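(* Fix an integer $p\ge3$, let $\lambda=\lambda_p=2\cos(\pi/p)$, and let $k$ be an odd positive integer. Let $F$ be an entire automorphic integral of weight $2k$ on $G_p$ with zero constant term and Hecke-symmetric rational period function $q=q^*+c_0q_0$, where $q^*(z)=\sum_{\ell=1}^L d_\ell\sum_{\alpha\in\mathcal Z_{\mathcal A_\ell}}Q_\alpha(z)^{-k}$ with hyperbolic classes $\mathcal A_\ell=-\mathcal A_\ell$ of discriminant $D_\ell$, and $q_0$ has poles only at $0$. Let $R(s)$ be the remainder term of the associated Dirichlet series, i.e. the meromorphic function with $\Phi(2k-s)+\Phi(s)=R(s)$, where $\Phi(s)=\int_0^\infty F(iy)y^s\frac{dy}{y}$ (continued meromorphically); regard $R$ as the linear combination $R=-\sum_{\ell=1}^L d_\ell D_\ell^{-k/2}\sum_{\alpha\in\mathcal Z_{\mathcal A_\ell}} R(s;\alpha,\alpha')$, which equals the remainder term for $0<\operatorname{Re}s<2k$. Then $$R+\rho(R)+\rho^2(R)+\cdots+\rho^{p-1}(R)=0.$$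
   Context: $S=\begin{pmatrix}1&\lambda\\0&1\end{pmatrix}$, $T=\begin{pmatrix}0&-1\\1&0\end{pmatrix}$, $G_p=\langle S,T\rangle/\{\pm I\}$ acting by linear fractional transformations, and $U=ST=\begin{pmatrix}\lambda&-1\\1&0\end{pmatrix}$. An entire automorphic integral of weight $2k$ on $G_p$ with rational period function $q$ is $F$ holomorphic on the upper half-plane, $F(z)=\sum_{n\ge0}a_ne^{2\pi inz/\lambda}$, with $z^{-2k}F(-1/z)=F(z)+q(z)$ and $q$ rational. Hyperbolic elements have $|\text{trace}|>2$; primitive means not a proper power in $G_p$. A hyperbolic fixed point is a real number fixed by a hyperbolic element of $G_p$; its Hecke conjugate $\alpha'$ is the other fixed point of its stabilizer. A $\lambda$-BQF is $[A,B,C]$ with $A,B,C\in\mathbb Z[\lambda]$, $Q(x,y)=Ax^2+Bxy+Cy^2$, discriminant $B^2-4AC$, with $G_p$-action $(Q\circ M)(x,y)=Q(ax+by,cx+dy)$ and resulting equivalence classes. For a hyperbolic fixed point $\alpha$, $M_\alpha=\begin{pmatrix}a&b\\c&d\end{pmatrix}$ (with $a+d>0$) is the unique primitive hyperbolic element of positive trace with $\alpha=\frac{a-d+\sqrt{(a+d)^2-4}}{2c}$, $Q_\alpha=[c,d-a,-b]$, $Q_\alpha(z)=Q_\alpha(z,1)$; these are the hyperbolic forms, and a class is hyperbolic if it consists of them. For hyperbolic $Q=[A,B,C]$ of discriminant $D$, $\alpha_Q=\frac{-B+\sqrt D}{2A}$, and $Q$ is simple if $A>0>C$; $-\mathcal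 A=\{[-A,-B,-C]:[A,B,C]\in\mathcal A\}$, $\mathcal Z_{\mathcal A}=\{\alpha_Q:Q\in\mathcal A\text{ simple}\}$. For nonzero reals $a,b$ and $0<\operatorname{Re}s<2k$, $R(s;a,b)=(a-b)^k\int_0^\infty\frac{y^s}{(iy-a)^k(iy-b)^k}\frac{dy}{y}$. The map $\rho$ is defined on such expressions by $\rho(R(s;a,b))=-R(2k-s;a-\lambda,b-\lambda)$ (this function equals $R(s;U^{-1}a,U^{-1}b)$, so $\rho$ again yields expressions of the same form) and extended by linearity to finite linear combinations; $\rho$ has order $p$. *)

theory Defs
  imports "HOL-Complex_Analysis.Complex_Analysis" "HOL-Library.Poly_Mapping"
begin

subsection \<open>Hecke groups\<close>

definition hecke_lambda :: "nat \<Rightarrow> real" where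
  "hecke_lambda p = 2 * cos (pi / real p)"

definition hecke_S :: "nat \<Rightarrow> real^2^2" where
  "hecke_S p = vector [vector [1, hecke_lambda p], vector [0, 1]]"

definition hecke_T :: "real^2^2" where
  "hecke_T = vector [vector [0, -1], vector [1, 0]]"

definition hecke_U :: "nat \<Rightarrow> real^2^2" where
  "hecke_U p = hecke_S p ** hecke_T"

text \<open>The matrix group generated by \<open>S\<close> and \<open>T\<close>.  Elements of \<open>G\<^sub>p\<close> are
  matrices of this group up to sign (it contains \<open>- I = T\<^sup>2\<close>), so statements about
  elements of \<open>G\<^sub>p\<close> are phrased for matrices, up to sign where the sign matters.\<close>

inductive_set hecke_group :: "nat \<Rightarrow> (real^2^2) set" for p :: nat where
  one: "mat 1 \<in> hecke_group p"
| S: "hecke_S p \<in> hecke_group p"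
| T: "hecke_T \<in> hecke_group p"
| mult: "M \<in> hecke_group p \<Longrightarrow> N \<in> hecke_group p \<Longrightarrow> M ** N \<in> hecke_group p"
| inv: "M \<in> hecke_group p \<Longrightarrow> matrix_inv M \<in> hecke_group p"

definition hyperbolic :: "real^2^2 \<Rightarrow> bool" where
  "hyperbolic M \<longleftrightarrow> \<bar>trace M\<bar> > 2"

definition matpow :: "real^2^2 \<Rightarrow> nat \<Rightarrow> real^2^2" where
  "matpow M n = (((**) M) ^^ n) (mat 1)"

text \<open>Not a proper power in \<open>G\<^sub>p\<close>, i.e. up to sign.\<close>

definition primitive :: "nat \<Rightarrow> real^2^2 \<Rightarrow> bool" where
  "primitive p M \<longleftrightarrow>
     (\<forall>N\<in>hecke_group p. \<forall>n\<ge>2. M \<noteq> matpow N n \<and> M \<noteq> - matpow N n)"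

definition moebius :: "real^2^2 \<Rightarrow> real \<Rightarrow> real" where
  "moebius M x = (M$1$1 * x + M$1$2) / (M$2$1 * x + M$2$2)"

text \<open>The first conjunct says that \<open>x\<close> is not mapped to \<open>\<infinity>\<close>.\<close>

definition moebius_fixes :: "real^2^2 \<Rightarrow> real \<Rightarrow> bool" where
  "moebius_fixes M x \<longleftrightarrow> M$2$1 * x + M$2$2 \<noteq> 0 \<and> moebius M x = x"

definition hyperbolic_fixed_point :: "nat \<Rightarrow> real \<Rightarrow> bool" where
  "hyperbolic_fixed_point p \<alpha> \<longleftrightarrow>
     (\<exists>M\<in>hecke_group p. hyperbolic M \<and> moebius_fixes M \<alpha>)"

text \<open>The fixed point other than \<open>\<alpha>\<close> of the stabilizer of \<open>\<alpha>\<close>.\<close>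

definition hecke_conj :: "nat \<Rightarrow> real \<Rightarrow> real" where
  "hecke_conj p \<alpha> = (THE \<beta>. \<beta> \<noteq> \<alpha> \<and>
     (\<forall>M\<in>hecke_group p. moebius_fixes M \<alpha> \<longrightarrow> moebius_fixes M \<beta>))"


subsection \<open>Binary quadratic forms over \<open>\<int>[\<lambda>]\<close>\<close>

text \<open>The triple \<open>(A, B, C)\<close> is the form \<open>[A, B, C]\<close>.\<close>

type_synonym bqf = "real \<times> real \<times> real"

definition Z_lambda :: "nat \<Rightarrow> real set" where
  "Z_lambda p = range (\<lambda>f :: int poly. poly (map_poly of_int f) (hecke_lambda p))"

definition lambda_bqf :: "nat \<Rightarrow> bqf \<Rightarrow> bool" where
  "lambda_bqf p = (\<lambda>(A, B, C). A \<in> Z_lambda p \<and> B \<in> Z_lambda p \<and> C \<in> Z_lambda p)"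

definition bqf_eval :: "bqf \<Rightarrow> complex \<Rightarrow> complex \<Rightarrow> complex" where
  "bqf_eval = (\<lambda>(A, B, C) x y.
     of_real A * x\<^sup>2 + of_real B * x * y + of_real C * y\<^sup>2)"

definition bqf_disc :: "bqf \<Rightarrow> real" where
  "bqf_disc = (\<lambda>(A, B, C). B\<^sup>2 - 4 * A * C)"

text \<open>\<open>(Q \<circ> M)(x, y) = Q(ax + by, cx + dy)\<close>, written out in coefficients;
  see \<open>bqf_eval_act\<close> below.\<close>

definition bqf_act :: "bqf \<Rightarrow> real^2^2 \<Rightarrow> bqf" where
  "bqf_act = (\<lambda>(A, B, C) M. let a = M$1$1; b = M$1$2; c = M$2$1; d = M$2$2 in
     (A * a\<^sup>2 + B * a * c + C * c\<^sup>2,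
      2 * A * a * b + B * (a * d + b * c) + 2 * C * c * d,
      A * b\<^sup>2 + B * b * d + C * d\<^sup>2))"

lemma bqf_eval_act:
  "bqf_eval (bqf_act Q M) x y =
     bqf_eval Q (of_real (M$1$1) * x + of_real (M$1$2) * y)
                (of_real (M$2$1) * x + of_real (M$2$2) * y)"
  by (cases Q) (simp add: bqf_eval_def bqf_act_def Let_def algebra_simps power2_eq_square)

definition bqf_class :: "nat \<Rightarrow> bqf \<Rightarrow> bqf set" where
  "bqf_class p Q = bqf_act Q ` hecke_group p"

definition M_of :: "nat \<Rightarrow> real \<Rightarrow> real^2^2" where
  "M_of p \<alpha> = (THE M. M \<in> hecke_group p \<and> hyperbolic M \<and> primitive p M \<and> trace M > 0 \<and>
     \<alpha> = (M$1$1 - M$2$2 + sqrt ((M$1$1 + M$2$2)\<^sup>2 - 4)) / (2 * M$2$1))"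

definition Q_of :: "nat \<Rightarrow> real \<Rightarrow> bqf" where
  "Q_of p \<alpha> = (let M = M_of p \<alpha> in (M$2$1, M$2$2 - M$1$1, - M$1$2))"

definition hyperbolic_form :: "nat \<Rightarrow> bqf \<Rightarrow> bool" where
  "hyperbolic_form p Q \<longleftrightarrow> (\<exists>\<alpha>. hyperbolic_fixed_point p \<alpha> \<and> Q = Q_of p \<alpha>)"

definition hyperbolic_class :: "nat \<Rightarrow> bqf set \<Rightarrow> bool" where
  "hyperbolic_class p \<A> \<longleftrightarrow>
     (\<exists>Q. lambda_bqf p Q \<and> \<A> = bqf_class p Q) \<and> (\<forall>Q\<in>\<A>. hyperbolic_form p Q)"

definition alpha_of :: "bqf \<Rightarrow> real" where
  "alpha_of Q = (case Q of (A, B, C) \<Rightarrow> (- B + sqrt (bqf_disc Q)) / (2 * A))"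

definition bqf_simple :: "bqf \<Rightarrow> bool" where
  "bqf_simple = (\<lambda>(A, B, C). A > 0 \<and> 0 > C)"

definition Z_set :: "bqf set \<Rightarrow> real set" where
  "Z_set \<A> = alpha_of ` {Q \<in> \<A>. bqf_simple Q}"


subsection \<open>Automorphic integrals with rational period functions\<close>

text \<open>A rational function in lowest terms; division by zero gives the value \<open>0\<close> at its poles.\<close>

definition rational_function :: "(complex \<Rightarrow> complex) \<Rightarrow> bool" where
  "rational_function q \<longleftrightarrow>
     (\<exists>P N. N \<noteq> 0 \<and> coprime P N \<and> q = (\<lambda>z. poly P z / poly N z))"

text \<open>\<open>a\<close> is the sequence of Fourier coefficients of \<open>F\<close>; the weight is \<open>2k\<close>.\<close>

definition entire_automorphic_integral ::
  "nat \<Rightarrow> nat \<Rightarrow> (complex \<Rightarrow> complex) \<Rightarrow> (nat \<Rightarrow> complex) \<Rightarrow> (complex \<Rightarrow> complex) \<Rightarrow> bool" where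
  "entire_automorphic_integral p k F a q \<longleftrightarrow>
     F holomorphic_on {z. Im z > 0} \<and>
     (\<forall>z. Im z > 0 \<longrightarrow>
        (\<lambda>n. a n * exp (2 * of_real pi * \<i> * of_nat n * z / of_real (hecke_lambda p))) sums F z) \<and>
     rational_function q \<and>
     (\<forall>z. Im z > 0 \<longrightarrow> F (- 1 / z) / z ^ (2 * k) = F z + q z)"

text \<open>The set of nonzero poles is closed under Hecke conjugation.\<close>

definition hecke_symmetric :: "nat \<Rightarrow> (complex \<Rightarrow> complex) \<Rightarrow> bool" where
  "hecke_symmetric p q \<longleftrightarrow>
     (\<forall>\<alpha> :: real. \<alpha> \<noteq> 0 \<and> is_pole q (of_real \<alpha>) \<longrightarrow> is_pole q (of_real (hecke_conj p \<alpha>)))"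

definition q_star ::
  "nat \<Rightarrow> nat \<Rightarrow> nat \<Rightarrow> (nat \<Rightarrow> complex) \<Rightarrow> (nat \<Rightarrow> bqf set) \<Rightarrow> complex \<Rightarrow> complex" where
  "q_star p k L d \<A> z =
     (\<Sum>l=1..L. d l * (\<Sum>\<alpha>\<in>Z_set (\<A> l). 1 / bqf_eval (Q_of p \<alpha>) z 1 ^ k))"


subsection \<open>The remainder term\<close>

text \<open>\<open>\<Phi>\<close> is the meromorphic continuation of \<open>\<integral>\<^sub>0\<^sup>\<infinity> F(iy) y\<^sup>s dy/y\<close>, an integral that
  converges in some right half-plane.\<close>

definition mellin_continuation :: "(complex \<Rightarrow> complex) \<Rightarrow> (complex \<Rightarrow> complex) \<Rightarrow> bool" where
  "mellin_continuation F \<Phi> \<longleftrightarrow>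
     \<Phi> nicely_meromorphic_on UNIV \<and>
     (\<exists>\<sigma>::real. \<forall>s. Re s > \<sigma> \<longrightarrow>
        set_integrable lborel {0<..} (\<lambda>y::real. F (\<i> * of_real y) * of_real y powr s / of_real y) \<and>
        \<Phi> s = set_lebesgue_integral lborel {0<..}
                (\<lambda>y::real. F (\<i> * of_real y) * of_real y powr s / of_real y))"

definition remainder_term :: "nat \<Rightarrow> (complex \<Rightarrow> complex) \<Rightarrow> (complex \<Rightarrow> complex) \<Rightarrow> bool" where
  "remainder_term k \<Phi> R \<longleftrightarrow>
     R nicely_meromorphic_on UNIV \<and>
     (\<forall>s. \<not> is_pole \<Phi> s \<and> \<not> is_pole \<Phi> (of_nat (2 * k) - s) \<longrightarrow>
        \<Phi> (of_nat (2 * k) - s) + \<Phi> s = R s)"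

definition hecke_R :: "nat \<Rightarrow> complex \<Rightarrow> real \<Rightarrow> real \<Rightarrow> complex" where
  "hecke_R k s a b = of_real (a - b) ^ k *
     set_lebesgue_integral lborel {0<..} (\<lambda>y::real.
       of_real y powr s / ((\<i> * of_real y - of_real a) ^ k * (\<i> * of_real y - of_real b) ^ k)
         / of_real y)"


subsection \<open>Linear combinations of the functions \<open>R(s; a, b)\<close> and the map \<open>\<rho>\<close>\<close>

text \<open>A formal linear combination; the basis element \<open>(a, b)\<close> stands for the expression
  \<open>R(s; a, b)\<close>, and \<open>R_eval\<close> is the function of \<open>s\<close> denoted by the combination.\<close>

type_synonym R_comb = "(real \<times> real) \<Rightarrow>\<^sub>0 complex"

definition R_eval :: "nat \<Rightarrow> R_comb \<Rightarrow> complex \<Rightarrow> complex" where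
  "R_eval k X s = (\<Sum>(a, b)\<in>Poly_Mapping.keys X. Poly_Mapping.lookup X (a, b) * hecke_R k s a b)"

text \<open>\<open>\<rho>(R(s; a, b)) = - R(2k - s; a - \<lambda>, b - \<lambda>)\<close>, which as an expression of the same form is
  \<open>R(s; U\<^sup>-\<^sup>1a, U\<^sup>-\<^sup>1b)\<close>; the agreement is \<open>R_eval_rho_single\<close> below.\<close>

definition rho :: "nat \<Rightarrow> R_comb \<Rightarrow> R_comb" where
  "rho p X = (\<Sum>(a, b)\<in>Poly_Mapping.keys X.
     Poly_Mapping.single
       (moebius (matrix_inv (hecke_U p)) a, moebius (matrix_inv (hecke_U p)) b)
       (Poly_Mapping.lookup X (a, b)))"

definition R_remainder ::
  "nat \<Rightarrow> nat \<Rightarrow> nat \<Rightarrow> (nat \<Rightarrow> complex) \<Rightarrow> (nat \<Rightarrow> real) \<Rightarrow> (nat \<Rightarrow> bqf set) \<Rightarrow> R_comb" where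
  "R_remainder p k L d D \<A> =
     - (\<Sum>l=1..L. \<Sum>\<alpha>\<in>Z_set (\<A> l).
          Poly_Mapping.single (\<alpha>, hecke_conj p \<alpha>) (d l * of_real (D l powr (- (real k / 2)))))"

lemma R_eval_single: "R_eval k (Poly_Mapping.single (a, b) c) s = c * hecke_R k s a b"
  by (cases "c = 0") (simp_all add: R_eval_def)

lemma R_eval_superset:
  assumes "finite K" "Poly_Mapping.keys X \<subseteq> K"
  shows "R_eval k X s = (\<Sum>(a, b)\<in>K. Poly_Mapping.lookup X (a, b) * hecke_R k s a b)"
  unfolding R_eval_def
  by (rule sum.mono_neutral_left) (use assms in \<open>auto simp: in_keys_iff\<close>)

lemma R_eval_add: "R_eval k (X + Y) s = R_eval k X s + R_eval k Y s"
proof -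
  let ?K = "Poly_Mapping.keys X \<union> Poly_Mapping.keys Y"
  have sub: "Poly_Mapping.keys (X + Y) \<subseteq> ?K"
    by (rule Poly_Mapping.keys_add)
  show ?thesis
    by (subst (1 2 3) R_eval_superset[of ?K])
       (use sub in \<open>auto simp: lookup_add algebra_simps sum.distrib[symmetric] intro!: sum.cong\<close>)
qed

lemma rho_superset:
  assumes "finite K" "Poly_Mapping.keys X \<subseteq> K"
  shows "rho p X = (\<Sum>(a, b)\<in>K. Poly_Mapping.single
       (moebius (matrix_inv (hecke_U p)) a, moebius (matrix_inv (hecke_U p)) b)
       (Poly_Mapping.lookup X (a, b)))"
  unfolding rho_def
  by (rule sum.mono_neutral_left) (use assms in \<open>auto simp: in_keys_iff\<close>)

lemma rho_add: "rho p (X + Y) = rho p X + rho p Y"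
proof -
  let ?K = "Poly_Mapping.keys X \<union> Poly_Mapping.keys Y"
  have sub: "Poly_Mapping.keys (X + Y) \<subseteq> ?K"
    by (rule Poly_Mapping.keys_add)
  show ?thesis
    by (subst (1 2 3) rho_superset[of ?K])
       (use sub in \<open>auto simp: lookup_add single_add sum.distrib[symmetric] intro!: sum.cong\<close>)
qed

lemma rho_single:
  "rho p (Poly_Mapping.single (a, b) c) = Poly_Mapping.single
     (moebius (matrix_inv (hecke_U p)) a, moebius (matrix_inv (hecke_U p)) b) c"
  by (cases "c = 0") (simp_all add: rho_def)

lemma hecke_U_eq: "hecke_U p = vector [vector [hecke_lambda p, -1], vector [1, 0]]"
  unfolding hecke_U_def hecke_S_def hecke_T_def
  by (simp add: vec_eq_iff forall_2 matrix_matrix_mult_def sum_2)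

lemma matrix_inv_hecke_U:
  "matrix_inv (hecke_U p) = vector [vector [0, 1], vector [-1, hecke_lambda p]]"
proof -
  let ?V = "vector [vector [0, 1], vector [-1, hecke_lambda p]] :: real^2^2"
  have UV: "hecke_U p ** ?V = mat 1" and VU: "?V ** hecke_U p = mat 1"
    unfolding hecke_U_eq
    by (simp_all add: vec_eq_iff forall_2 matrix_matrix_mult_def sum_2 mat_def)
  hence "matrix_inv (hecke_U p) ** hecke_U p = mat 1"
    unfolding matrix_inv_def by (rule someI2[of _ ?V, OF conjI]) auto
  hence "matrix_inv (hecke_U p) ** hecke_U p ** ?V = ?V" by simp
  thus ?thesis by (simp add: matrix_mul_assoc[symmetric] UV)
qed

lemma moebius_inv_hecke_U: "moebius (matrix_inv (hecke_U p)) x = - 1 / (x - hecke_lambda p)"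
  by (simp add: moebius_def matrix_inv_hecke_U minus_divide_left [symmetric]
        divide_minus_right [symmetric] del: divide_minus_right)

lemma integral_inversion:
  fixes f :: "real \<Rightarrow> complex"
  assumes f [measurable]: "f \<in> borel_measurable borel"
  shows "set_lebesgue_integral lborel {0<..} f =
         set_lebesgue_integral lborel {0<..} (\<lambda>y. f (1 / y) /\<^sub>R y\<^sup>2)"
proof -
  let ?g = "\<lambda>y. f (1 / y) /\<^sub>R y\<^sup>2"
  let ?h = "\<lambda>y::real. \<bar>- (1 / y\<^sup>2)\<bar> *\<^sub>R f (1 / y)"
  have gh: "?h = ?g"
    by (auto simp: fun_eq_iff divide_inverse)
  have img: "(\<lambda>y::real. 1 / y) ` {0<..} = {0<..}"
    by (force simp: image_iff intro!: bexI[of _ "1 / _"])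
  have der: "((\<lambda>y::real. 1 / y) has_field_derivative - (1 / x\<^sup>2)) (at x within {0<..})"
    if "x \<in> {0<..}" for x
    using that by (auto intro!: derivative_eq_intros simp: power2_eq_square)
  have inj: "inj_on (\<lambda>y::real. 1 / y) {0<..}"
    by (auto simp: inj_on_def)
  have meas: "{0::real<..} \<in> sets lebesgue" by simp
  have iff: "f absolutely_integrable_on {0<..} \<longleftrightarrow> ?g absolutely_integrable_on {0<..}"
    using absolutely_integrable_change_of_variables_real[OF meas der inj, of f]
    unfolding img gh .
  have borel: "set_integrable lborel {0<..} u \<longleftrightarrow> u absolutely_integrable_on {0<..}"
    if [measurable]: "u \<in> borel_measurable borel" for u :: "real \<Rightarrow> complex"
    unfolding set_integrable_def by (rule integrable_completion[symmetric]) measurable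
  have g: "?g \<in> borel_measurable borel" by measurable
  show ?thesis
  proof (cases "set_integrable lborel {0<..} f")
    case True
    hence fa: "f absolutely_integrable_on {0<..}" by (simp add: borel f)
    hence ga: "?g absolutely_integrable_on {0<..}" using iff by simp
    have "integral {0<..} ?g = integral {0<..} f"
      using has_absolute_integral_change_of_variables_real[OF meas der inj, of f "integral {0<..} f"] fa
      unfolding img gh by blast
    thus ?thesis
      using True ga borel[OF g] by (simp add: set_borel_integral_eq_integral)
  next
    case False
    hence "\<not> set_integrable lborel {0<..} ?g"
      using iff borel[OF f] borel[OF g] by simp
    thus ?thesis using False
      unfolding set_integrable_def set_lebesgue_integral_def
      by (simp add: not_integrable_integral_eq)
  qed
qed

lemma hecke_R_reflect:
  assumes "a \<noteq> 0" "b \<noteq> 0" "odd k"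
  shows "hecke_R k s (- 1 / a) (- 1 / b) = - hecke_R k (of_nat (2 * k) - s) a b"
proof -
  let ?f = "\<lambda>s a b (y::real). of_real y powr s /
     ((\<i> * of_real y - of_real a) ^ k * (\<i> * of_real y - of_real b) ^ k) / (of_real y :: complex)"
  have meas: "?f s a b \<in> borel_measurable borel" for s a b
    by measurable
  have eq: "?f (of_nat (2 * k) - s) a b (1 / y) /\<^sub>R y\<^sup>2 =
      - (1 / of_real (a * b) ^ k) * ?f s (- 1 / a) (- 1 / b) y" if y: "y > 0" for y
  proof -
    have pw: "of_real (1 / y) powr (of_nat (2 * k) - s) =
        of_real y powr s / (of_real y :: complex) ^ (2 * k)"
    proof -
      have "of_real (1 / y) powr (of_nat (2 * k) - s) =
          exp ((of_nat (2 * k) - s) * of_real (ln (1 / y)))"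
        using y by (simp add: powr_def Ln_of_real[symmetric] del: of_real_divide)
      also have "\<dots> = exp (s * of_real (ln y) - of_nat (2 * k) * of_real (ln y))"
        using y by (simp add: ln_div algebra_simps)
      also have "\<dots> = exp (s * of_real (ln y)) / exp (of_real (ln y)) ^ (2 * k)"
        by (simp only: exp_diff exp_of_nat_mult)
      also have "exp (of_real (ln y)) = (of_real y :: complex)"
        using y by (simp add: exp_of_real)
      also have "exp (s * of_real (ln y)) = of_real y powr s"
        using y by (simp add: powr_def Ln_of_real)
      finally show ?thesis .
    qed
    have lin: "\<i> * of_real (1 / y) - of_real c =
        (\<i> * of_real c / of_real y) * (\<i> * of_real y - of_real (- 1 / c))" if "c \<noteq> 0" for c
      using that y by (simp add: field_simps)
    have sq: "(\<i> * of_real a / of_real y) ^ k * (\<i> * of_real b / of_real y) ^ k =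
        - (of_real (a * b) ^ k / (of_real y :: complex) ^ (2 * k))"
    proof -
      have "(\<i> * of_real a / of_real y) ^ k * (\<i> * of_real b / of_real y) ^ k =
          (- 1 * (of_real (a * b) / (of_real y :: complex) ^ 2)) ^ k"
        by (simp add: power_mult_distrib[symmetric] power2_eq_square algebra_simps)
      also have "\<dots> = - ((of_real (a * b) / (of_real y :: complex) ^ 2) ^ k)"
        using assms(3) by (simp only: power_mult_distrib) simp
      finally show ?thesis
        by (simp add: power_divide power_mult)
    qed
    define X where
      "X = (\<i> * of_real y - of_real (- 1 / a)) ^ k * (\<i> * of_real y - of_real (- 1 / b)) ^ k"
    define P where "P = (of_real (a * b) :: complex) ^ k"
    define Y where "Y = (of_real y :: complex) ^ (2 * k)"
    have nz: "P \<noteq> 0" "Y \<noteq> 0"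
      using assms y by (auto simp: P_def Y_def)
    have den: "(\<i> * of_real (1 / y) - of_real a) ^ k * (\<i> * of_real (1 / y) - of_real b) ^ k =
        - (P / Y) * X"
      unfolding lin[OF assms(1)] lin[OF assms(2)] P_def Y_def X_def sq[symmetric] power_mult_distrib
      by (simp only: mult_ac)
    show ?thesis
      unfolding pw den X_def[symmetric] P_def[symmetric] Y_def[symmetric] using y nz
      by (simp add: scaleR_conv_of_real divide_simps power2_eq_square)
  qed
  have "set_lebesgue_integral lborel {0<..} (?f (of_nat (2 * k) - s) a b) =
      set_lebesgue_integral lborel {0<..}
        (\<lambda>y. - (1 / of_real (a * b) ^ k) * ?f s (- 1 / a) (- 1 / b) y)"
    unfolding integral_inversion[OF meas]
    by (rule set_lebesgue_integral_cong) (use eq in auto)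
  also have "\<dots> = - (1 / of_real (a * b) ^ k) *
      set_lebesgue_integral lborel {0<..} (?f s (- 1 / a) (- 1 / b))"
    by (rule set_integral_mult_right)
  finally have I: "set_lebesgue_integral lborel {0<..} (?f (of_nat (2 * k) - s) a b) = \<dots>" .
  have "of_real (- 1 / a - - 1 / b) = (of_real (a - b) / of_real (a * b) :: complex)"
    using assms by (simp add: field_simps)
  hence "of_real (- 1 / a - - 1 / b) ^ k = (of_real (a - b) ^ k / of_real (a * b) ^ k :: complex)"
    by (simp only: power_divide)
  thus ?thesis
    unfolding hecke_R_def I by simp
qed

lemma R_eval_rho_single:
  assumes "a \<noteq> hecke_lambda p" "b \<noteq> hecke_lambda p" "odd k"
  shows "R_eval k (rho p (Poly_Mapping.single (a, b) c)) s =
         c * (- hecke_R k (of_nat (2 * k) - s) (a - hecke_lambda p) (b - hecke_lambda p))"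
  unfolding rho_single R_eval_single moebius_inv_hecke_U
  by (subst hecke_R_reflect) (use assms in auto)

end

theory Submission
  imports Defs "HOL-Computational_Algebra.Fundamental_Theorem_Algebra"
begin

text \<open>
  Write \<open>s\<^sub>j = sin (j\<pi>/p) / sin (\<pi>/p)\<close>. The matrices \<open>V\<^sub>j = - U\<^sup>j T\<close> with \<open>0 < j < p\<close> have the
  entries \<open>s\<^sub>j\<close>, \<open>s\<^sub>j\<^sub>+\<^sub>1\<close>, \<open>s\<^sub>j\<^sub>-\<^sub>1\<close>, each of them \<open>0\<close> or at least \<open>1\<close>, and multiplication by \<open>V\<^sub>j\<close>
  increases the sum of the entries by at least \<open>1\<close>. Every element of the Hecke group is, up to sign
  and factors \<open>T\<close> at both ends, a word in the \<open>V\<^sub>j\<close>; so the group is discrete, and the entries of its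
  elements are \<open>0\<close> or at least \<open>1\<close> in absolute value. Discreteness makes the stabilizer of a
  hyperbolic fixed point infinite cyclic up to sign, whence \<open>M\<^sub>\<alpha>\<close>, \<open>Q\<^sub>\<alpha>\<close> and the Hecke conjugate are
  well defined; it also leaves only finitely many simple forms of a given discriminant.

  The map \<open>\<rho>\<close> acts on the root pair of a form \<open>Q\<close> as \<open>Q \<mapsto> Q \<circ> U\<close>, so the sum in question runs over
  the simple forms \<open>Q\<close>, with a summand that is invariant under \<open>U\<close> and changes its sign under
  \<open>Q \<mapsto> - Q\<close>, as \<open>R(s; b, a) = - R(s; a, b)\<close> for odd \<open>k\<close>. Such a sum vanishes because the
  leading coefficient of \<open>Q\<close> is the last coefficient of \<open>Q \<circ> U\<close>.

  The formula for the remainder term is Riemann's argument: splitting the Mellin integral at \<open>1\<close> and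
  using the transformation law expresses \<open>\<Phi>\<close> on \<open>Re s > 0\<close> by holomorphic tail integrals and a
  rational function coming from \<open>c\<^sub>0 q\<^sub>0\<close>, whose contributions at \<open>s\<close> and \<open>2k - s\<close> cancel.
\<close>

unbundle no Formal_Power_Series.fps_syntax


subsection \<open>Real two-by-two matrices\<close>

lemma matrix_mult_uminus:
  fixes M :: "'a::ring_1^'n^'m" and N :: "'a^'k^'n"
  shows "M ** (- N) = - (M ** N)" "(- M) ** N = - (M ** N)"
  by (simp_all add: vec_eq_iff matrix_matrix_mult_def sum_negf)

lemma matrix_inv_eqI:
  fixes M N :: "'a::field^'n^'n"
  assumes "M ** N = mat 1"
  shows "matrix_inv M = N"
proof -
  have "N ** M = mat 1"
    using assms matrix_left_right_inverse by blast
  with assms have "matrix_inv M ** M = mat 1"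
    unfolding matrix_inv_def by (metis (mono_tags, lifting) someI_ex)
  hence "matrix_inv M ** M ** N = N"
    by simp
  thus ?thesis
    by (simp add: matrix_mul_assoc[symmetric] assms)
qed

lemma matrix_inv_right:
  fixes M :: "'a::field^'n^'n"
  assumes "det M \<noteq> 0"
  shows "M ** matrix_inv M = mat 1"
  using assms matrix_inv_eqI by (metis invertible_def invertible_det_nz)

lemma matrix_inv_mult:
  fixes M N :: "'a::field^'n^'n"
  assumes "det M \<noteq> 0" "det N \<noteq> 0"
  shows "matrix_inv (M ** N) = matrix_inv N ** matrix_inv M"
proof (rule matrix_inv_eqI)
  have "M ** (N ** matrix_inv N) ** matrix_inv M = mat 1"
    using assms by (simp add: matrix_inv_right)
  thus "M ** N ** (matrix_inv N ** matrix_inv M) = mat 1"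
    by (simp add: matrix_mul_assoc)
qed

lemma matrix_inv_matrix_inv:
  fixes M :: "'a::field^'n^'n"
  assumes "det M \<noteq> 0"
  shows "matrix_inv (matrix_inv M) = M"
  using matrix_inv_right[OF assms] matrix_left_right_inverse by (metis matrix_inv_eqI)

lemma conjugate_mult:
  fixes P R X Y :: "'a::semiring_1^'n^'n"
  assumes "R ** P = mat 1"
  shows "(P ** X ** R) ** (P ** Y ** R) = P ** (X ** Y) ** R"
proof -
  have "(P ** X ** R) ** (P ** Y ** R) = P ** X ** (R ** P) ** Y ** R"
    by (simp add: matrix_mul_assoc)
  thus ?thesis
    by (simp add: assms matrix_mul_assoc)
qed

lemma conjugate_cancel:
  fixes P R X :: "'a::semiring_1^'n^'n"
  assumes "R ** P = mat 1"
  shows "R ** (P ** X ** R) ** P = X"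
  by (metis assms matrix_mul_assoc matrix_mul_lid matrix_mul_rid)

lemma matpow_conjugate:
  assumes "P ** R = mat 1" "R ** P = mat 1"
  shows "matpow (P ** X ** R) n = P ** matpow X n ** R"
  by (induction n) (simp_all add: matpow_def assms conjugate_mult)

lemma matpow_commute: "N ** matpow N n = matpow N n ** N"
  by (induction n) (simp_all add: matpow_def matrix_mul_assoc)

definition mat2 :: "real \<Rightarrow> real \<Rightarrow> real \<Rightarrow> real \<Rightarrow> real^2^2" where
  "mat2 a b c d = vector [vector [a, b], vector [c, d]]"

lemma mat2_nth [simp]:
  "mat2 a b c d $ 1 $ 1 = a" "mat2 a b c d $ 1 $ 2 = b"
  "mat2 a b c d $ 2 $ 1 = c" "mat2 a b c d $ 2 $ 2 = d"
  by (simp_all add: mat2_def)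

lemma mat2_eq_iff [simp]:
  "mat2 a b c d = mat2 a' b' c' d' \<longleftrightarrow> a = a' \<and> b = b' \<and> c = c' \<and> d = d'"
  by (metis mat2_nth)

lemma mat2_collapse: "mat2 (M$1$1) (M$1$2) (M$2$1) (M$2$2) = M"
  by (simp add: vec_eq_iff forall_2)

lemma mat2_cases: obtains a b c d where "M = mat2 a b c d"
  by (metis mat2_collapse)

lemma mat2_mult [simp]:
  "mat2 a b c d ** mat2 a' b' c' d' =
     mat2 (a * a' + b * c') (a * b' + b * d') (c * a' + d * c') (c * b' + d * d')"
  by (simp add: vec_eq_iff forall_2 matrix_matrix_mult_def sum_2)

lemma mat_1_eq_mat2: "mat 1 = mat2 1 0 0 1"
  by (simp add: vec_eq_iff forall_2 mat_def)

lemma uminus_mat2 [simp]: "- mat2 a b c d = mat2 (- a) (- b) (- c) (- d)"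
  by (simp add: vec_eq_iff forall_2)

lemma det_mat2 [simp]: "det (mat2 a b c d) = a * d - b * c"
  by (simp add: det_2)

lemma trace_mat2 [simp]: "trace (mat2 a b c d) = a + d"
  by (simp add: trace_def sum_2)

lemma matrix_inv_mat2:
  "a * d - b * c = 1 \<Longrightarrow> matrix_inv (mat2 a b c d) = mat2 d (- b) (- c) a"
  by (rule matrix_inv_eqI) (simp add: mat_1_eq_mat2 algebra_simps)

definition bounded_entries :: "real \<Rightarrow> real^'n^'m \<Rightarrow> bool" where
  "bounded_entries K M \<longleftrightarrow> (\<forall>i j. \<bar>M$i$j\<bar> \<le> K)"

lemma bounded_entries_mat2 [simp]:
  "bounded_entries K (mat2 a b c d) \<longleftrightarrow> \<bar>a\<bar> \<le> K \<and> \<bar>b\<bar> \<le> K \<and> \<bar>c\<bar> \<le> K \<and> \<bar>d\<bar> \<le> K"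
  by (auto simp: bounded_entries_def forall_2)

lemma bounded_entries_mult:
  fixes M :: "real^'n^'m" and N :: "real^'k^'n"
  assumes "bounded_entries K M" "bounded_entries L N"
  shows "bounded_entries (real CARD('n) * (K * L)) (M ** N)"
  unfolding bounded_entries_def
proof (intro allI)
  fix i j
  have "0 \<le> K"
    using assms(1) abs_ge_zero order_trans unfolding bounded_entries_def by blast
  hence "\<bar>M$i$m * N$m$j\<bar> \<le> K * L" for m
    using assms unfolding abs_mult bounded_entries_def by (intro mult_mono) auto
  hence "(\<Sum>m\<in>UNIV. \<bar>M$i$m * N$m$j\<bar>) \<le> real CARD('n) * (K * L)"
    using sum_bounded_above[of UNIV "\<lambda>m. \<bar>M$i$m * N$m$j\<bar>" "K * L"] by simp
  thus "\<bar>(M ** N)$i$j\<bar> \<le> real CARD('n) * (K * L)"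
    by (simp add: matrix_matrix_mult_def order_trans[OF sum_abs])
qed

lemma ex_bounded_entries:
  fixes M :: "real^'n^'m"
  shows "\<exists>K. bounded_entries K M"
proof -
  have "bounded_entries (Max (range (\<lambda>(i, j). \<bar>M$i$j\<bar>))) M"
    unfolding bounded_entries_def by (auto intro!: Max_ge image_eqI[of _ _ "(_, _)"])
  thus ?thesis ..
qed


subsection \<open>Discrete subgroups of \<open>SL\<^sub>2(\<real>)\<close>\<close>

locale discrete_SL2 =
  fixes \<Gamma> :: "(real^2^2) set"
  assumes mult: "M \<in> \<Gamma> \<Longrightarrow> N \<in> \<Gamma> \<Longrightarrow> M ** N \<in> \<Gamma>"
    and inv: "M \<in> \<Gamma> \<Longrightarrow> matrix_inv M \<in> \<Gamma>"
    and uminus: "M \<in> \<Gamma> \<Longrightarrow> - M \<in> \<Gamma>"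
    and det: "M \<in> \<Gamma> \<Longrightarrow> det M = 1"
    and finite_bounded: "finite {M \<in> \<Gamma>. bounded_entries K M}"
begin

lemma finite_bounded_conjugate:
  fixes P R :: "real^2^2"
  assumes "R ** P = mat 1"
  shows "finite {X. P ** X ** R \<in> \<Gamma> \<and> bounded_entries K X}"
proof -
  obtain KP KR where KP: "bounded_entries KP P" and KR: "bounded_entries KR R"
    using ex_bounded_entries by meson
  define L where "L = real CARD(2) * (real CARD(2) * (KP * K) * KR)"
  have "bounded_entries L (P ** X ** R)" if "bounded_entries K X" for X
    unfolding L_def by (rule bounded_entries_mult[OF bounded_entries_mult[OF KP that] KR])
  hence "{X. P ** X ** R \<in> \<Gamma> \<and> bounded_entries K X} \<subseteq>
      (\<lambda>M. R ** M ** P) ` {M \<in> \<Gamma>. bounded_entries L M}"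
    using conjugate_cancel[OF assms]
    by (force intro: image_eqI[of _ _ "P ** _ ** R"])
  thus ?thesis
    by (rule finite_subset) (intro finite_imageI finite_bounded)
qed

lemma discrete_SL2_conjugate:
  assumes PR: "P ** R = mat 1"
  shows "discrete_SL2 {X. P ** X ** R \<in> \<Gamma>}"
proof
  have RP: "R ** P = mat 1"
    using PR matrix_left_right_inverse by blast
  have det_PR: "det P * det R = 1"
    using PR by (metis det_I det_mul)
  have det_conj: "det X = 1" if "P ** X ** R \<in> \<Gamma>" for X
  proof -
    have "(det P * det R) * det X = 1"
      using det[OF that] by (simp add: det_mul mult_ac)
    thus ?thesis
      by (simp add: det_PR)
  qed
  fix X Y K
  show "finite {X \<in> {X. P ** X ** R \<in> \<Gamma>}. bounded_entries K X}"
    using finite_bounded_conjugate[OF RP] by simp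
  assume "X \<in> {X. P ** X ** R \<in> \<Gamma>}"
  hence X: "P ** X ** R \<in> \<Gamma>"
    by simp
  show "det X = 1"
    by (rule det_conj[OF X])
  show "- X \<in> {X. P ** X ** R \<in> \<Gamma>}"
    using uminus[OF X] by (simp add: matrix_mult_uminus)
  have "(P ** X ** R) ** (P ** matrix_inv X ** R) = mat 1"
    by (simp add: conjugate_mult[OF RP] matrix_inv_right det_conj[OF X] PR)
  thus "matrix_inv X \<in> {X. P ** X ** R \<in> \<Gamma>}"
    using inv[OF X] by (simp add: matrix_inv_eqI)
  assume "Y \<in> {X. P ** X ** R \<in> \<Gamma>}"
  thus "X ** Y \<in> {X. P ** X ** R \<in> \<Gamma>}"
    using mult[OF X, of "P ** Y ** R"] by (simp add: conjugate_mult[OF RP])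
qed

lemma conjugate_unipotent_mem:
  assumes "mat2 t y 0 u \<in> \<Gamma>" "mat2 1 x 0 1 \<in> \<Gamma>"
  shows "mat2 1 (t\<^sup>2 * x) 0 1 \<in> \<Gamma>"
proof -
  have tu: "t * u = 1"
    using det[OF assms(1)] by simp
  have "mat2 t y 0 u ** mat2 1 x 0 1 ** mat2 u (- y) 0 t \<in> \<Gamma>"
    using assms inv[OF assms(1)] tu by (intro mult) (simp_all add: matrix_inv_mat2)
  also have "mat2 t y 0 u ** mat2 1 x 0 1 ** mat2 u (- y) 0 t = mat2 1 (t\<^sup>2 * x) 0 1"
    using tu by (simp add: power2_eq_square algebra_simps)
  finally show ?thesis .
qed

text \<open>Conjugation by powers of the upper triangular matrix contracts the unipotent one to the
  identity.\<close>

lemma unipotent_trivial_of_contraction: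
  assumes D: "mat2 t y 0 u \<in> \<Gamma>" "\<bar>t\<bar> < 1" and N: "mat2 1 x 0 1 \<in> \<Gamma>"
  shows "x = 0"
proof (rule ccontr)
  assume "x \<noteq> 0"
  have "t \<noteq> 0"
    using det[OF D(1)] by auto
  hence t2: "0 < t\<^sup>2" "t\<^sup>2 < 1"
    using D(2) by (simp_all add: abs_square_less_1)
  define N' where "N' j = mat2 1 ((t\<^sup>2) ^ j * x) 0 1" for j
  have "N' j \<in> \<Gamma>" for j
    using conjugate_unipotent_mem[OF D(1)] N
    by (induction j) (simp_all add: N'_def mult.assoc)
  moreover have "bounded_entries (max 1 \<bar>x\<bar>) (N' j)" for j
  proof -
    have "(t\<^sup>2) ^ j \<le> 1"
      by (rule power_le_one) (use t2 in auto)
    hence "(t\<^sup>2) ^ j * \<bar>x\<bar> \<le> 1 * \<bar>x\<bar>"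
      by (rule mult_right_mono) simp
    thus ?thesis
      by (auto simp: N'_def abs_mult)
  qed
  ultimately have "finite (range N')"
    by (intro finite_subset[OF _ finite_bounded]) auto
  moreover have "inj N'"
  proof (rule injI)
    fix i j assume "N' i = N' j"
    hence "(t\<^sup>2) ^ i = (t\<^sup>2) ^ j"
      using \<open>x \<noteq> 0\<close> by (simp add: N'_def)
    thus "i = j"
      using t2 power_strict_decreasing[of _ _ "t\<^sup>2"] by (metis less_irrefl linorder_neqE_nat)
  qed
  ultimately show False
    using finite_imageD by blast
qed

lemma unipotent_trivial:
  assumes D: "mat2 t y 0 u \<in> \<Gamma>" "\<bar>t\<bar> \<noteq> 1" and N: "mat2 1 x 0 1 \<in> \<Gamma>"
  shows "x = 0"
proof (cases "\<bar>t\<bar> < 1")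
  case True
  thus ?thesis
    using unipotent_trivial_of_contraction D N by blast
next
  case False
  have tu: "t * u = 1"
    using det[OF D(1)] by simp
  hence "\<bar>t\<bar> * \<bar>u\<bar> = 1"
    by (metis abs_mult abs_one)
  hence "\<bar>u\<bar> < 1"
    using False D(2) mult_left_le[of "\<bar>u\<bar>"] by (smt (verit) mult_less_cancel_left2)
  moreover have "mat2 u (- y) 0 t \<in> \<Gamma>"
    using inv[OF D(1)] tu by (simp add: matrix_inv_mat2)
  ultimately show ?thesis
    using unipotent_trivial_of_contraction N by blast
qed

lemma upper_triangular_diagonal:
  assumes D: "mat2 t 0 0 u \<in> \<Gamma>" "\<bar>t\<bar> \<noteq> 1" and N: "mat2 n x 0 m \<in> \<Gamma>"
  shows "x = 0"
proof -
  have tu: "t * u = 1" and nm: "n * m = 1"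
    using det[OF D(1)] det[OF N] by simp_all
  have "mat2 n x 0 m ** mat2 t 0 0 u ** mat2 m (- x) 0 n ** mat2 u 0 0 t \<in> \<Gamma>"
    using D N inv[OF D(1)] inv[OF N] tu nm by (intro mult) (simp_all add: matrix_inv_mat2)
  also have "mat2 n x 0 m ** mat2 t 0 0 u ** mat2 m (- x) 0 n ** mat2 u 0 0 t =
      mat2 1 (n * x * (1 - t\<^sup>2)) 0 1"
    using tu nm by (simp add: power2_eq_square algebra_simps)
  finally have "n * x * (1 - t\<^sup>2) = 0"
    using unipotent_trivial D by blast
  moreover have "t\<^sup>2 \<noteq> 1"
    using D(2) by (auto simp: power2_eq_1_iff)
  ultimately show ?thesis
    using nm by auto
qed

end


subsection \<open>Dilations\<close>

definition dilation :: "real \<Rightarrow> real^2^2" where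
  "dilation t = mat2 t 0 0 (1 / t)"

lemma dilation_eq_iff [simp]: "dilation s = dilation t \<longleftrightarrow> s = t"
  by (auto simp: dilation_def)

lemma dilation_mult [simp]: "dilation s ** dilation t = dilation (s * t)"
  by (simp add: dilation_def)

lemma dilation_1: "dilation 1 = mat 1"
  by (simp add: dilation_def mat_1_eq_mat2)

lemma uminus_dilation: "- dilation t = dilation (- t)"
  by (simp add: dilation_def)

lemma matrix_inv_dilation: "t \<noteq> 0 \<Longrightarrow> matrix_inv (dilation t) = dilation (1 / t)"
  by (rule matrix_inv_eqI) (simp add: dilation_1)

lemma matpow_dilation: "matpow (dilation t) n = dilation (t ^ n)"
  by (induction n) (simp_all add: matpow_def dilation_1)

lemma commutes_dilation:
  assumes comm: "N ** dilation t = dilation t ** N" and t: "t > 1" and det: "det N = 1"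
  obtains w where "N = dilation w"
proof -
  obtain w x y z where N: "N = mat2 w x y z"
    by (rule mat2_cases)
  have "1 / t < t"
    using t by (meson less_trans divide_less_eq_1_pos zero_less_one)
  moreover have "x * (1 / t) = t * x" "y * t = 1 / t * y"
    using comm by (simp_all add: N dilation_def)
  hence "x * (t - 1 / t) = 0" "y * (t - 1 / t) = 0"
    by (simp_all add: algebra_simps)
  ultimately have "x = 0" "y = 0"
    by auto
  moreover from this have "z = 1 / w"
    using det by (auto simp: N eq_divide_eq mult.commute)
  ultimately show ?thesis
    using that by (simp add: N dilation_def)
qed

definition primitive_in :: "(real^2^2) set \<Rightarrow> real^2^2 \<Rightarrow> bool" where
  "primitive_in \<Gamma> M \<longleftrightarrow> (\<forall>N\<in>\<Gamma>. \<forall>n\<ge>2. M \<noteq> matpow N n \<and> M \<noteq> - matpow N n)"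

lemma primitive_in_conjugate:
  assumes PR: "P ** R = mat 1"
  shows "primitive_in \<Gamma> (P ** X ** R) \<longleftrightarrow> primitive_in {X. P ** X ** R \<in> \<Gamma>} X"
proof -
  have RP: "R ** P = mat 1"
    using PR matrix_left_right_inverse by blast
  have conj_eq_iff: "P ** X ** R = P ** Y ** R \<longleftrightarrow> X = Y" for X Y :: "real^2^2"
    using conjugate_cancel[OF RP] by metis
  hence conj_eq_uminus_iff: "P ** X ** R = - (P ** Y ** R) \<longleftrightarrow> X = - Y" for X Y :: "real^2^2"
    by (metis matrix_mult_uminus)
  have \<Gamma>: "\<Gamma> = (\<lambda>X. P ** X ** R) ` {X. P ** X ** R \<in> \<Gamma>}"
    using conjugate_cancel[OF PR] by (auto intro!: image_eqI[of _ _ "R ** _ ** P"])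
  show ?thesis
    unfolding primitive_in_def
    by (subst \<Gamma>) (simp add: matpow_conjugate[OF PR RP] conj_eq_iff conj_eq_uminus_iff)
qed

context discrete_SL2
begin

lemma dilation_inverse_mem: "t \<noteq> 0 \<Longrightarrow> dilation t \<in> \<Gamma> \<Longrightarrow> dilation (1 / t) \<in> \<Gamma>"
  using inv by (simp flip: matrix_inv_dilation)

lemma dilation_abs_mem: "dilation t \<in> \<Gamma> \<Longrightarrow> dilation \<bar>t\<bar> \<in> \<Gamma>"
  using uminus by (auto simp: abs_if simp flip: uminus_dilation)

lemma dilation_power_mem: "dilation t \<in> \<Gamma> \<Longrightarrow> dilation (t ^ Suc n) \<in> \<Gamma>"
  using mult by (induction n) (simp_all flip: dilation_mult)

lemma finite_dilations: "finite {t. 1 < t \<and> t \<le> K \<and> dilation t \<in> \<Gamma>}"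
proof -
  have "1 / t \<le> K" if "1 < t" "t \<le> K" for t :: real
    using that by (smt (verit) divide_le_eq_1_pos)
  hence "dilation ` {t. 1 < t \<and> t \<le> K \<and> dilation t \<in> \<Gamma>} \<subseteq> {M \<in> \<Gamma>. bounded_entries K M}"
    by (auto simp: dilation_def)
  hence "finite (dilation ` {t. 1 < t \<and> t \<le> K \<and> dilation t \<in> \<Gamma>})"
    using finite_bounded finite_subset by blast
  thus ?thesis
    by (rule finite_imageD) (simp add: inj_on_def)
qed

lemma least_dilation:
  assumes "s > 1" "dilation s \<in> \<Gamma>"
  obtains \<tau> where "\<tau> > 1" "dilation \<tau> \<in> \<Gamma>" "\<And>t. t > 1 \<Longrightarrow> dilation t \<in> \<Gamma> \<Longrightarrow> \<tau> \<le> t"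
proof -
  define H where "H = {t. 1 < t \<and> t \<le> s \<and> dilation t \<in> \<Gamma>}"
  have fin: "finite H"
    unfolding H_def by (rule finite_dilations)
  have "s \<in> H"
    using assms by (simp add: H_def)
  hence "Min H \<in> H"
    using fin Min_in by blast
  moreover have "Min H \<le> t" if "t > 1" "dilation t \<in> \<Gamma>" for t
    using that \<open>s \<in> H\<close> Min_le[OF fin, of s] Min_le[OF fin, of t]
    unfolding H_def by (cases "t \<le> s") fastforce+
  ultimately show ?thesis
    using that by (auto simp: H_def)
qed

lemma dilation_generator:
  assumes "s > 1" "dilation s \<in> \<Gamma>"
  obtains \<tau> where "\<tau> > 1" "dilation \<tau> \<in> \<Gamma>"
    "\<And>t. t > 1 \<Longrightarrow> dilation t \<in> \<Gamma> \<Longrightarrow> \<exists>n\<ge>1. t = \<tau> ^ n"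
proof -
  obtain \<tau> where \<tau>: "\<tau> > 1" "dilation \<tau> \<in> \<Gamma>"
    and least: "\<And>t. t > 1 \<Longrightarrow> dilation t \<in> \<Gamma> \<Longrightarrow> \<tau> \<le> t"
    using least_dilation[OF assms] by blast
  have "\<exists>n\<ge>1. t = \<tau> ^ n" if t: "t > 1" "dilation t \<in> \<Gamma>" for t
  proof -
    define n where "n = nat \<lfloor>log \<tau> t\<rfloor>"
    have "log \<tau> \<tau> \<le> log \<tau> t"
      using \<tau> t least[OF t] by (subst log_le_cancel_iff) auto
    hence log: "1 \<le> n" "real n \<le> log \<tau> t" "log \<tau> t < real (Suc n)"
      using \<tau>(1) by (auto simp: n_def le_nat_iff) linarith+
    have lower: "\<tau> ^ n \<le> t" and upper: "t < \<tau> ^ Suc n"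
      using log \<tau>(1) t(1) powr_realpow[of \<tau> n] powr_realpow[of \<tau> "Suc n"]
      by (simp_all add: le_log_iff log_less_iff)
    obtain m where m: "n = Suc m"
      using log(1) by (cases n) auto
    have "dilation (t * (1 / \<tau> ^ n)) \<in> \<Gamma>"
      unfolding m dilation_mult[symmetric]
      using \<tau> t(2) dilation_power_mem by (intro mult dilation_inverse_mem) auto
    moreover have "t * (1 / \<tau> ^ n) < \<tau>"
      using \<tau>(1) upper by (simp add: field_simps)
    ultimately have "\<not> t * (1 / \<tau> ^ n) > 1"
      using least by fastforce
    hence "t = \<tau> ^ n"
      using lower \<tau>(1) by (simp add: field_simps)
    thus ?thesis
      using log(1) by blast
  qed
  thus ?thesis
    using that \<tau> by blast
qed

lemma primitive_in_dilation_generator: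
  assumes \<tau>: "\<tau> > 1" and gen: "\<And>t. t > 1 \<Longrightarrow> dilation t \<in> \<Gamma> \<Longrightarrow> \<exists>n\<ge>1. t = \<tau> ^ n"
  shows "primitive_in \<Gamma> (dilation \<tau>)"
proof (unfold primitive_in_def, intro ballI allI impI, rule ccontr)
  fix N n assume N: "N \<in> \<Gamma>" and n: "2 \<le> (n::nat)"
    and "\<not> (dilation \<tau> \<noteq> matpow N n \<and> dilation \<tau> \<noteq> - matpow N n)"
  hence power: "dilation \<tau> = matpow N n \<or> dilation \<tau> = - matpow N n"
    by blast
  hence "N ** dilation \<tau> = dilation \<tau> ** N"
    using matpow_commute by (auto simp: matrix_mult_uminus)
  then obtain w where w: "N = dilation w"
    using commutes_dilation[OF _ \<tau> det[OF N]] by blast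
  have "\<tau> = w ^ n \<or> \<tau> = - (w ^ n)"
    using power by (simp add: w matpow_dilation uminus_dilation)
  hence abs_w: "\<bar>w\<bar> ^ n = \<tau>"
    using \<tau> by (auto simp flip: power_abs)
  hence "\<bar>w\<bar> > 1"
    using \<tau> power_le_one[of "\<bar>w\<bar>" n] by linarith
  then obtain m where m: "m \<ge> 1" "\<bar>w\<bar> = \<tau> ^ m"
    using gen dilation_abs_mem N w by blast
  hence "\<tau> ^ (m * n) = \<tau> ^ 1"
    using abs_w by (simp add: power_mult)
  hence "m * n = 1"
    using \<tau> by (subst (asm) power_inject_exp) auto
  thus False
    using n by simp
qed

lemma ex1_primitive_dilation:
  assumes "s > 1" "dilation s \<in> \<Gamma>"
  shows "\<exists>!t. t > 1 \<and> dilation t \<in> \<Gamma> \<and> primitive_in \<Gamma> (dilation t)"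
proof -
  obtain \<tau> where \<tau>: "\<tau> > 1" "dilation \<tau> \<in> \<Gamma>"
    and gen: "\<And>t. t > 1 \<Longrightarrow> dilation t \<in> \<Gamma> \<Longrightarrow> \<exists>n\<ge>1. t = \<tau> ^ n"
    using dilation_generator[OF assms] by blast
  show ?thesis
  proof (rule ex1I[of _ \<tau>])
    show "\<tau> > 1 \<and> dilation \<tau> \<in> \<Gamma> \<and> primitive_in \<Gamma> (dilation \<tau>)"
      using \<tau> primitive_in_dilation_generator[OF \<tau>(1) gen] by blast
    fix t assume t: "t > 1 \<and> dilation t \<in> \<Gamma> \<and> primitive_in \<Gamma> (dilation t)"
    then obtain n where n: "n \<ge> 1" "t = \<tau> ^ n"
      using gen by blast
    hence "dilation t = matpow (dilation \<tau>) n"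
      by (simp add: matpow_dilation)
    hence "\<not> n \<ge> 2"
      using t \<tau>(2) unfolding primitive_in_def by blast
    hence "n = 1"
      using n(1) by linarith
    thus "t = \<tau>"
      by (simp add: n(2))
  qed
qed

end


subsection \<open>Axes of hyperbolic elements\<close>

definition fix_basis :: "real \<Rightarrow> real \<Rightarrow> real^2^2" where
  "fix_basis \<alpha> \<beta> = mat2 \<alpha> \<beta> 1 1"

definition fix_basis_inv :: "real \<Rightarrow> real \<Rightarrow> real^2^2" where
  "fix_basis_inv \<alpha> \<beta> = mat2 (1 / (\<alpha> - \<beta>)) (- \<beta> / (\<alpha> - \<beta>)) (- 1 / (\<alpha> - \<beta>)) (\<alpha> / (\<alpha> - \<beta>))"

lemma fix_basis_mult_inv: "\<alpha> \<noteq> \<beta> \<Longrightarrow> fix_basis \<alpha> \<beta> ** fix_basis_inv \<alpha> \<beta> = mat 1"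
  and fix_basis_inv_mult: "\<alpha> \<noteq> \<beta> \<Longrightarrow> fix_basis_inv \<alpha> \<beta> ** fix_basis \<alpha> \<beta> = mat 1"
  by (simp_all add: fix_basis_def fix_basis_inv_def mat_1_eq_mat2
      flip: diff_divide_distrib add_divide_distrib)

definition fixes_point :: "real^2^2 \<Rightarrow> real \<Rightarrow> bool" where
  "fixes_point M x \<longleftrightarrow> M$1$1 * x + M$1$2 = x * (M$2$1 * x + M$2$2)"

lemma moebius_fixes_iff:
  assumes "det M = 1"
  shows "moebius_fixes M x \<longleftrightarrow> fixes_point M x"
proof -
  obtain a b c d where M: "M = mat2 a b c d"
    by (rule mat2_cases)
  have "c * x + d \<noteq> 0" if "a * x + b = x * (c * x + d)"
  proof
    assume "c * x + d = 0"
    hence "b = - a * x" "d = - c * x"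
      using that by auto
    thus False
      using assms by (simp add: M)
  qed
  thus ?thesis
    by (auto simp: M moebius_fixes_def moebius_def fixes_point_def field_simps)
qed

lemma fixes_point_uminus: "fixes_point (- M) x \<longleftrightarrow> fixes_point M x"
  by (simp add: fixes_point_def algebra_simps) argo

lemma conjugate_fix_basis_nth:
  assumes "\<alpha> \<noteq> \<beta>"
  defines "X \<equiv> \<lambda>M. fix_basis_inv \<alpha> \<beta> ** M ** fix_basis \<alpha> \<beta>"
  shows "X M $ 2 $ 1 = 0 \<longleftrightarrow> fixes_point M \<alpha>" "X M $ 1 $ 2 = 0 \<longleftrightarrow> fixes_point M \<beta>"
proof -
  obtain a b c d where M: "M = mat2 a b c d"
    by (rule mat2_cases)
  have "X M $ 2 $ 1 = (\<alpha> * (c * \<alpha> + d) - (a * \<alpha> + b)) / (\<alpha> - \<beta>)"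
    "X M $ 1 $ 2 = ((a * \<beta> + b) - \<beta> * (c * \<beta> + d)) / (\<alpha> - \<beta>)"
    by (simp_all add: X_def M fix_basis_def fix_basis_inv_def divide_inverse algebra_simps)
  thus "X M $ 2 $ 1 = 0 \<longleftrightarrow> fixes_point M \<alpha>" "X M $ 1 $ 2 = 0 \<longleftrightarrow> fixes_point M \<beta>"
    using assms(1) by (auto simp: M fixes_point_def)
qed

definition hyperbolic_mat :: "real \<Rightarrow> real \<Rightarrow> real \<Rightarrow> real^2^2" where
  "hyperbolic_mat \<alpha> \<beta> t = fix_basis \<alpha> \<beta> ** dilation t ** fix_basis_inv \<alpha> \<beta>"

lemma hyperbolic_mat_eq:
  "hyperbolic_mat \<alpha> \<beta> t =
     mat2 ((\<alpha> * t - \<beta> / t) / (\<alpha> - \<beta>)) (- (\<alpha> * \<beta> * (t - 1 / t)) / (\<alpha> - \<beta>))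
       ((t - 1 / t) / (\<alpha> - \<beta>)) ((\<alpha> / t - \<beta> * t) / (\<alpha> - \<beta>))"
  by (simp add: hyperbolic_mat_def dilation_def fix_basis_def fix_basis_inv_def divide_inverse
      algebra_simps)

lemma trace_hyperbolic_mat:
  assumes "\<alpha> \<noteq> \<beta>"
  shows "trace (hyperbolic_mat \<alpha> \<beta> t) = t + 1 / t"
proof -
  have "(\<alpha> * t - \<beta> / t) + (\<alpha> / t - \<beta> * t) = (\<alpha> - \<beta>) * (t + 1 / t)"
    by (simp add: algebra_simps diff_divide_distrib)
  thus ?thesis
    using assms by (simp add: hyperbolic_mat_eq flip: add_divide_distrib)
qed

lemma hyperbolic_mat_swap: "hyperbolic_mat \<beta> \<alpha> t = hyperbolic_mat \<alpha> \<beta> (1 / t)"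
proof -
  have "inverse (\<beta> - \<alpha>) = - inverse (\<alpha> - \<beta>)"
    by (metis inverse_minus_eq minus_diff_eq)
  thus ?thesis
    by (simp add: hyperbolic_mat_eq divide_inverse algebra_simps)
qed

lemma matrix_inv_hyperbolic_mat:
  assumes "\<alpha> \<noteq> \<beta>" "t \<noteq> 0"
  shows "matrix_inv (hyperbolic_mat \<alpha> \<beta> t) = hyperbolic_mat \<alpha> \<beta> (1 / t)"
  by (rule matrix_inv_eqI)
    (use assms in \<open>simp add: hyperbolic_mat_def conjugate_mult fix_basis_inv_mult
      fix_basis_mult_inv dilation_1\<close>)

lemma one_plus_inverse_gt_2: "t > 1 \<Longrightarrow> t + 1 / t > (2::real)"
proof -
  assume "t > 1"
  hence "(t - 1) * (t - 1) > 0"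
    by simp
  thus ?thesis
    using \<open>t > 1\<close> by (simp add: field_simps)
qed

lemma diff_inverse_pos: "t > 1 \<Longrightarrow> t - 1 / t > (0::real)"
  by (simp add: less_trans[of _ 1])

lemma fixes_point_hyperbolic_mat_iff:
  assumes "\<alpha> \<noteq> \<beta>" "t > 1"
  shows "fixes_point (hyperbolic_mat \<alpha> \<beta> t) x \<longleftrightarrow> x = \<alpha> \<or> x = \<beta>"
proof -
  let ?M = "hyperbolic_mat \<alpha> \<beta> t"
  have "x * (?M$2$1 * x + ?M$2$2) - (?M$1$1 * x + ?M$1$2) =
      (t - 1 / t) * ((x - \<alpha>) * (x - \<beta>)) / (\<alpha> - \<beta>)"
    by (simp add: hyperbolic_mat_eq divide_inverse algebra_simps)
  thus ?thesis
    using assms diff_inverse_pos[of t] by (auto simp: fixes_point_def)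
qed

text \<open>The fixed point \<open>\<alpha>\<close> in the definition of \<open>M\<^sub>\<alpha>\<close>.\<close>

definition attracting_point :: "real^2^2 \<Rightarrow> real" where
  "attracting_point M = (M$1$1 - M$2$2 + sqrt ((M$1$1 + M$2$2)\<^sup>2 - 4)) / (2 * M$2$1)"

lemma attracting_point_hyperbolic_mat:
  assumes \<alpha>\<beta>: "\<alpha> \<noteq> \<beta>" and t: "t > 1"
  shows "attracting_point (hyperbolic_mat \<alpha> \<beta> t) = \<alpha>"
proof -
  let ?M = "hyperbolic_mat \<alpha> \<beta> t"
  define v where "v = t - 1 / t"
  have v: "v > 0"
    using diff_inverse_pos[OF t] by (simp add: v_def)
  have sum: "?M$1$1 + ?M$2$2 = t + 1 / t"
    using trace_hyperbolic_mat[OF \<alpha>\<beta>, of t] by (simp add: trace_def sum_2)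
  have "(?M$1$1 + ?M$2$2)\<^sup>2 - 4 = v\<^sup>2"
    unfolding sum using t by (simp add: v_def power2_eq_square field_simps)
  hence sqrt: "sqrt ((?M$1$1 + ?M$2$2)\<^sup>2 - 4) = v"
    using v by simp
  have "(\<alpha> * t - \<beta> / t) - (\<alpha> / t - \<beta> * t) = (\<alpha> + \<beta>) * v"
    by (simp add: v_def algebra_simps add_divide_distrib)
  hence diff: "?M$1$1 - ?M$2$2 = (\<alpha> + \<beta>) * v / (\<alpha> - \<beta>)"
    by (simp add: hyperbolic_mat_eq flip: diff_divide_distrib)
  have "(\<alpha> + \<beta>) * v / (\<alpha> - \<beta>) + v = 2 * \<alpha> * v / (\<alpha> - \<beta>)"
    using \<alpha>\<beta> by (simp add: field_simps)
  moreover have "?M$2$1 = v / (\<alpha> - \<beta>)"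
    by (simp add: hyperbolic_mat_eq v_def)
  ultimately show ?thesis
    unfolding attracting_point_def sqrt diff using \<alpha>\<beta> v by simp
qed

lemma ex_plus_inverse_eq:
  fixes \<tau> :: real
  assumes "\<tau> > 2"
  shows "\<exists>t>1. t + 1 / t = \<tau> \<and> t - 1 / t = sqrt (\<tau>\<^sup>2 - 4)"
proof -
  define v where "v = sqrt (\<tau>\<^sup>2 - 4)"
  have "2\<^sup>2 < \<tau>\<^sup>2"
    using assms by (intro power_strict_mono) auto
  hence v: "v > 0" "v\<^sup>2 = \<tau>\<^sup>2 - 4"
    by (simp_all add: v_def)
  have t: "(\<tau> + v) / 2 > 1"
    using assms v(1) by simp
  have "(\<tau> + v) / 2 * ((\<tau> - v) / 2) = 1"
    using v(2) by (simp add: power2_eq_square algebra_simps)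
  hence inverse: "1 / ((\<tau> + v) / 2) = (\<tau> - v) / 2"
    using t by (simp add: divide_eq_eq mult.commute)
  have "(\<tau> + v) / 2 + 1 / ((\<tau> + v) / 2) = \<tau> \<and> (\<tau> + v) / 2 - 1 / ((\<tau> + v) / 2) = v"
    unfolding inverse by (simp add: field_simps)
  thus ?thesis
    using t unfolding v_def by blast
qed

lemma hyperbolic_diagonalization:
  assumes det: "det M = 1" and trace: "trace M > 2" and lower: "M$2$1 \<noteq> 0"
  obtains \<beta> t where "t > 1" "\<beta> \<noteq> attracting_point M"
    "M = hyperbolic_mat (attracting_point M) \<beta> t"
proof -
  obtain a b c d where M: "M = mat2 a b c d"
    by (rule mat2_cases)
  have dt: "a * d - b * c = 1" and c: "c \<noteq> 0"
    using det lower by (simp_all add: M)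
  obtain t where t: "t > 1" "t + 1 / t = a + d" "t - 1 / t = sqrt ((a + d)\<^sup>2 - 4)"
    using ex_plus_inverse_eq[of "a + d"] trace by (auto simp: M)
  define v where "v = t - 1 / t"
  have v: "v > 0"
    using diff_inverse_pos[OF t(1)] by (simp add: v_def)
  define \<alpha> \<beta> where "\<alpha> = (a - d + v) / (2 * c)" and "\<beta> = (a - d - v) / (2 * c)"
  have diff: "\<alpha> - \<beta> = v / c"
    using c by (simp add: \<alpha>_def \<beta>_def field_simps)
  have t_eq: "t = (a + d + v) / 2" and inv_t: "1 / t = (a + d - v) / 2"
    using t(2) by (simp_all add: v_def)
  have "4 * (\<alpha> * \<beta> * (c * c)) = (a - d)\<^sup>2 - v\<^sup>2"
    using c by (simp add: \<alpha>_def \<beta>_def field_simps power2_eq_square)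
  also have "v\<^sup>2 = (a + d)\<^sup>2 - 4"
    using t(1) unfolding t(2)[symmetric] v_def by (simp add: power2_eq_square field_simps)
  also have "(a - d)\<^sup>2 - ((a + d)\<^sup>2 - 4) = - 4 * b * c"
    using dt by (simp add: power2_eq_square algebra_simps)
  finally have "c * (\<alpha> * \<beta> * c + b) = 0"
    by (simp add: algebra_simps)
  hence "\<alpha> * \<beta> * c + b = 0"
    using c mult_eq_0_iff by blast
  hence prod: "\<alpha> * \<beta> = - b / c"
    using c by (simp add: field_simps)
  have "\<alpha> * t - \<beta> * (1 / t) = a * (v / c)" "\<alpha> * (1 / t) - \<beta> * t = d * (v / c)"
    unfolding inv_t unfolding \<alpha>_def \<beta>_def t_eq using c by (simp_all add: field_simps)
  moreover have "\<alpha> * \<beta> * v = - b * (v / c)"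
    by (simp add: prod)
  ultimately have "M = hyperbolic_mat \<alpha> \<beta> t"
    using v c by (simp add: M hyperbolic_mat_eq diff flip: v_def)
  moreover have "attracting_point M = \<alpha>"
    using t(3) by (simp add: attracting_point_def M \<alpha>_def v_def)
  moreover have "\<beta> \<noteq> \<alpha>"
    using diff v c by auto
  ultimately show ?thesis
    using that[of t \<beta>] t(1) by simp
qed

context discrete_SL2
begin

definition is_axis :: "real \<Rightarrow> real \<Rightarrow> bool" where
  "is_axis \<alpha> \<beta> \<longleftrightarrow> \<alpha> \<noteq> \<beta> \<and> (\<exists>t>1. hyperbolic_mat \<alpha> \<beta> t \<in> \<Gamma>)"

lemma is_axis_neq: "is_axis \<alpha> \<beta> \<Longrightarrow> \<alpha> \<noteq> \<beta>"
  by (simp add: is_axis_def)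

lemma is_axis_fixes_point:
  assumes axis: "is_axis \<alpha> \<beta>" and N: "N \<in> \<Gamma>" "fixes_point N \<alpha>"
  shows "fixes_point N \<beta>"
proof -
  define P R where "P = fix_basis \<alpha> \<beta>" and "R = fix_basis_inv \<alpha> \<beta>"
  have neq: "\<alpha> \<noteq> \<beta>"
    using axis by (rule is_axis_neq)
  have PR: "P ** R = mat 1"
    using neq by (simp add: P_def R_def fix_basis_mult_inv)
  interpret conj: discrete_SL2 "{X. P ** X ** R \<in> \<Gamma>}"
    using PR by (rule discrete_SL2_conjugate)
  obtain t where t: "t > 1" "P ** mat2 t 0 0 (1 / t) ** R \<in> \<Gamma>"
    using axis by (auto simp: is_axis_def hyperbolic_mat_def P_def R_def dilation_def)
  define X where "X = R ** N ** P"
  have "X $ 2 $ 1 = 0"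
    using conjugate_fix_basis_nth(1)[OF neq] N(2) by (simp add: X_def P_def R_def)
  hence X: "mat2 (X$1$1) (X$1$2) 0 (X$2$2) = X"
    using mat2_collapse[of X] by simp
  have "P ** X ** R \<in> \<Gamma>"
    using N(1) by (simp add: X_def conjugate_cancel[OF PR])
  hence "X $ 1 $ 2 = 0"
    using t conj.upper_triangular_diagonal[of t "1 / t" "X$1$1" "X$1$2" "X$2$2"] by (simp add: X)
  thus ?thesis
    using conjugate_fix_basis_nth(2)[OF neq] by (simp add: X_def P_def R_def)
qed

lemma stabilizer_fixed_point_iff:
  assumes axis: "is_axis \<alpha> \<beta>"
  shows "(\<beta>' \<noteq> \<alpha> \<and> (\<forall>M\<in>\<Gamma>. moebius_fixes M \<alpha> \<longrightarrow> moebius_fixes M \<beta>')) \<longleftrightarrow> \<beta>' = \<beta>"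
proof -
  obtain t where t: "t > 1" "hyperbolic_mat \<alpha> \<beta> t \<in> \<Gamma>"
    using axis by (auto simp: is_axis_def)
  have "fixes_point (hyperbolic_mat \<alpha> \<beta> t) x \<longleftrightarrow> x = \<alpha> \<or> x = \<beta>" for x
    using is_axis_neq[OF axis] t(1) by (rule fixes_point_hyperbolic_mat_iff)
  thus ?thesis
    using is_axis_fixes_point[OF axis] is_axis_neq[OF axis] t(2) moebius_fixes_iff[OF det] by metis
qed

end

locale cusped_SL2 = discrete_SL2 +
  fixes h :: real
  assumes translation: "mat2 1 h 0 1 \<in> \<Gamma>" "h \<noteq> 0"
begin

lemma hyperbolic_lower_left_neq_0:
  assumes M: "M \<in> \<Gamma>" and hyp: "hyperbolic M"
  shows "M $ 2 $ 1 \<noteq> 0"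
proof
  assume lower: "M $ 2 $ 1 = 0"
  obtain a b c d where abcd: "M = mat2 a b c d"
    by (rule mat2_cases)
  have ad: "a * d = 1" and c: "c = 0"
    using det[OF M] lower by (simp_all add: abcd)
  have "\<bar>a\<bar> \<noteq> 1"
  proof
    assume "\<bar>a\<bar> = 1"
    moreover from this have "\<bar>d\<bar> = 1"
      using ad by (metis abs_mult abs_one mult_1)
    ultimately show False
      using hyp by (auto simp: hyperbolic_def abcd)
  qed
  thus False
    using unipotent_trivial[of a b d h] translation M by (simp add: abcd c)
qed

lemma hyperbolic_diagonalization_mem:
  assumes "M \<in> \<Gamma>" "hyperbolic M" "trace M > 0"
  obtains \<beta> t where "t > 1" "M = hyperbolic_mat (attracting_point M) \<beta> t"
    "is_axis (attracting_point M) \<beta>"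
proof -
  have "trace M > 2"
    using assms(2,3) by (simp add: hyperbolic_def)
  then obtain \<beta> t where "t > 1" "\<beta> \<noteq> attracting_point M"
    "M = hyperbolic_mat (attracting_point M) \<beta> t"
    using hyperbolic_diagonalization[OF det[OF assms(1)]] hyperbolic_lower_left_neq_0[OF assms(1,2)]
    by blast
  moreover from this have "is_axis (attracting_point M) \<beta>"
    using assms(1) by (auto simp: is_axis_def)
  ultimately show ?thesis
    using that by blast
qed

lemma ex_axis:
  assumes M: "M \<in> \<Gamma>" "hyperbolic M" "moebius_fixes M \<alpha>"
  shows "\<exists>\<beta>. is_axis \<alpha> \<beta>"
proof -
  define N where "N = (if trace M > 0 then M else - M)"
  have "trace (- M) = - trace M"
    by (simp add: trace_def sum_negf)
  hence N: "N \<in> \<Gamma>" "hyperbolic N" "trace N > 0"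
    using M(1,2) uminus by (auto simp: N_def hyperbolic_def)
  have fixed: "fixes_point N \<alpha>"
    using M(3) moebius_fixes_iff[OF det[OF M(1)]] by (simp add: N_def fixes_point_uminus)
  obtain \<beta> t where t: "t > 1" "N = hyperbolic_mat (attracting_point N) \<beta> t"
    and axis: "is_axis (attracting_point N) \<beta>"
    using hyperbolic_diagonalization_mem[OF N] by blast
  have neq: "attracting_point N \<noteq> \<beta>"
    using axis by (rule is_axis_neq)
  have "matrix_inv N = hyperbolic_mat \<beta> (attracting_point N) t"
    using t neq
    by (metis hyperbolic_mat_swap matrix_inv_hyperbolic_mat less_irrefl not_one_less_zero)
  hence "is_axis \<beta> (attracting_point N)"
    using inv[OF N(1)] t(1) neq by (auto simp: is_axis_def)
  moreover have "\<alpha> = attracting_point N \<or> \<alpha> = \<beta>"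
    using fixed t fixes_point_hyperbolic_mat_iff[OF neq t(1)] by metis
  ultimately show ?thesis
    using axis by blast
qed

lemma hyperbolic_attracting_iff:
  assumes axis: "is_axis \<alpha> \<beta>"
  shows "M \<in> \<Gamma> \<and> hyperbolic M \<and> trace M > 0 \<and> \<alpha> = attracting_point M \<longleftrightarrow>
    M \<in> \<Gamma> \<and> (\<exists>t>1. M = hyperbolic_mat \<alpha> \<beta> t)" (is "?L \<longleftrightarrow> ?R")
proof
  assume L: ?L
  then obtain \<beta>' t where t: "t > 1" "M = hyperbolic_mat \<alpha> \<beta>' t" and axis': "is_axis \<alpha> \<beta>'"
    using hyperbolic_diagonalization_mem by metis
  have "\<beta>' = \<beta>"
    using stabilizer_fixed_point_iff[OF axis] stabilizer_fixed_point_iff[OF axis'] by blast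
  thus ?R
    using L t by blast
next
  have neq: "\<alpha> \<noteq> \<beta>"
    using axis by (rule is_axis_neq)
  assume ?R
  then obtain t where t: "t > 1" "M = hyperbolic_mat \<alpha> \<beta> t" "M \<in> \<Gamma>"
    by blast
  thus ?L
    using one_plus_inverse_gt_2[OF t(1)] trace_hyperbolic_mat[OF neq, of t]
      attracting_point_hyperbolic_mat[OF neq t(1)] by (simp add: hyperbolic_def)
qed

lemma ex1_primitive_hyperbolic:
  assumes axis: "is_axis \<alpha> \<beta>"
  shows "\<exists>!M. M \<in> \<Gamma> \<and> hyperbolic M \<and> primitive_in \<Gamma> M \<and> trace M > 0 \<and> \<alpha> = attracting_point M"
proof -
  define P R where "P = fix_basis \<alpha> \<beta>" and "R = fix_basis_inv \<alpha> \<beta>"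
  have neq: "\<alpha> \<noteq> \<beta>"
    using axis by (rule is_axis_neq)
  have PR: "P ** R = mat 1"
    using neq by (simp add: P_def R_def fix_basis_mult_inv)
  interpret conj: discrete_SL2 "{X. P ** X ** R \<in> \<Gamma>}"
    using PR by (rule discrete_SL2_conjugate)
  have mat: "hyperbolic_mat \<alpha> \<beta> t = P ** dilation t ** R" for t
    by (simp add: hyperbolic_mat_def P_def R_def)
  obtain s where "s > 1" "P ** dilation s ** R \<in> \<Gamma>"
    using axis by (auto simp: is_axis_def mat)
  hence "\<exists>!t. t > 1 \<and> hyperbolic_mat \<alpha> \<beta> t \<in> \<Gamma> \<and> primitive_in \<Gamma> (hyperbolic_mat \<alpha> \<beta> t)"
    using conj.ex1_primitive_dilation[of s] by (simp add: mat primitive_in_conjugate[OF PR])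
  hence "\<exists>!M. M \<in> \<Gamma> \<and> primitive_in \<Gamma> M \<and> (\<exists>t>1. M = hyperbolic_mat \<alpha> \<beta> t)"
    by metis
  thus ?thesis
    using hyperbolic_attracting_iff[OF axis] by (simp add: conj_ac) metis
qed

end


subsection \<open>Discreteness of the Hecke groups\<close>

lemma hecke_S_eq: "hecke_S p = mat2 1 (hecke_lambda p) 0 1"
  and hecke_T_eq: "hecke_T = mat2 0 (-1) 1 0"
  and hecke_U_eq_mat2: "hecke_U p = mat2 (hecke_lambda p) (-1) 1 0"
  by (simp_all add: hecke_S_def hecke_T_def hecke_U_eq mat2_def)

lemma hecke_T_hecke_T: "hecke_T ** hecke_T = - mat 1"
  by (simp add: hecke_T_eq mat_1_eq_mat2)

lemma mult_hecke_T_hecke_T: "M ** hecke_T ** hecke_T = - M"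
  by (simp add: hecke_T_hecke_T matrix_mult_uminus flip: matrix_mul_assoc)

lemma det_hecke_group: "M \<in> hecke_group p \<Longrightarrow> det M = 1"
proof (induction rule: hecke_group.induct)
  case (inv M)
  hence "det M * det (matrix_inv M) = 1"
    using matrix_inv_right[of M] by (metis det_I det_mul zero_neq_one)
  thus ?case
    using inv by simp
qed (simp_all add: hecke_S_eq hecke_T_eq det_mul)

lemma hecke_group_uminus:
  assumes "M \<in> hecke_group p"
  shows "- M \<in> hecke_group p"
proof -
  have "M ** hecke_T ** hecke_T \<in> hecke_group p"
    by (intro hecke_group.intros assms)
  thus ?thesis
    by (simp add: mult_hecke_T_hecke_T)
qed

lemma hecke_U_mem: "hecke_U p \<in> hecke_group p"
  unfolding hecke_U_def by (intro hecke_group.intros)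

definition sin_ratio :: "nat \<Rightarrow> real \<Rightarrow> real" where
  "sin_ratio p x = sin (x * pi / real p) / sin (pi / real p)"

definition U_power :: "nat \<Rightarrow> nat \<Rightarrow> real^2^2" where
  "U_power p j = mat2 (sin_ratio p (real j + 1)) (- sin_ratio p (real j))
     (sin_ratio p (real j)) (- sin_ratio p (real j - 1))"

definition V_mat :: "nat \<Rightarrow> nat \<Rightarrow> real^2^2" where
  "V_mat p j = mat2 (sin_ratio p (real j)) (sin_ratio p (real j + 1))
     (sin_ratio p (real j - 1)) (sin_ratio p (real j))"

primrec V_products :: "nat \<Rightarrow> nat \<Rightarrow> (real^2^2) set" where
  "V_products p 0 = {mat 1}"
| "V_products p (Suc n) = (\<lambda>(W, j). W ** V_mat p j) ` (V_products p n \<times> {1..<p})"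

lemma V_products_SucI:
  "W \<in> V_products p n \<Longrightarrow> 1 \<le> j \<Longrightarrow> j < p \<Longrightarrow> W ** V_mat p j \<in> V_products p (Suc n)"
  by (auto intro!: image_eqI[of _ _ "(W, j)"])

lemma finite_V_products: "finite (V_products p n)"
  by (induction n) simp_all

definition T_group :: "(real^2^2) set" where
  "T_group = {mat 1, hecke_T, - mat 1, - hecke_T}"

lemma T_group_uminus: "A \<in> T_group \<Longrightarrow> - A \<in> T_group"
  by (auto simp: T_group_def)

lemma T_group_mult: "A \<in> T_group \<Longrightarrow> B \<in> T_group \<Longrightarrow> A ** B \<in> T_group"
  by (auto simp: T_group_def matrix_mult_uminus hecke_T_hecke_T)

lemma hecke_T_mem_T_group: "hecke_T \<in> T_group"
  and mat_1_mem_T_group: "mat 1 \<in> T_group"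
  by (simp_all add: T_group_def)

definition hecke_normal_form :: "nat \<Rightarrow> (real^2^2) set" where
  "hecke_normal_form p = {A ** W ** B | A W B n. A \<in> T_group \<and> W \<in> V_products p n \<and> B \<in> T_group}"

lemma hecke_normal_formI:
  "A \<in> T_group \<Longrightarrow> W \<in> V_products p n \<Longrightarrow> B \<in> T_group \<Longrightarrow> A ** W ** B \<in> hecke_normal_form p"
  unfolding hecke_normal_form_def by blast

lemma hecke_normal_formE:
  assumes "M \<in> hecke_normal_form p"
  obtains A W B n where "M = A ** W ** B" "A \<in> T_group" "W \<in> V_products p n" "B \<in> T_group"
  using assms unfolding hecke_normal_form_def by blast

lemma hecke_normal_form_uminus:
  assumes "M \<in> hecke_normal_form p"
  shows "- M \<in> hecke_normal_form p"
proof -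
  obtain A W B n where "M = A ** W ** B" "A \<in> T_group" "W \<in> V_products p n" "B \<in> T_group"
    using assms by (rule hecke_normal_formE)
  thus ?thesis
    using hecke_normal_formI[of "- A" W p n B] by (simp add: T_group_uminus matrix_mult_uminus)
qed

lemma hecke_normal_form_mult_T:
  assumes "M \<in> hecke_normal_form p"
  shows "M ** hecke_T \<in> hecke_normal_form p"
proof -
  obtain A W B n where M: "M = A ** W ** B" "A \<in> T_group" "W \<in> V_products p n" "B \<in> T_group"
    using assms by (rule hecke_normal_formE)
  have "A ** W ** (B ** hecke_T) \<in> hecke_normal_form p"
    using M by (intro hecke_normal_formI[of _ _ _ n] T_group_mult hecke_T_mem_T_group)
  thus ?thesis
    by (simp add: M(1) matrix_mul_assoc)
qed

locale hecke =
  fixes p :: nat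
  assumes p_ge_3: "p \<ge> 3"
begin

lemma sin_pi_p_pos: "sin (pi / real p) > 0"
  using p_ge_3 by (intro sin_gt_zero) (auto simp: field_simps)

lemma sin_ratio_0 [simp]: "sin_ratio p 0 = 0"
  and sin_ratio_1 [simp]: "sin_ratio p 1 = 1"
  and sin_ratio_p [simp]: "sin_ratio p (real p) = 0"
  using sin_pi_p_pos p_ge_3 by (auto simp: sin_ratio_def)

lemma sin_ratio_minus: "sin_ratio p (- x) = - sin_ratio p x"
  by (simp add: sin_ratio_def)

lemma sin_ratio_plus_p: "sin_ratio p (x + real p) = - sin_ratio p x"
proof -
  have "(x + real p) * pi / real p = x * pi / real p + pi"
    using p_ge_3 by (simp add: field_simps)
  thus ?thesis
    by (simp add: sin_ratio_def)
qed

lemma sin_ratio_rec: "hecke_lambda p * sin_ratio p x = sin_ratio p (x + 1) + sin_ratio p (x - 1)"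
proof -
  have "sin ((x + 1) * pi / real p) + sin ((x - 1) * pi / real p) =
      2 * sin (x * pi / real p) * cos (pi / real p)"
    by (simp add: add_divide_distrib diff_divide_distrib algebra_simps sin_add sin_diff)
  thus ?thesis
    by (simp add: sin_ratio_def hecke_lambda_def add_divide_distrib[symmetric] mult_ac)
qed

lemma sin_ratio_ge_1:
  assumes "1 \<le> x" "x \<le> real p - 1"
  shows "sin_ratio p x \<ge> 1"
proof -
  have mono: "sin (pi / real p) \<le> sin y" if "pi / real p \<le> y" "y \<le> pi / 2" for y
  proof (rule sin_monotone_2pi_le)
    show "- (pi / 2) \<le> pi / real p"
      by (rule order_trans[of _ 0]) simp_all
  qed (use that in auto)
  have "sin (pi / real p) \<le> sin (x * pi / real p)"
  proof (cases "x * pi / real p \<le> pi / 2")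
    case True
    thus ?thesis
      using assms p_ge_3 by (intro mono) (auto simp: field_simps)
  next
    case False
    have reflect: "pi - x * pi / real p = (real p - x) * pi / real p"
      using p_ge_3 by (simp add: field_simps)
    have "pi / real p \<le> (real p - x) * pi / real p"
      using assms p_ge_3 by (simp add: divide_right_mono)
    hence "sin (pi / real p) \<le> sin (pi - x * pi / real p)"
      using False reflect by (intro mono) linarith+
    thus ?thesis
      by simp
  qed
  thus ?thesis
    using sin_pi_p_pos by (simp add: sin_ratio_def)
qed

lemma hecke_lambda_ge_1: "hecke_lambda p \<ge> 1"
proof -
  have "sin_ratio p 2 = hecke_lambda p"
    using sin_ratio_rec[of 1] by simp
  thus ?thesis
    using sin_ratio_ge_1[of 2] p_ge_3 by simp
qed

lemma U_power_0: "U_power p 0 = mat 1"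
  using sin_ratio_minus[of 1] by (simp add: U_power_def mat_1_eq_mat2)

lemma U_power_Suc: "U_power p (Suc j) = U_power p j ** hecke_U p"
  using sin_ratio_rec[of "real j + 1"] sin_ratio_rec[of "real j"]
  by (simp add: U_power_def hecke_U_eq_mat2 algebra_simps)

lemma U_power_p: "U_power p p = - mat 1"
  using sin_ratio_plus_p[of 1] sin_ratio_plus_p[of 0] sin_ratio_plus_p[of "- 1"]
    sin_ratio_minus[of 1]
  by (simp add: U_power_def mat_1_eq_mat2 add.commute)

lemma V_mat_hecke_T: "V_mat p j ** hecke_T = U_power p j"
  by (simp add: U_power_def hecke_T_eq V_mat_def)

lemma det_V_mat: "det (V_mat p j) = 1"
proof -
  have "det (U_power p j) = 1"
    by (induction j) (simp_all add: U_power_0 U_power_Suc det_mul hecke_U_eq_mat2)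
  thus ?thesis
    by (simp add: det_mul hecke_T_eq flip: V_mat_hecke_T)
qed

lemma V_product_mult_U_normal_form:
  assumes A: "A \<in> T_group" and W: "W \<in> V_products p n"
  shows "A ** W ** hecke_U p \<in> hecke_normal_form p"
proof -
  have "A ** (W ** V_mat p 1) ** hecke_T \<in> hecke_normal_form p"
    using p_ge_3
    by (intro hecke_normal_formI[of _ _ _ "Suc n"] A V_products_SucI W hecke_T_mem_T_group) auto
  thus ?thesis
    using U_power_Suc[of 0] V_mat_hecke_T[of 1] by (simp add: U_power_0 flip: matrix_mul_assoc)
qed

lemma V_product_T_mult_U_normal_form:
  assumes A: "A \<in> T_group" and W: "W \<in> V_products p n"
  shows "A ** W ** hecke_T ** hecke_U p \<in> hecke_normal_form p"
proof (cases n)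
  case 0
  thus ?thesis
    using V_product_mult_U_normal_form[of "A ** hecke_T" "mat 1" 0] A W
    by (simp add: T_group_mult hecke_T_mem_T_group)
next
  case (Suc m)
  then obtain W' j where W': "W' \<in> V_products p m" and j: "1 \<le> j" "j < p"
    and "W = W' ** V_mat p j"
    using W by auto
  moreover have "V_mat p j ** hecke_T ** hecke_U p = U_power p (Suc j)"
    by (simp add: V_mat_hecke_T U_power_Suc)
  ultimately have "A ** W ** hecke_T ** hecke_U p = A ** W' ** U_power p (Suc j)"
    by (metis matrix_mul_assoc)
  moreover have "A ** W' ** U_power p (Suc j) \<in> hecke_normal_form p"
  proof (cases "Suc j = p")
    case True
    have "- (A ** W' ** mat 1) \<in> hecke_normal_form p"
      by (intro hecke_normal_form_uminus hecke_normal_formI[of _ _ _ m] A W' mat_1_mem_T_group)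
    thus ?thesis
      by (simp add: True U_power_p matrix_mult_uminus)
  next
    case False
    hence "A ** (W' ** V_mat p (Suc j)) ** hecke_T \<in> hecke_normal_form p"
      using j
      by (intro hecke_normal_formI[of _ _ _ "Suc m"] A V_products_SucI W' hecke_T_mem_T_group) auto
    thus ?thesis
      by (simp add: matrix_mul_assoc flip: V_mat_hecke_T)
  qed
  ultimately show ?thesis
    by simp
qed

lemma hecke_normal_form_mult_U:
  assumes "M \<in> hecke_normal_form p"
  shows "M ** hecke_U p \<in> hecke_normal_form p"
proof -
  obtain A W B n where M: "M = A ** W ** B" "A \<in> T_group" "W \<in> V_products p n" "B \<in> T_group"
    using assms by (rule hecke_normal_formE)
  consider "B = mat 1 \<or> B = - mat 1" | "B = hecke_T \<or> B = - hecke_T"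
    using M(4) by (auto simp: T_group_def)
  thus ?thesis
    using V_product_mult_U_normal_form[OF M(2,3)] V_product_T_mult_U_normal_form[OF M(2,3)]
    by cases (auto simp: M(1) matrix_mult_uminus intro: hecke_normal_form_uminus)
qed

lemma hecke_normal_form_mult_U_power:
  "M \<in> hecke_normal_form p \<Longrightarrow> M ** U_power p j \<in> hecke_normal_form p"
  by (induction j) (simp_all add: U_power_0 U_power_Suc matrix_mul_assoc hecke_normal_form_mult_U)

lemma matrix_inv_hecke_S: "matrix_inv (hecke_S p) = - (hecke_T ** U_power p (p - 1))"
proof (rule matrix_inv_eqI)
  have "U_power p (p - 1) ** hecke_U p = - mat 1"
    using U_power_Suc[of "p - 1"] p_ge_3 by (simp add: U_power_p)
  hence "hecke_U p ** - U_power p (p - 1) = mat 1"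
    by (subst matrix_left_right_inverse) (simp add: matrix_mult_uminus)
  thus "hecke_S p ** - (hecke_T ** U_power p (p - 1)) = mat 1"
    by (simp add: hecke_U_def matrix_mult_uminus matrix_mul_assoc)
qed

lemma hecke_normal_form_mult_hecke_group:
  assumes "N \<in> hecke_group p" "M \<in> hecke_normal_form p"
  shows "M ** N \<in> hecke_normal_form p \<and> M ** matrix_inv N \<in> hecke_normal_form p"
  using assms
proof (induction arbitrary: M rule: hecke_group.induct)
  case one
  thus ?case
    by (simp add: matrix_inv_eqI)
next
  case S
  have "M ** hecke_S p = - (M ** hecke_U p ** hecke_T)"
    by (simp add: hecke_U_def mult_hecke_T_hecke_T matrix_mul_assoc)
  thus ?case
    using S by (simp add: matrix_inv_hecke_S matrix_mult_uminus matrix_mul_assoc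
        hecke_normal_form_uminus hecke_normal_form_mult_T hecke_normal_form_mult_U
        hecke_normal_form_mult_U_power)
next
  case T
  have "matrix_inv hecke_T = - hecke_T"
    by (rule matrix_inv_eqI) (simp add: matrix_mult_uminus hecke_T_hecke_T)
  thus ?case
    using T by (simp add: matrix_mult_uminus hecke_normal_form_uminus hecke_normal_form_mult_T)
next
  case (mult N N')
  thus ?case
    by (simp add: matrix_inv_mult det_hecke_group matrix_mul_assoc)
next
  case (inv N)
  thus ?case
    by (simp add: matrix_inv_matrix_inv det_hecke_group)
qed

lemma hecke_group_subset_normal_form: "hecke_group p \<subseteq> hecke_normal_form p"
proof
  fix N assume "N \<in> hecke_group p"
  moreover have "mat 1 ** mat 1 ** mat 1 \<in> hecke_normal_form p"
    by (rule hecke_normal_formI[of _ _ _ 0]) (simp_all add: mat_1_mem_T_group)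
  ultimately show "N \<in> hecke_normal_form p"
    using hecke_normal_form_mult_hecke_group[of N "mat 1"] by simp
qed

end

definition zero_or_ge_1 :: "real \<Rightarrow> bool" where
  "zero_or_ge_1 x \<longleftrightarrow> x = 0 \<or> x \<ge> 1"

lemma zero_or_ge_1_add: "zero_or_ge_1 x \<Longrightarrow> zero_or_ge_1 y \<Longrightarrow> zero_or_ge_1 (x + y)"
  by (auto simp: zero_or_ge_1_def)

lemma zero_or_ge_1_mult: "zero_or_ge_1 x \<Longrightarrow> zero_or_ge_1 y \<Longrightarrow> zero_or_ge_1 (x * y)"
  using mult_mono[of 1 x 1 y] by (auto simp: zero_or_ge_1_def)

lemma zero_or_ge_1_nonneg: "zero_or_ge_1 x \<Longrightarrow> 0 \<le> x"
  by (auto simp: zero_or_ge_1_def)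

definition entry_sum :: "real^2^2 \<Rightarrow> real" where
  "entry_sum M = M$1$1 + M$1$2 + M$2$1 + M$2$2"

definition zero_or_ge_1_SL2 :: "real^2^2 \<Rightarrow> bool" where
  "zero_or_ge_1_SL2 M \<longleftrightarrow> (\<forall>i j. zero_or_ge_1 (M$i$j)) \<and> det M = 1"

lemma zero_or_ge_1_SL2_mult:
  "zero_or_ge_1_SL2 M \<Longrightarrow> zero_or_ge_1_SL2 N \<Longrightarrow> zero_or_ge_1_SL2 (M ** N)"
  unfolding zero_or_ge_1_SL2_def det_mul
  by (simp add: matrix_matrix_mult_def sum_2 zero_or_ge_1_add zero_or_ge_1_mult)

lemma entry_sum_mult_ge:
  assumes W: "zero_or_ge_1_SL2 W" and V: "x \<ge> 1" "zero_or_ge_1 y" "zero_or_ge_1 z" "y \<ge> 1 \<or> z \<ge> 1"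
  shows "entry_sum (W ** mat2 x y z x) \<ge> entry_sum W + 1"
proof -
  obtain a b c d where abcd: "W = mat2 a b c d"
    by (rule mat2_cases)
  have entries: "zero_or_ge_1 a" "zero_or_ge_1 b" "zero_or_ge_1 c" "zero_or_ge_1 d"
    and "a * d - b * c = 1"
    using W unfolding zero_or_ge_1_SL2_def abcd forall_2 by auto
  hence columns: "a + c \<ge> 1" "b + d \<ge> 1"
    unfolding zero_or_ge_1_def by force+
  note nonneg = entries[THEN zero_or_ge_1_nonneg] V(2,3)[THEN zero_or_ge_1_nonneg]
  have "(a + b + c + d) * 1 \<le> (a + b + c + d) * x"
    using V(1) nonneg by (intro mult_left_mono) linarith+
  moreover have "1 \<le> (a + c) * y + (b + d) * z"
    using V(4)
  proof
    assume "y \<ge> 1"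
    hence "1 * 1 \<le> (a + c) * y"
      using columns by (intro mult_mono) auto
    thus ?thesis
      using nonneg by (simp add: add_increasing2)
  next
    assume "z \<ge> 1"
    hence "1 * 1 \<le> (b + d) * z"
      using columns by (intro mult_mono) auto
    thus ?thesis
      using nonneg by (simp add: add_increasing)
  qed
  ultimately show ?thesis
    by (simp add: abcd entry_sum_def algebra_simps)
qed

lemma T_group_entries:
  assumes "A \<in> T_group" and P: "\<And>x. P (- x) = P x"
  shows "(\<forall>i j. P ((A ** M) $ i $ j)) \<longleftrightarrow> (\<forall>i j. P (M $ i $ j))"
    and "(\<forall>i j. P ((M ** A) $ i $ j)) \<longleftrightarrow> (\<forall>i j. P (M $ i $ j))"
  using assms(1)
  by (cases M rule: mat2_cases; auto simp: T_group_def forall_2 hecke_T_eq mat_1_eq_mat2 P)+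

context hecke
begin

lemma V_mat_entries:
  assumes j: "1 \<le> j" "j < p"
  shows "sin_ratio p (real j) \<ge> 1" "zero_or_ge_1 (sin_ratio p (real j + 1))"
    "zero_or_ge_1 (sin_ratio p (real j - 1))"
    "sin_ratio p (real j + 1) \<ge> 1 \<or> sin_ratio p (real j - 1) \<ge> 1"
proof -
  show "sin_ratio p (real j) \<ge> 1"
    using j by (intro sin_ratio_ge_1) auto
  have upper: "real j + 1 = real p \<or> sin_ratio p (real j + 1) \<ge> 1"
  proof (cases "Suc j = p")
    case False
    thus ?thesis
      using j by (intro disjI2 sin_ratio_ge_1) linarith+
  qed auto
  have lower: "real j - 1 = 0 \<or> sin_ratio p (real j - 1) \<ge> 1"
    using j by (auto intro!: sin_ratio_ge_1)
  show "zero_or_ge_1 (sin_ratio p (real j + 1))" "zero_or_ge_1 (sin_ratio p (real j - 1))"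
    using upper lower sin_ratio_p sin_ratio_0 unfolding zero_or_ge_1_def by metis+
  show "sin_ratio p (real j + 1) \<ge> 1 \<or> sin_ratio p (real j - 1) \<ge> 1"
    using upper lower p_ge_3 by linarith
qed

lemma V_products_entries:
  "W \<in> V_products p n \<Longrightarrow> zero_or_ge_1_SL2 W \<and> real n \<le> entry_sum W"
proof (induction n arbitrary: W)
  case 0
  thus ?case
    by (auto simp: zero_or_ge_1_SL2_def zero_or_ge_1_def forall_2 entry_sum_def mat_1_eq_mat2)
next
  case (Suc n)
  then obtain W' j where W: "W = W' ** V_mat p j" "W' \<in> V_products p n" and j: "1 \<le> j" "j < p"
    by auto
  note entries = V_mat_entries[OF j]
  have "zero_or_ge_1_SL2 (V_mat p j)"
    unfolding zero_or_ge_1_SL2_def det_V_mat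
    using entries by (simp add: V_mat_def forall_2 zero_or_ge_1_def)
  moreover have "zero_or_ge_1_SL2 W'" "real n \<le> entry_sum W'"
    using Suc.IH W(2) by auto
  moreover from this have "entry_sum W' + 1 \<le> entry_sum (W' ** V_mat p j)"
    unfolding V_mat_def using entries by (intro entry_sum_mult_ge) auto
  ultimately show ?case
    by (simp add: W(1) zero_or_ge_1_SL2_mult)
qed

lemma hecke_group_entries:
  assumes "M \<in> hecke_group p"
  shows "zero_or_ge_1 \<bar>M$i$j\<bar>"
proof -
  obtain A W B n where M: "M = A ** W ** B" "A \<in> T_group" "W \<in> V_products p n" "B \<in> T_group"
    using assms hecke_group_subset_normal_form hecke_normal_formE by blast
  have "\<forall>i j. zero_or_ge_1 \<bar>W$i$j\<bar>"
    using V_products_entries[OF M(3)] by (auto simp: zero_or_ge_1_SL2_def zero_or_ge_1_nonneg)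
  hence "\<forall>i j. zero_or_ge_1 \<bar>(A ** W ** B)$i$j\<bar>"
    using T_group_entries[of _ "\<lambda>x. zero_or_ge_1 \<bar>x\<bar>"] M(2,4) by simp
  thus ?thesis
    by (simp add: M(1))
qed

lemma finite_bounded_hecke_group: "finite {M \<in> hecke_group p. bounded_entries K M}"
proof -
  define N where "N = nat \<lfloor>4 * K\<rfloor>"
  have "{M \<in> hecke_group p. bounded_entries K M} \<subseteq>
      (\<lambda>(A, W, B). A ** W ** B) ` (T_group \<times> (\<Union>n\<le>N. V_products p n) \<times> T_group)"
  proof safe
    fix M assume "M \<in> hecke_group p" and bounded: "bounded_entries K M"
    then obtain A W B n where M: "M = A ** W ** B" "A \<in> T_group" "W \<in> V_products p n" "B \<in> T_group"
      using hecke_group_subset_normal_form hecke_normal_formE by blast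
    have "\<forall>i j. \<bar>W$i$j\<bar> \<le> K"
      using bounded M(2,4) T_group_entries[of _ "\<lambda>x. \<bar>x\<bar> \<le> K"]
      by (simp add: M(1) bounded_entries_def)
    hence "entry_sum W \<le> 4 * K"
      unfolding entry_sum_def by (smt (verit) abs_ge_self)
    hence "n \<le> N"
      using V_products_entries[OF M(3)] by (simp add: N_def le_nat_floor)
    thus "M \<in> (\<lambda>(A, W, B). A ** W ** B) ` (T_group \<times> (\<Union>n\<le>N. V_products p n) \<times> T_group)"
      using M by (auto intro!: image_eqI[of _ _ "(A, W, B)"])
  qed
  moreover have "finite (T_group \<times> (\<Union>n\<le>N. V_products p n) \<times> T_group)"
    by (simp add: T_group_def finite_V_products)
  ultimately show ?thesis
    using finite_surj by blast
qed

sublocale cusped_SL2 "hecke_group p" "hecke_lambda p"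
proof
  show "mat2 1 (hecke_lambda p) 0 1 \<in> hecke_group p"
    using hecke_group.S by (simp add: hecke_S_eq)
  show "hecke_lambda p \<noteq> 0"
    using hecke_lambda_ge_1 by simp
qed (auto intro: hecke_group.mult hecke_group.inv hecke_group_uminus det_hecke_group
    finite_bounded_hecke_group)

end


subsection \<open>Binary quadratic forms and their roots\<close>

definition conj_root :: "bqf \<Rightarrow> real" where
  "conj_root Q = (case Q of (A, B, C) \<Rightarrow> (- B - sqrt (bqf_disc Q)) / (2 * A))"

definition bqf_of_roots :: "real \<Rightarrow> real \<Rightarrow> real \<Rightarrow> bqf" where
  "bqf_of_roots A x y = (A, - A * (x + y), A * (x * y))"

lemma bqf_of_roots_nth [simp]:
  "fst (bqf_of_roots A x y) = A" "snd (snd (bqf_of_roots A x y)) = A * (x * y)"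
  by (simp_all add: bqf_of_roots_def)

lemma bqf_disc_of_roots: "bqf_disc (bqf_of_roots A x y) = (A * (x - y))\<^sup>2"
  by (simp add: bqf_of_roots_def bqf_disc_def power2_eq_square algebra_simps)

lemma bqf_eval_of_roots:
  "bqf_eval (bqf_of_roots A x y) z 1 = of_real A * ((z - of_real x) * (z - of_real y))"
  by (simp add: bqf_of_roots_def bqf_eval_def power2_eq_square algebra_simps)

lemma
  assumes "A * (x - y) > 0"
  shows alpha_of_bqf_of_roots: "alpha_of (bqf_of_roots A x y) = x"
    and conj_root_bqf_of_roots: "conj_root (bqf_of_roots A x y) = y"
proof -
  have "sqrt (bqf_disc (bqf_of_roots A x y)) = A * (x - y)"
    using assms by (simp add: bqf_disc_of_roots)
  hence sqrt: "sqrt (bqf_disc (A, - A * (x + y), A * (x * y))) = A * (x - y)"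
    by (simp add: bqf_of_roots_def)
  have A: "A \<noteq> 0"
    using assms by auto
  show "alpha_of (bqf_of_roots A x y) = x" "conj_root (bqf_of_roots A x y) = y"
    unfolding alpha_of_def conj_root_def bqf_of_roots_def prod.case sqrt
    using A by (simp_all add: field_simps)
qed

lemma
  assumes "fst Q \<noteq> 0" "bqf_disc Q > 0"
  shows bqf_of_roots_collapse: "bqf_of_roots (fst Q) (alpha_of Q) (conj_root Q) = Q"
    and lead_coeff_times_root_diff: "fst Q * (alpha_of Q - conj_root Q) = sqrt (bqf_disc Q)"
proof -
  obtain A B C where Q: "Q = (A, B, C)"
    by (cases Q)
  define r where "r = sqrt (bqf_disc Q)"
  have A: "A \<noteq> 0"
    using assms(1) by (simp add: Q)
  have roots: "alpha_of Q = (- B + r) / (2 * A)" "conj_root Q = (- B - r) / (2 * A)"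
    by (simp_all add: Q r_def alpha_of_def conj_root_def)
  have "r * r = B * B - 4 * A * C"
    using assms(2) by (simp add: r_def Q bqf_disc_def power2_eq_square)
  moreover have "alpha_of Q * conj_root Q = (B * B - r * r) / (4 * A * A)"
    unfolding roots by (simp add: algebra_simps)
  ultimately have "A * (alpha_of Q * conj_root Q) = C"
    using A by simp
  moreover have "A * (alpha_of Q + conj_root Q) = - B"
    unfolding roots using A by (simp add: field_simps)
  ultimately show "bqf_of_roots (fst Q) (alpha_of Q) (conj_root Q) = Q"
    by (simp add: Q bqf_of_roots_def)
  show "fst Q * (alpha_of Q - conj_root Q) = sqrt (bqf_disc Q)"
    unfolding roots using A by (simp add: Q r_def field_simps)
qed

lemma alpha_of_uminus: "alpha_of (- Q) = conj_root Q"
  and conj_root_uminus: "conj_root (- Q) = alpha_of Q"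
proof -
  obtain A B C where Q: "Q = (A, B, C)"
    by (cases Q)
  have disc: "bqf_disc (- A, - B, - C) = bqf_disc (A, B, C)"
    by (simp add: bqf_disc_def)
  show "alpha_of (- Q) = conj_root Q" "conj_root (- Q) = alpha_of Q"
    using minus_divide_divide[of "- B - sqrt (bqf_disc Q)" "2 * A"]
      minus_divide_divide[of "- B + sqrt (bqf_disc Q)" "2 * A"]
    by (simp_all add: Q alpha_of_def conj_root_def disc add.commute)
qed

lemma bqf_act_mult: "bqf_act (bqf_act Q M) N = bqf_act Q (M ** N)"
  by (cases Q, rule mat2_cases[of M], rule mat2_cases[of N])
    (simp add: bqf_act_def Let_def power2_eq_square algebra_simps)

lemma bqf_act_mat_1: "bqf_act Q (mat 1) = Q"
  by (cases Q) (simp add: bqf_act_def Let_def mat_1_eq_mat2)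

lemma bqf_act_uminus: "bqf_act (- Q) M = - bqf_act Q M"
  by (cases Q) (simp add: bqf_act_def Let_def algebra_simps)

lemma bqf_act_uminus_mat: "bqf_act Q (- M) = bqf_act Q M"
  by (cases Q) (simp add: bqf_act_def Let_def)

lemma bqf_disc_act:
  assumes "det M = 1"
  shows "bqf_disc (bqf_act Q M) = bqf_disc Q"
proof -
  obtain a b c d where M: "M = mat2 a b c d"
    by (rule mat2_cases)
  have "bqf_disc (bqf_act Q M) = (a * d - b * c)\<^sup>2 * bqf_disc Q"
    by (cases Q) (simp add: M bqf_act_def Let_def bqf_disc_def power2_eq_square algebra_simps)
  thus ?thesis
    using assms by (simp add: M)
qed

lemma
  fixes M :: "real^2^2" and A x y :: real
  defines "X \<equiv> M$1$1 - M$2$1 * x" and "Y \<equiv> M$1$1 - M$2$1 * y"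
    and "x' \<equiv> moebius (matrix_inv M) x" and "y' \<equiv> moebius (matrix_inv M) y"
  assumes det: "det M = 1"
  shows fst_bqf_act_of_roots: "fst (bqf_act (bqf_of_roots A x y) M) = A * (X * Y)"
    and bqf_act_of_roots:
      "X \<noteq> 0 \<Longrightarrow> Y \<noteq> 0 \<Longrightarrow> bqf_act (bqf_of_roots A x y) M = bqf_of_roots (A * (X * Y)) x' y'"
    and moebius_inv_diff: "X \<noteq> 0 \<Longrightarrow> Y \<noteq> 0 \<Longrightarrow> X * Y * (x' - y') = x - y"
proof -
  obtain a b c d where M: "M = mat2 a b c d"
    by (rule mat2_cases)
  have ad: "a * d - b * c = 1"
    using det by (simp add: M)
  have moebius: "x' = (d * x - b) / X" "y' = (d * y - b) / Y"
    using ad by (simp_all add: x'_def y'_def X_def Y_def M moebius_def matrix_inv_mat2)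
  show fst_act: "fst (bqf_act (bqf_of_roots A x y) M) = A * (X * Y)"
    by (simp add: bqf_of_roots_def M bqf_act_def Let_def X_def Y_def power2_eq_square algebra_simps)
  assume XY: "X \<noteq> 0" "Y \<noteq> 0"
  have "A * (X * Y) * (x' + y') = A * ((d * x - b) * Y + (d * y - b) * X)"
    "A * (X * Y) * (x' * y') = A * ((d * x - b) * (d * y - b))"
    using XY by (simp_all add: moebius field_simps)
  thus "bqf_act (bqf_of_roots A x y) M = bqf_of_roots (A * (X * Y)) x' y'"
    using fst_act by (simp add: bqf_of_roots_def M bqf_act_def Let_def X_def Y_def
        power2_eq_square algebra_simps)
  have "X * Y * (x' - y') = (d * x - b) * Y - (d * y - b) * X"
    using XY by (simp add: moebius field_simps)
  also have "\<dots> = (a * d - b * c) * (x - y)"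
    by (simp add: X_def Y_def M algebra_simps)
  finally show "X * Y * (x' - y') = x - y"
    by (simp add: ad)
qed

lemma
  assumes Q: "fst Q \<noteq> 0" "bqf_disc Q > 0" and M: "det M = 1" and act: "fst (bqf_act Q M) \<noteq> 0"
  shows alpha_of_bqf_act: "alpha_of (bqf_act Q M) = moebius (matrix_inv M) (alpha_of Q)"
    and conj_root_bqf_act: "conj_root (bqf_act Q M) = moebius (matrix_inv M) (conj_root Q)"
proof -
  define A x y where "A = fst Q" and "x = alpha_of Q" and "y = conj_root Q"
  have Q_eq: "Q = bqf_of_roots A x y"
    using bqf_of_roots_collapse[OF Q] by (simp add: A_def x_def y_def)
  define X Y where "X = M$1$1 - M$2$1 * x" and "Y = M$1$1 - M$2$1 * y"
  have XY: "X \<noteq> 0" "Y \<noteq> 0"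
    using act fst_bqf_act_of_roots[OF M, of A x y] by (auto simp: Q_eq X_def Y_def)
  note act_eq = bqf_act_of_roots[OF M, of x y A, folded X_def Y_def Q_eq, OF XY]
  have "A * (x - y) > 0"
    using lead_coeff_times_root_diff[OF Q] Q(2) by (simp add: A_def x_def y_def)
  hence "A * (X * Y) * (moebius (matrix_inv M) x - moebius (matrix_inv M) y) > 0"
    using moebius_inv_diff[OF M, of x y, folded X_def Y_def, OF XY] by (simp only: mult.assoc)
  thus "alpha_of (bqf_act Q M) = moebius (matrix_inv M) (alpha_of Q)"
    "conj_root (bqf_act Q M) = moebius (matrix_inv M) (conj_root Q)"
    unfolding act_eq by (simp_all add: alpha_of_bqf_of_roots conj_root_bqf_of_roots x_def y_def)
qed


subsection \<open>Hyperbolic forms\<close>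

context hecke
begin

lemma hecke_conj_axis:
  assumes "is_axis \<alpha> \<beta>"
  shows "hecke_conj p \<alpha> = \<beta>"
  unfolding hecke_conj_def stabilizer_fixed_point_iff[OF assms] by simp

lemma M_of_axis:
  assumes axis: "is_axis \<alpha> \<beta>"
  obtains t where "t > 1" "M_of p \<alpha> = hyperbolic_mat \<alpha> \<beta> t" "M_of p \<alpha> \<in> hecke_group p"
proof -
  have "primitive p M \<longleftrightarrow> primitive_in (hecke_group p) M" for M
    by (simp add: primitive_def primitive_in_def)
  hence "M_of p \<alpha> \<in> hecke_group p \<and> hyperbolic (M_of p \<alpha>) \<and>
      primitive_in (hecke_group p) (M_of p \<alpha>) \<and> trace (M_of p \<alpha>) > 0 \<and>
      \<alpha> = attracting_point (M_of p \<alpha>)"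
    unfolding M_of_def using theI'[OF ex1_primitive_hyperbolic[OF axis]]
    by (simp add: attracting_point_def)
  thus ?thesis
    using hyperbolic_attracting_iff[OF axis] that by blast
qed

lemma hyperbolic_formE:
  assumes "hyperbolic_form p Q"
  obtains \<alpha> \<beta> t where "is_axis \<alpha> \<beta>" "t > 1" "hyperbolic_mat \<alpha> \<beta> t \<in> hecke_group p"
    "M_of p \<alpha> = hyperbolic_mat \<alpha> \<beta> t" "Q = Q_of p \<alpha>"
    "Q = bqf_of_roots ((t - 1 / t) / (\<alpha> - \<beta>)) \<alpha> \<beta>"
proof -
  obtain \<alpha> where \<alpha>: "hyperbolic_fixed_point p \<alpha>" "Q = Q_of p \<alpha>"
    using assms by (auto simp: hyperbolic_form_def)
  then obtain \<beta> where axis: "is_axis \<alpha> \<beta>"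
    using ex_axis by (auto simp: hyperbolic_fixed_point_def)
  obtain t where t: "t > 1" "M_of p \<alpha> = hyperbolic_mat \<alpha> \<beta> t" "M_of p \<alpha> \<in> hecke_group p"
    using axis by (rule M_of_axis)
  have "Q = bqf_of_roots ((t - 1 / t) / (\<alpha> - \<beta>)) \<alpha> \<beta>"
    unfolding \<alpha>(2) Q_of_def Let_def t(2) hyperbolic_mat_eq mat2_nth bqf_of_roots_def
    by (simp add: divide_inverse algebra_simps)
  thus ?thesis
    using that axis t \<alpha>(2) by metis
qed

lemma hyperbolic_form_roots:
  assumes "hyperbolic_form p Q"
  shows "Q_of p (alpha_of Q) = Q" "hecke_conj p (alpha_of Q) = conj_root Q" "bqf_disc Q > 0"
proof -
  obtain \<alpha> \<beta> t where axis: "is_axis \<alpha> \<beta>" and t: "t > 1" and "Q = Q_of p \<alpha>"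
    and Q: "Q = bqf_of_roots ((t - 1 / t) / (\<alpha> - \<beta>)) \<alpha> \<beta>"
    using assms by (rule hyperbolic_formE)
  have pos: "(t - 1 / t) / (\<alpha> - \<beta>) * (\<alpha> - \<beta>) > 0"
    using is_axis_neq[OF axis] diff_inverse_pos[OF t] by simp
  show "Q_of p (alpha_of Q) = Q" "hecke_conj p (alpha_of Q) = conj_root Q"
    using alpha_of_bqf_of_roots[OF pos] conj_root_bqf_of_roots[OF pos] hecke_conj_axis[OF axis]
      \<open>Q = Q_of p \<alpha>\<close> by (simp_all flip: Q)
  show "bqf_disc Q > 0"
    using pos by (simp add: Q bqf_disc_of_roots)
qed

lemma hyperbolic_form_matrixE:
  assumes "hyperbolic_form p Q"
  obtains a b c d where "mat2 a b c d \<in> hecke_group p" "hyperbolic (mat2 a b c d)"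
    "Q = (c, d - a, - b)"
proof -
  obtain \<alpha> \<beta> t where axis: "is_axis \<alpha> \<beta>" and t: "t > 1"
    and mem: "hyperbolic_mat \<alpha> \<beta> t \<in> hecke_group p"
    and M: "M_of p \<alpha> = hyperbolic_mat \<alpha> \<beta> t" and Q: "Q = Q_of p \<alpha>"
    using assms by (rule hyperbolic_formE)
  have "hyperbolic (hyperbolic_mat \<alpha> \<beta> t)"
    using hyperbolic_attracting_iff[OF axis] t mem by blast
  thus ?thesis
    using that[of "M_of p \<alpha> $ 1 $ 1" "M_of p \<alpha> $ 1 $ 2" "M_of p \<alpha> $ 2 $ 1" "M_of p \<alpha> $ 2 $ 2"] mem
    unfolding mat2_collapse Q Q_of_def Let_def M by blast
qed

lemma hyperbolic_form_coeffs_ge_1: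
  assumes "hyperbolic_form p Q"
  shows "\<bar>fst Q\<bar> \<ge> 1" "\<bar>snd (snd Q)\<bar> \<ge> 1"
proof -
  obtain a b c d where M: "mat2 a b c d \<in> hecke_group p" "hyperbolic (mat2 a b c d)"
    and Q: "Q = (c, d - a, - b)"
    using assms by (rule hyperbolic_form_matrixE)
  have "c \<noteq> 0"
    using hyperbolic_lower_left_neq_0[OF M] by simp
  have "hecke_T ** mat2 a b c d ** hecke_T \<in> hecke_group p"
    by (intro hecke_group.intros M)
  hence "mat2 (- d) c b (- a) \<in> hecke_group p"
    by (simp add: hecke_T_eq)
  hence "b \<noteq> 0"
    using hyperbolic_lower_left_neq_0[of "mat2 (- d) c b (- a)"] M(2) by (auto simp: hyperbolic_def)
  with \<open>c \<noteq> 0\<close> show "\<bar>fst Q\<bar> \<ge> 1" "\<bar>snd (snd Q)\<bar> \<ge> 1"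
    using hecke_group_entries[OF M(1), of 2 1] hecke_group_entries[OF M(1), of 1 2]
    by (simp_all add: Q zero_or_ge_1_def)
qed

lemma finite_simple_hyperbolic_forms:
  "finite {Q. hyperbolic_form p Q \<and> bqf_simple Q \<and> bqf_disc Q = D}"
proof -
  have "{Q. hyperbolic_form p Q \<and> bqf_simple Q \<and> bqf_disc Q = D} \<subseteq>
      (\<lambda>M. (M$2$1, M$2$2 - M$1$1, - (M$1$2))) ` {M \<in> hecke_group p. bounded_entries (D + 5) M}"
  proof
    fix Q assume "Q \<in> {Q. hyperbolic_form p Q \<and> bqf_simple Q \<and> bqf_disc Q = D}"
    hence form: "hyperbolic_form p Q" and simple: "bqf_simple Q" and D: "bqf_disc Q = D"
      by simp_all
    obtain a b c d where M: "mat2 a b c d \<in> hecke_group p" and Q: "Q = (c, d - a, - b)"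
      using form by (rule hyperbolic_form_matrixE)
    have bc: "b \<ge> 1" "c \<ge> 1"
      using hyperbolic_form_coeffs_ge_1[OF form] simple Q by (auto simp: bqf_simple_def)
    have D_eq: "D = (d - a)\<^sup>2 + 4 * (b * c)"
      unfolding D[symmetric] Q by (simp add: bqf_disc_def)
    have "(a + d)\<^sup>2 = D + 4 * (a * d - b * c)"
      unfolding D_eq by (simp add: power2_eq_square algebra_simps)
    hence tr: "(a + d)\<^sup>2 = D + 4"
      using det_hecke_group[OF M] by simp
    have abs_le: "\<bar>x\<bar> \<le> x\<^sup>2 + 1" for x :: real
      using zero_le_power2[of "\<bar>x\<bar> - 1"] by (simp add: power2_eq_square algebra_simps)
    have "b * 1 \<le> b * c" "1 * c \<le> b * c"
      using bc by (auto intro: mult_mono)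
    moreover have "0 \<le> (d - a)\<^sup>2"
      by simp
    ultimately have "\<bar>b\<bar> \<le> D + 5" "\<bar>c\<bar> \<le> D + 5" "(d - a)\<^sup>2 \<le> D"
      using bc unfolding D_eq by linarith+
    moreover from this have "\<bar>d - a\<bar> \<le> D + 1" "\<bar>a + d\<bar> \<le> D + 5"
      using abs_le[of "d - a"] abs_le[of "a + d"] by (simp_all add: tr)
    hence "\<bar>a\<bar> \<le> D + 5" "\<bar>d\<bar> \<le> D + 5"
      by linarith+
    ultimately have "mat2 a b c d \<in> {M \<in> hecke_group p. bounded_entries (D + 5) M}"
      using M by simp
    thus "Q \<in> (\<lambda>M. (M$2$1, M$2$2 - M$1$1, - (M$1$2))) `
        {M \<in> hecke_group p. bounded_entries (D + 5) M}"
      by (rule image_eqI[rotated]) (simp add: Q)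
  qed
  thus ?thesis
    using finite_bounded finite_surj by blast
qed

end


subsection \<open>Simple forms of a symmetric class\<close>

definition simple_forms :: "bqf set \<Rightarrow> bqf set" where
  "simple_forms \<A> = {Q \<in> \<A>. bqf_simple Q}"

abbreviation U_act :: "nat \<Rightarrow> bqf \<Rightarrow> bqf" where
  "U_act p Q \<equiv> bqf_act Q (hecke_U p)"

lemma U_act_last_coeff: "snd (snd (U_act p Q)) = fst Q"
  by (cases Q) (simp add: bqf_act_def Let_def hecke_U_eq_mat2)

lemma funpow_U_act_uminus: "(U_act p ^^ j) (- Q) = - (U_act p ^^ j) Q"
  by (induction j) (simp_all add: bqf_act_uminus)

context hecke
begin

lemma funpow_U_act: "(U_act p ^^ j) Q = bqf_act Q (U_power p j)"
  by (induction j) (simp_all add: U_power_0 bqf_act_mat_1 bqf_act_mult U_power_Suc)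

lemma U_act_period: "(U_act p ^^ p) Q = Q"
  by (simp add: funpow_U_act U_power_p bqf_act_uminus_mat bqf_act_mat_1)

lemma inj_U_act: "inj (U_act p)"
proof (rule injI)
  fix Q Q' assume "U_act p Q = U_act p Q'"
  hence "(U_act p ^^ Suc (p - 1)) Q = (U_act p ^^ Suc (p - 1)) Q'"
    by (simp only: funpow_Suc_right o_apply)
  thus "Q = Q'"
    using p_ge_3 U_act_period by (simp del: funpow.simps)
qed

end

locale symmetric_class = hecke +
  fixes \<A> :: "bqf set"
  assumes hyperbolic: "hyperbolic_class p \<A>"
    and symmetric: "\<A> = uminus ` \<A>"
begin

lemma hyperbolic_form: "Q \<in> \<A> \<Longrightarrow> hyperbolic_form p Q"
  using hyperbolic by (simp add: hyperbolic_class_def)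

lemmas roots = hyperbolic_form_roots[OF hyperbolic_form]

lemma outer_coeffs_neq_0: "Q \<in> \<A> \<Longrightarrow> fst Q \<noteq> 0" "Q \<in> \<A> \<Longrightarrow> snd (snd Q) \<noteq> 0"
  using hyperbolic_form_coeffs_ge_1[OF hyperbolic_form] by fastforce+

lemma uminus_mem: "Q \<in> \<A> \<Longrightarrow> - Q \<in> \<A>"
  using symmetric by blast

lemma bqf_act_mem:
  assumes "Q \<in> \<A>" "M \<in> hecke_group p"
  shows "bqf_act Q M \<in> \<A>"
proof -
  obtain Q0 where Q0: "\<A> = bqf_class p Q0"
    using hyperbolic by (auto simp: hyperbolic_class_def)
  then obtain N where "N \<in> hecke_group p" "Q = bqf_act Q0 N"
    using assms(1) by (auto simp: bqf_class_def)
  thus ?thesis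
    using assms(2) by (auto simp: Q0 bqf_class_def bqf_act_mult intro: hecke_group.mult)
qed

lemma funpow_U_act_mem: "Q \<in> \<A> \<Longrightarrow> (U_act p ^^ j) Q \<in> \<A>"
  by (induction j) (auto intro: bqf_act_mem hecke_U_mem)

lemma finite_simple_forms: "finite (simple_forms \<A>)"
proof -
  obtain Q0 where Q0: "\<A> = bqf_class p Q0"
    using hyperbolic by (auto simp: hyperbolic_class_def)
  hence "simple_forms \<A> \<subseteq> {Q. hyperbolic_form p Q \<and> bqf_simple Q \<and> bqf_disc Q = bqf_disc Q0}"
    using hyperbolic_form
    by (auto simp: simple_forms_def bqf_class_def bqf_disc_act det_hecke_group)
  thus ?thesis
    using finite_simple_hyperbolic_forms finite_subset by blast
qed

lemma sum_Z_set:
  "(\<Sum>\<alpha>\<in>Z_set \<A>. g \<alpha> (Q_of p \<alpha>) (hecke_conj p \<alpha>)) =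
     (\<Sum>Q\<in>simple_forms \<A>. g (alpha_of Q) Q (conj_root Q))"
proof -
  have "inj_on alpha_of (simple_forms \<A>)"
    by (rule inj_onI) (metis (no_types, lifting) roots(1) mem_Collect_eq simple_forms_def)
  hence "(\<Sum>\<alpha>\<in>Z_set \<A>. g \<alpha> (Q_of p \<alpha>) (hecke_conj p \<alpha>)) =
      (\<Sum>Q\<in>simple_forms \<A>. g (alpha_of Q) (Q_of p (alpha_of Q)) (hecke_conj p (alpha_of Q)))"
    unfolding Z_set_def simple_forms_def[symmetric] by (simp add: sum.reindex)
  also have "\<dots> = (\<Sum>Q\<in>simple_forms \<A>. g (alpha_of Q) Q (conj_root Q))"
    by (rule sum.cong) (auto simp: simple_forms_def roots)
  finally show ?thesis .
qed

lemma finite_U_act_invariant_superset: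
  assumes "finite S" "S \<subseteq> \<A>"
  obtains X where "finite X" "S \<subseteq> X" "X \<subseteq> \<A>" "bij_betw (U_act p) X X"
proof -
  define X where "X = (\<Union>j<p. (U_act p ^^ j) ` S)"
  have finite_X: "finite X"
    using assms(1) by (simp add: X_def)
  have "U_act p Q \<in> X" if Q: "Q \<in> X" for Q
  proof -
    obtain j Q0 where j: "j < p" "Q0 \<in> S" "Q = (U_act p ^^ j) Q0"
      using Q unfolding X_def by blast
    hence "U_act p Q = (U_act p ^^ (Suc j mod p)) Q0"
      using U_act_period[of Q0] by (cases "Suc j = p") auto
    thus ?thesis
      using j p_ge_3 by (auto simp: X_def intro!: bexI[of _ "Suc j mod p"])
  qed
  hence "U_act p ` X = X"
    using finite_X inj_U_act by (intro endo_inj_surj) (auto intro: inj_on_subset)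
  hence "bij_betw (U_act p) X X"
    using inj_U_act by (auto simp: bij_betw_def intro: inj_on_subset)
  moreover have "S \<subseteq> X"
    using p_ge_3 unfolding X_def by (intro subsetI UN_I[of 0]) auto
  moreover have "X \<subseteq> \<A>"
    using assms(2) funpow_U_act_mem unfolding X_def by blast
  ultimately show ?thesis
    using that finite_X by blast
qed

text \<open>On a finite \<open>U\<close>-invariant set of forms \<open>[A, B, C]\<close>, the sum of \<open>\<psi>\<close> over those with
  \<open>A > 0\<close> equals the sum over those with \<open>C > 0\<close>, because \<open>Q \<circ> U\<close> has the last coefficient \<open>A\<close>.
  The forms in only one of the two sums are the simple ones and their negatives.\<close>

lemma sum_simple_forms_eq_0:
  fixes \<psi> :: "bqf \<Rightarrow> complex"
  assumes invariant: "\<And>Q. \<psi> (U_act p Q) = \<psi> Q" and odd: "\<And>Q. \<psi> (- Q) = - \<psi> Q"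
  shows "(\<Sum>Q\<in>simple_forms \<A>. \<psi> Q) = 0"
proof -
  define S where "S = simple_forms \<A>"
  have "S \<union> uminus ` S \<subseteq> \<A>"
    using uminus_mem by (auto simp: S_def simple_forms_def)
  moreover have "finite (S \<union> uminus ` S)"
    using finite_simple_forms by (simp add: S_def)
  ultimately obtain X where X: "finite X" "S \<union> uminus ` S \<subseteq> X" "X \<subseteq> \<A>"
    and bij: "bij_betw (U_act p) X X"
    by (metis finite_U_act_invariant_superset)
  have "(\<Sum>Q\<in>X. if snd (snd Q) > 0 then \<psi> Q else 0) = (\<Sum>Q\<in>X. if fst Q > 0 then \<psi> Q else 0)"
    by (subst sum.reindex_bij_betw[OF bij, symmetric])
      (simp add: U_act_last_coeff invariant cong: if_cong)
  hence "0 = (\<Sum>Q\<in>X. (if fst Q > 0 then \<psi> Q else 0) - (if snd (snd Q) > 0 then \<psi> Q else 0))"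
    by (simp add: sum_subtractf)
  also have "\<dots> = (\<Sum>Q\<in>X. (if Q \<in> S then \<psi> Q else 0) - (if - Q \<in> S then \<psi> Q else 0))"
  proof (rule sum.cong[OF refl])
    fix Q assume "Q \<in> X"
    hence Q: "Q \<in> \<A>" "- Q \<in> \<A>"
      using X(3) uminus_mem by blast+
    show "(if fst Q > 0 then \<psi> Q else 0) - (if snd (snd Q) > 0 then \<psi> Q else 0) =
        (if Q \<in> S then \<psi> Q else 0) - (if - Q \<in> S then \<psi> Q else 0)"
      using Q outer_coeffs_neq_0[OF Q(1)]
      by (cases Q) (auto simp: S_def simple_forms_def bqf_simple_def)
  qed
  also have "\<dots> = (\<Sum>Q\<in>S. \<psi> Q) - (\<Sum>Q\<in>uminus ` S. \<psi> Q)"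
  proof -
    have "X \<inter> {Q. Q \<in> S} = S" "X \<inter> {Q. - Q \<in> S} = uminus ` S"
      using X(2) by (auto intro: image_eqI[of _ _ "- _"])
    thus ?thesis
      using X(1) by (simp add: sum_subtractf sum.If_cases)
  qed
  also have "(\<Sum>Q\<in>uminus ` S. \<psi> Q) = - (\<Sum>Q\<in>S. \<psi> Q)"
    by (simp add: sum.reindex odd sum_negf)
  finally show ?thesis
    by (simp add: S_def)
qed

lemma orbit_sum_eq_0:
  fixes \<phi> :: "bqf \<Rightarrow> complex"
  assumes odd: "\<And>Q. \<phi> (- Q) = - \<phi> Q"
  shows "(\<Sum>Q\<in>simple_forms \<A>. \<Sum>j<p. \<phi> ((U_act p ^^ j) Q)) = 0"
proof (rule sum_simple_forms_eq_0)
  fix Q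
  show "(\<Sum>j<p. \<phi> ((U_act p ^^ j) (- Q))) = - (\<Sum>j<p. \<phi> ((U_act p ^^ j) Q))"
    by (simp add: funpow_U_act_uminus odd sum_negf)
  have "(\<Sum>j<p. \<phi> ((U_act p ^^ j) (U_act p Q))) + \<phi> Q = (\<Sum>j<Suc p. \<phi> ((U_act p ^^ j) Q))"
    by (simp add: sum.lessThan_Suc_shift funpow_swap1[of "U_act p"] del: sum.lessThan_Suc)
  also have "\<dots> = (\<Sum>j<p. \<phi> ((U_act p ^^ j) Q)) + \<phi> Q"
    by (simp add: U_act_period)
  finally show "(\<Sum>j<p. \<phi> ((U_act p ^^ j) (U_act p Q))) = (\<Sum>j<p. \<phi> ((U_act p ^^ j) Q))"
    by simp
qed

lemma funpow_rho_single:
  assumes "Q \<in> \<A>"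
  shows "(rho p ^^ j) (Poly_Mapping.single (alpha_of Q, conj_root Q) c) =
    Poly_Mapping.single (alpha_of ((U_act p ^^ j) Q), conj_root ((U_act p ^^ j) Q)) c"
proof (induction j)
  case (Suc j)
  let ?Q = "(U_act p ^^ j) Q"
  have mem: "?Q \<in> \<A>" "U_act p ?Q \<in> \<A>"
    using funpow_U_act_mem[OF assms, of j] funpow_U_act_mem[OF assms, of "Suc j"] by simp_all
  have "det (hecke_U p) = 1"
    by (rule det_hecke_group[OF hecke_U_mem])
  thus ?case
    using outer_coeffs_neq_0(1)[OF mem(1)] outer_coeffs_neq_0(1)[OF mem(2)] roots(3)[OF mem(1)]
    by (simp add: Suc rho_single alpha_of_bqf_act conj_root_bqf_act)
qed simp

lemma bqf_eval_eq_linear_factors: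
  assumes Q: "Q \<in> \<A>" and D: "bqf_disc Q = D"
  shows "1 / bqf_eval Q z 1 ^ k = of_real (D powr (- (real k / 2))) *
    (of_real (alpha_of Q - conj_root Q) ^ k /
      ((z - of_real (alpha_of Q)) ^ k * (z - of_real (conj_root Q)) ^ k))"
proof -
  define A x y where "A = fst Q" and "x = alpha_of Q" and "y = conj_root Q"
  have A: "A \<noteq> 0" and D_pos: "D > 0"
    using outer_coeffs_neq_0(1)[OF Q] roots(3)[OF Q] D by (simp_all add: A_def)
  have Q_eq: "Q = bqf_of_roots A x y" and diff: "A * (x - y) = sqrt D"
    using bqf_of_roots_collapse[of Q] lead_coeff_times_root_diff[of Q] A D D_pos
    by (simp_all add: A_def x_def y_def)
  have "D powr (- (real k / 2)) = inverse ((D powr (1 / 2)) powr real k)"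
    by (simp add: powr_powr powr_minus)
  also have "\<dots> = inverse (sqrt D ^ k)"
    using D_pos by (simp add: powr_half_sqrt powr_realpow)
  finally have "D powr (- (real k / 2)) = inverse ((A * (x - y)) ^ k)"
    by (simp add: diff)
  moreover have "x - y \<noteq> 0"
    using diff D_pos by auto
  ultimately have "D powr (- (real k / 2)) * (x - y) ^ k = inverse (A ^ k)"
    using A by (simp add: power_mult_distrib)
  hence "of_real (D powr (- (real k / 2))) * of_real (x - y) ^ k =
      inverse (of_real A ^ k :: complex)"
    by (metis of_real_inverse of_real_mult of_real_power)
  moreover have "1 / bqf_eval Q z 1 ^ k =
      inverse (of_real A ^ k) / ((z - of_real x) ^ k * (z - of_real y) ^ k)"
    by (simp add: Q_eq bqf_eval_of_roots power_mult_distrib divide_inverse)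
  ultimately show ?thesis
    by (simp only: x_def y_def times_divide_eq_right)
qed

text \<open>The map \<open>Q \<mapsto> - (Q \<circ> T)\<close> permutes the simple forms.\<close>

lemma sum_bqf_eval_reflect:
  assumes k: "odd k" and z: "z \<noteq> 0"
  shows "(\<Sum>Q\<in>simple_forms \<A>. 1 / bqf_eval Q (- 1 / z) 1 ^ k) =
     - (z ^ (2 * k)) * (\<Sum>Q\<in>simple_forms \<A>. 1 / bqf_eval Q z 1 ^ k)"
proof -
  define \<tau> where "\<tau> Q = - bqf_act Q hecke_T" for Q
  have \<tau>: "\<tau> (A, B, C) = (- C, B, - A)" for A B C
    by (simp add: \<tau>_def bqf_act_def Let_def hecke_T_eq)
  have "\<tau> Q \<in> simple_forms \<A>" if "Q \<in> simple_forms \<A>" for Q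
    using that uminus_mem[OF bqf_act_mem[OF _ hecke_group.T]]
    by (cases Q) (auto simp: simple_forms_def \<tau>_def[symmetric] \<tau> bqf_simple_def)
  moreover have "\<tau> (\<tau> Q) = Q" for Q
    by (cases Q) (simp add: \<tau>)
  ultimately have bij: "bij_betw \<tau> (simple_forms \<A>) (simple_forms \<A>)"
    by (intro bij_betwI[of _ _ _ \<tau>]) auto
  have "1 / bqf_eval Q (- 1 / z) 1 ^ k = - (z ^ (2 * k)) * (1 / bqf_eval (\<tau> Q) z 1 ^ k)" for Q
  proof -
    obtain A B C where Q: "Q = (A, B, C)"
      by (cases Q)
    have "bqf_eval Q (- 1 / z) 1 = - (bqf_eval (\<tau> Q) z 1 / z\<^sup>2)"
      using z by (simp add: Q \<tau> bqf_eval_def power2_eq_square field_simps)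
    hence "bqf_eval Q (- 1 / z) 1 ^ k = - (bqf_eval (\<tau> Q) z 1 ^ k / z ^ (2 * k))"
      using k by (simp add: power_divide power_mult)
    thus ?thesis
      by simp
  qed
  hence "(\<Sum>Q\<in>simple_forms \<A>. 1 / bqf_eval Q (- 1 / z) 1 ^ k) =
      - (z ^ (2 * k)) * (\<Sum>Q\<in>simple_forms \<A>. 1 / bqf_eval (\<tau> Q) z 1 ^ k)"
    by (simp only: sum_distrib_left)
  thus ?thesis
    by (simp only: sum.reindex_bij_betw[OF bij, of "\<lambda>Q. 1 / bqf_eval Q z 1 ^ k"])
qed

end


subsection \<open>The algebraic cancellation\<close>

lemma hecke_R_swap: "odd k \<Longrightarrow> hecke_R k s b a = - hecke_R k s a b"
proof -
  assume "odd k"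
  hence "complex_of_real (b - a) ^ k = - (complex_of_real (a - b) ^ k)"
    by (metis minus_diff_eq of_real_minus power_minus_odd)
  thus ?thesis
    by (simp add: hecke_R_def mult.commute)
qed

lemma additive_funpow:
  fixes f :: "'a::ab_group_add \<Rightarrow> 'a"
  shows "Modules.additive f \<Longrightarrow> Modules.additive (f ^^ n)"
  by (induction n) (simp_all add: Modules.additive_def)

interpretation R_eval: Modules.additive "\<lambda>X. R_eval k X s"
  by unfold_locales (rule R_eval_add)

interpretation funpow_rho: Modules.additive "rho p ^^ j"
  by (rule additive_funpow) (simp add: Modules.additive_def rho_add)

locale symmetric_period = hecke +
  fixes k L :: nat and d :: "nat \<Rightarrow> complex" and D :: "nat \<Rightarrow> real" and \<A> :: "nat \<Rightarrow> bqf set"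
  assumes odd_k: "odd k"
    and hyperbolic: "l \<in> {1..L} \<Longrightarrow> hyperbolic_class p (\<A> l)"
    and symmetric: "l \<in> {1..L} \<Longrightarrow> \<A> l = uminus ` \<A> l"
    and disc: "l \<in> {1..L} \<Longrightarrow> Q \<in> \<A> l \<Longrightarrow> bqf_disc Q = D l"
begin

lemma symmetric_class: "l \<in> {1..L} \<Longrightarrow> symmetric_class p (\<A> l)"
  using hyperbolic symmetric by unfold_locales

definition remainder_coeff :: "nat \<Rightarrow> complex" where
  "remainder_coeff l = d l * of_real (D l powr (- (real k / 2)))"

lemma R_remainder_eq:
  "R_remainder p k L d D \<A> = - (\<Sum>l=1..L. \<Sum>Q\<in>simple_forms (\<A> l).
     Poly_Mapping.single (alpha_of Q, conj_root Q) (remainder_coeff l))"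
  unfolding R_remainder_def remainder_coeff_def
  by (intro arg_cong[of _ _ uminus] sum.cong refl symmetric_class.sum_Z_set[OF symmetric_class,
      of _ "\<lambda>a Q b. Poly_Mapping.single (a, b) _"])

lemma R_eval_funpow_rho:
  "R_eval k ((rho p ^^ j) (R_remainder p k L d D \<A>)) s =
     - (\<Sum>l=1..L. \<Sum>Q\<in>simple_forms (\<A> l). remainder_coeff l *
          hecke_R k s (alpha_of ((U_act p ^^ j) Q)) (conj_root ((U_act p ^^ j) Q)))"
proof -
  have "R_eval k ((rho p ^^ j)
        (Poly_Mapping.single (alpha_of Q, conj_root Q) (remainder_coeff l))) s =
      remainder_coeff l * hecke_R k s (alpha_of ((U_act p ^^ j) Q)) (conj_root ((U_act p ^^ j) Q))"
    if "l \<in> {1..L}" "Q \<in> simple_forms (\<A> l)" for l Q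
    using symmetric_class.funpow_rho_single[OF symmetric_class[OF that(1)], of Q] that(2)
    by (simp add: simple_forms_def R_eval_single)
  thus ?thesis
    by (simp add: R_remainder_eq funpow_rho.minus funpow_rho.sum R_eval.minus R_eval.sum)
qed

theorem R_eval_rho_orbit_sum_eq_0:
  "R_eval k (\<Sum>j<p. (rho p ^^ j) (R_remainder p k L d D \<A>)) s = 0"
proof -
  define \<phi> where "\<phi> Q = hecke_R k s (alpha_of Q) (conj_root Q)" for Q
  have "R_eval k (\<Sum>j<p. (rho p ^^ j) (R_remainder p k L d D \<A>)) s =
      - (\<Sum>j<p. \<Sum>l=1..L. \<Sum>Q\<in>simple_forms (\<A> l). remainder_coeff l * \<phi> ((U_act p ^^ j) Q))"
    by (simp add: R_eval.sum R_eval_funpow_rho sum_negf \<phi>_def)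
  also have "\<dots> = - (\<Sum>l=1..L. \<Sum>j<p. \<Sum>Q\<in>simple_forms (\<A> l). remainder_coeff l * \<phi> ((U_act p ^^ j) Q))"
    by (subst sum.swap) simp
  also have "\<dots> = - (\<Sum>l=1..L. remainder_coeff l *
      (\<Sum>Q\<in>simple_forms (\<A> l). \<Sum>j<p. \<phi> ((U_act p ^^ j) Q)))"
    unfolding sum_distrib_left by (intro arg_cong[of _ _ uminus] sum.cong refl sum.swap)
  also have "\<dots> = 0"
  proof -
    have "\<phi> (- Q) = - \<phi> Q" for Q
      by (simp add: \<phi>_def alpha_of_uminus conj_root_uminus
          hecke_R_swap[OF odd_k, of s "conj_root Q"])
    thus ?thesis
      using symmetric_class.orbit_sum_eq_0[OF symmetric_class] by simp
  qed
  finally show ?thesis .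
qed

end


subsection \<open>Mellin integrals\<close>

definition mellin_integrand :: "(real \<Rightarrow> complex) \<Rightarrow> complex \<Rightarrow> real \<Rightarrow> complex" where
  "mellin_integrand g s y = g y * of_real y powr s / of_real y"

definition mellin :: "(real \<Rightarrow> complex) \<Rightarrow> complex \<Rightarrow> complex" where
  "mellin g s = set_lebesgue_integral lborel {0<..} (mellin_integrand g s)"

definition mellin_head :: "(real \<Rightarrow> complex) \<Rightarrow> complex \<Rightarrow> complex" where
  "mellin_head g s = set_lebesgue_integral lborel {0<..<1} (mellin_integrand g s)"

definition mellin_tail :: "(real \<Rightarrow> complex) \<Rightarrow> complex \<Rightarrow> complex" where
  "mellin_tail g s = set_lebesgue_integral lborel {1..} (mellin_integrand g s)"

lemma mellin_split:
  assumes "set_integrable lborel {0<..} (mellin_integrand g s)"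
  shows "mellin g s = mellin_head g s + mellin_tail g s"
proof -
  have "set_integrable lborel {0<..<1} (mellin_integrand g s)"
    "set_integrable lborel {1..} (mellin_integrand g s)"
    by (rule set_integrable_subset[OF assms]; force)+
  moreover have un: "{0::real<..} = {0<..<1} \<union> {1..}"
    by auto
  ultimately show ?thesis
    unfolding mellin_def mellin_head_def mellin_tail_def un by (intro set_integral_Un) auto
qed

lemma mellin_integrand_add:
  "mellin_integrand (\<lambda>y. g y + h y) s = (\<lambda>y. mellin_integrand g s y + mellin_integrand h s y)"
  by (simp add: fun_eq_iff mellin_integrand_def distrib_right add_divide_distrib)

lemma mellin_integrand_cmult:
  "mellin_integrand (\<lambda>y. a * g y) s = (\<lambda>y. a * mellin_integrand g s y)"
  by (simp add: fun_eq_iff mellin_integrand_def mult.assoc)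

lemma mellin_integrand_sum:
  "mellin_integrand (\<lambda>y. \<Sum>i\<in>I. g i y) s = (\<lambda>y. \<Sum>i\<in>I. mellin_integrand (g i) s y)"
  by (simp add: fun_eq_iff mellin_integrand_def sum_distrib_right sum_divide_distrib)

lemma mellin_integrand_powi:
  "y > 0 \<Longrightarrow>
     mellin_integrand (\<lambda>y. of_real y powi n * g y) s y = mellin_integrand g (s + of_int n) y"
  by (simp add: mellin_integrand_def powr_add complex_powr_of_int)

lemma norm_mellin_integrand:
  "y > 0 \<Longrightarrow> norm (mellin_integrand g s y) = norm (g y) * y powr (Re s - 1)"
  by (simp add: mellin_integrand_def norm_divide norm_mult norm_powr_real_powr powr_diff)

lemma continuous_on_mellin_integrand:
  assumes "continuous_on A g" "A \<subseteq> {0<..}"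
  shows "continuous_on A (mellin_integrand g s)"
  unfolding mellin_integrand_def
  using assms(2) by (intro continuous_intros assms(1)) (auto simp: complex_nonpos_Reals_iff)

lemma set_borel_measurable_mellin_integrand:
  assumes "continuous_on A g" "A \<subseteq> {0<..}" "A \<in> sets borel"
  shows "set_borel_measurable borel A (mellin_integrand g s)"
  using continuous_on_mellin_integrand[OF assms(1,2)] assms(3)
  by (simp add: set_borel_measurable_def borel_measurable_continuous_on_indicator)

lemma mellin_integrand_integrable:
  assumes A: "A \<in> sets borel" "A \<subseteq> {0<..}" and g: "continuous_on A g"
    and bound: "\<And>y. y \<in> A \<Longrightarrow> norm (g y) \<le> C * y powr (- c)"
    and integrable: "set_integrable lborel A (\<lambda>y. y powr (Re s - c - 1))"
  shows "set_integrable lborel A (mellin_integrand g s)"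
proof (rule set_integrable_bound)
  show "set_integrable lborel A (\<lambda>y. C * y powr (Re s - c - 1))"
    using integrable by auto
  show "set_borel_measurable lborel A (mellin_integrand g s)"
    using set_borel_measurable_mellin_integrand[OF g A(2,1)] by (simp add: set_borel_measurable_def)
  have "norm (mellin_integrand g s y) \<le> C * y powr (Re s - c - 1)" if "y \<in> A" for y
  proof -
    have "norm (mellin_integrand g s y) = norm (g y) * y powr (Re s - 1)"
      using that A(2) by (intro norm_mellin_integrand) auto
    also have "\<dots> \<le> (C * y powr (- c)) * y powr (Re s - 1)"
      by (intro mult_right_mono bound that) simp
    also have "\<dots> = C * y powr (Re s - c - 1)"
      by (simp add: powr_add[symmetric] algebra_simps)
    finally show ?thesis .
  qed
  thus "AE y in lborel. y \<in> A \<longrightarrow> norm (mellin_integrand g s y) \<le> norm (C * y powr (Re s - c - 1))"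
    by (intro AE_I2) (fastforce intro: order_trans[OF _ abs_ge_self])
qed

lemma set_integrable_lborel_iff:
  fixes f :: "real \<Rightarrow> 'a::euclidean_space"
  assumes [measurable]: "f \<in> borel_measurable borel" "A \<in> sets borel"
  shows "set_integrable lborel A f \<longleftrightarrow> f absolutely_integrable_on A"
  unfolding set_integrable_def by (rule integrable_completion[symmetric]) measurable

lemma
  fixes e :: real
  assumes "a > 0" "e < -1"
  shows set_integrable_powr_atLeast: "set_integrable lborel {a..} (\<lambda>y. y powr e)"
    and set_integral_powr_atLeast: "(LINT y:{a..}|lborel. y powr e) = - (a powr (e + 1)) / (e + 1)"
proof -
  have integral: "((\<lambda>y. y powr e) has_integral - (a powr (e + 1)) / (e + 1)) {a..}"
    by (rule has_integral_powr_to_inf) (use assms in auto)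
  hence "(\<lambda>y. y powr e) absolutely_integrable_on {a..}"
    by (intro nonnegative_absolutely_integrable_1) (auto simp: integrable_on_def)
  thus integrable: "set_integrable lborel {a..} (\<lambda>y. y powr e)"
    by (subst set_integrable_lborel_iff) auto
  show "(LINT y:{a..}|lborel. y powr e) = - (a powr (e + 1)) / (e + 1)"
    using set_borel_integral_eq_integral(2)[OF integrable] integral by (simp add: integral_unique)
qed

lemma set_integrable_powr_0_1:
  fixes e :: real
  assumes "e > -1"
  shows "set_integrable lborel {0<..<1} (\<lambda>y. y powr e)"
proof -
  have "(\<lambda>y. y powr e) integrable_on {0<..1}"
    by (rule integrable_on_powr_from_0') (use assms in auto)
  hence "(\<lambda>y. y powr e) absolutely_integrable_on {0<..1}"
    by (intro nonnegative_absolutely_integrable_1) auto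
  hence "set_integrable lborel {0<..1} (\<lambda>y. y powr e)"
    by (subst set_integrable_lborel_iff) auto
  thus ?thesis
    by (rule set_integrable_subset) auto
qed

lemma mellin_tail_integrable:
  assumes "continuous_on {1..} g" "\<And>y. y \<ge> 1 \<Longrightarrow> norm (g y) \<le> C * y powr (- c)" "Re s < c"
  shows "set_integrable lborel {1..} (mellin_integrand g s)"
  by (rule mellin_integrand_integrable[where C = C and c = c])
    (use assms set_integrable_powr_atLeast[of 1 "Re s - c - 1"] in auto)

lemma mellin_head_integrable:
  assumes "continuous_on {0<..<1} g" "\<And>y. 0 < y \<Longrightarrow> y < 1 \<Longrightarrow> norm (g y) \<le> C" "Re s > 0"
  shows "set_integrable lborel {0<..<1} (mellin_integrand g s)"
  by (rule mellin_integrand_integrable[where C = C and c = 0])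
    (use assms set_integrable_powr_0_1[of "Re s - 1"] in auto)

lemma mellin_tail_truncated_holomorphic:
  assumes g: "continuous_on {1..} g"
  shows "(\<lambda>s. integral (cbox 1 b) (mellin_integrand g s)) holomorphic_on {s. Re s < c}"
proof (rule leibniz_rule_holomorphic)
  fix s :: complex and y :: real
  assume "y \<in> cbox 1 b"
  hence y: "y \<ge> 1" "complex_of_real y \<noteq> 0"
    by auto
  hence "((\<lambda>s. complex_of_real y powr s) has_field_derivative Ln (of_real y) * of_real y powr s)
      (at s within {s. Re s < c})"
    by (intro has_field_derivative_at_within[OF has_field_derivative_powr_right])
  thus "((\<lambda>s. mellin_integrand g s y) has_field_derivative
      g y * (of_real y powr s * Ln (of_real y)) / of_real y) (at s within {s. Re s < c})"
    unfolding mellin_integrand_def using y by (auto intro!: derivative_eq_intros)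
next
  fix s :: complex
  have "continuous_on (cbox 1 b) (mellin_integrand g s)"
    by (intro continuous_on_mellin_integrand continuous_on_subset[OF g]) auto
  thus "mellin_integrand g s integrable_on cbox 1 b"
    by (rule integrable_continuous)
next
  have "continuous_on ({s. Re s < c} \<times> cbox 1 b)
     (\<lambda>x. g (snd x) * (of_real (snd x) powr fst x * Ln (of_real (snd x))) / of_real (snd x))"
    by (intro continuous_intros continuous_on_compose2[OF g]) (auto simp: complex_nonpos_Reals_iff)
  thus "continuous_on ({s. Re s < c} \<times> cbox 1 b)
     (\<lambda>(s, y). g y * (of_real y powr s * Ln (of_real y)) / of_real y)"
    by (simp add: case_prod_unfold)
qed (rule convex_halfspace_Re_lt)

lemma norm_set_integral_mellin_integrand_le:
  assumes integrable: "set_integrable lborel {B..} (mellin_integrand g s)"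
    and bound: "\<And>y. y \<ge> B \<Longrightarrow> norm (g y) \<le> C * y powr (- c)"
    and s: "Re s \<le> c - \<delta>" "\<delta> > 0" and B: "B \<ge> 1"
  shows "norm (LINT y:{B..}|lborel. mellin_integrand g s y) \<le> C * B powr (- \<delta>) / \<delta>"
proof -
  have "norm (LINT y:{B..}|lborel. mellin_integrand g s y) \<le>
      (LINT y:{B..}|lborel. norm (mellin_integrand g s y))"
    by (rule set_integral_norm_bound[OF integrable])
  also have "\<dots> \<le> (LINT y:{B..}|lborel. C * y powr (- \<delta> - 1))"
  proof (rule set_integral_mono)
    show "set_integrable lborel {B..} (\<lambda>y. norm (mellin_integrand g s y))"
      by (rule set_integrable_norm[OF integrable])
    show "set_integrable lborel {B..} (\<lambda>y. C * y powr (- \<delta> - 1))"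
      using set_integrable_powr_atLeast[of B "- \<delta> - 1"] s B by auto
    have "0 \<le> C * B powr (- c)"
      using order_trans[OF norm_ge_zero bound[of B]] by simp
    hence C: "C \<ge> 0"
      using B by (simp add: zero_le_mult_iff)
    fix y assume "y \<in> {B..}"
    hence y: "y \<ge> B"
      by simp
    have "norm (mellin_integrand g s y) = norm (g y) * y powr (Re s - 1)"
      using y B by (intro norm_mellin_integrand) simp
    also have "\<dots> \<le> (C * y powr (- c)) * y powr (c - \<delta> - 1)"
      using bound[OF y] y B s C by (intro mult_mono powr_mono) auto
    also have "\<dots> = C * y powr (- \<delta> - 1)"
      unfolding mult.assoc powr_add[symmetric] by simp
    finally show "norm (mellin_integrand g s y) \<le> C * y powr (- \<delta> - 1)" .
  qed
  also have "\<dots> = C * B powr (- \<delta>) / \<delta>"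
    using set_integral_powr_atLeast[of B "- \<delta> - 1"] s B by simp
  finally show ?thesis .
qed

lemma mellin_tail_truncation_error:
  assumes g: "continuous_on {1..} g" and bound: "\<And>y. y \<ge> 1 \<Longrightarrow> norm (g y) \<le> C * y powr (- c)"
    and s: "Re s \<le> c - \<delta>" "\<delta> > 0" and B: "B \<ge> 1"
  shows "dist (integral (cbox 1 B) (mellin_integrand g s)) (mellin_tail g s) \<le>
    C * B powr (- \<delta>) / \<delta>"
proof -
  let ?u = "mellin_integrand g s"
  have integrable: "set_integrable lborel {1..} ?u"
    by (rule mellin_tail_integrable[OF g bound]) (use s in auto)
  have parts: "set_integrable lborel {1..B} ?u" "set_integrable lborel {B..} ?u"
    by (rule set_integrable_subset[OF integrable]; use B in force)+
  have "AE y in lborel. \<not> (y \<in> {1..B} \<and> y \<in> {B..})"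
    using AE_lborel_singleton[of B] by eventually_elim auto
  moreover have "{1..} = {1..B} \<union> {B..}"
    using B by auto
  ultimately have "mellin_tail g s = (LINT y:{1..B}|lborel. ?u y) + (LINT y:{B..}|lborel. ?u y)"
    unfolding mellin_tail_def using parts by (simp add: set_integral_Un_AE)
  also have "(LINT y:{1..B}|lborel. ?u y) = integral (cbox 1 B) ?u"
    using set_borel_integral_eq_integral(2)[OF parts(1)] by simp
  finally have "dist (integral (cbox 1 B) ?u) (mellin_tail g s) = norm (LINT y:{B..}|lborel. ?u y)"
    by (simp add: dist_norm)
  also have "\<dots> \<le> C * B powr (- \<delta>) / \<delta>"
    using B by (intro norm_set_integral_mellin_integrand_le[OF parts(2) bound s]) auto
  finally show ?thesis .
qed

lemma mellin_tail_uniform_limit: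
  assumes g: "continuous_on {1..} g" and bound: "\<And>y. y \<ge> 1 \<Longrightarrow> norm (g y) \<le> C * y powr (- c)"
    and \<delta>: "\<delta> > 0"
  shows "uniform_limit {s. Re s \<le> c - \<delta>}
    (\<lambda>n s. integral (cbox 1 (real (Suc n))) (mellin_integrand g s)) (mellin_tail g) sequentially"
proof (rule uniform_limitI)
  fix e :: real
  assume "e > 0"
  have "filterlim (\<lambda>n. real (Suc n)) at_top sequentially"
    by (rule filterlim_compose[OF filterlim_real_sequentially filterlim_Suc])
  hence "(\<lambda>n. real (Suc n) powr (- \<delta>)) \<longlonglongrightarrow> 0"
    using \<delta> by (intro tendsto_neg_powr) auto
  hence "(\<lambda>n. C * real (Suc n) powr (- \<delta>) / \<delta>) \<longlonglongrightarrow> C * 0 / \<delta>"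
    by (intro tendsto_intros) (use \<delta> in auto)
  hence "\<forall>\<^sub>F n in sequentially. C * real (Suc n) powr (- \<delta>) / \<delta> < e"
    using \<open>e > 0\<close> by (intro order_tendstoD(2)[where a = e and y = "C * 0 / \<delta>"]) auto
  thus "\<forall>\<^sub>F n in sequentially. \<forall>s\<in>{s. Re s \<le> c - \<delta>}.
      dist (integral (cbox 1 (real (Suc n))) (mellin_integrand g s)) (mellin_tail g s) < e"
  proof eventually_elim
    case (elim n)
    thus ?case
      using mellin_tail_truncation_error[OF g bound _ \<delta>, of _ "real (Suc n)"] by fastforce
  qed
qed

lemma mellin_tail_holomorphic:
  assumes g: "continuous_on {1..} g" and bound: "\<And>y. y \<ge> 1 \<Longrightarrow> norm (g y) \<le> C * y powr (- c)"
  shows "mellin_tail g holomorphic_on {s. Re s < c}"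
proof (rule holomorphic_uniform_sequence)
  let ?I = "\<lambda>n s. integral (cbox 1 (real (Suc n))) (mellin_integrand g s)"
  show "open {s. Re s < c}"
    by (rule open_halfspace_Re_lt)
  show "?I n holomorphic_on {s. Re s < c}" for n
    by (rule mellin_tail_truncated_holomorphic[OF g])
  fix s0 :: complex
  assume "s0 \<in> {s. Re s < c}"
  define \<delta> where "\<delta> = (c - Re s0) / 2"
  have \<delta>: "\<delta> > 0"
    using \<open>s0 \<in> {s. Re s < c}\<close> by (simp add: \<delta>_def)
  have cball: "cball s0 \<delta> \<subseteq> {s. Re s \<le> c - \<delta>}"
  proof
    fix s assume "s \<in> cball s0 \<delta>"
    hence "\<bar>Re s - Re s0\<bar> \<le> \<delta>"
      using abs_Re_le_cmod[of "s - s0"] by (simp add: dist_norm norm_minus_commute)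
    hence "Re s \<le> Re s0 + \<delta>"
      by linarith
    thus "s \<in> {s. Re s \<le> c - \<delta>}"
      by (simp add: \<delta>_def field_simps)
  qed
  hence "uniform_limit (cball s0 \<delta>) ?I (mellin_tail g) sequentially"
    using mellin_tail_uniform_limit[OF g bound \<delta>] uniform_limit_on_subset by blast
  moreover have "cball s0 \<delta> \<subseteq> {s. Re s < c}"
    using cball \<delta> by force
  ultimately show "\<exists>d>0. cball s0 d \<subseteq> {s. Re s < c} \<and>
      uniform_limit (cball s0 d) ?I (mellin_tail g) sequentially"
    using \<delta> by blast
qed

lemma mellin_integrand_inversion:
  assumes "y > 0"
  shows "mellin_integrand g (- s) (1 / y) /\<^sub>R y\<^sup>2 = mellin_integrand (\<lambda>y. g (1 / y)) s y"
proof -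
  have "Ln (complex_of_real (1 / y)) = - Ln (of_real y)"
    using assms by (subst (1 2) Ln_of_real) (auto simp: ln_div)
  hence "complex_of_real (1 / y) powr (- s) = of_real y powr s"
    using assms by (simp add: powr_def)
  thus ?thesis
    using assms
    by (simp add: mellin_integrand_def scaleR_conv_of_real power2_eq_square field_simps)
qed

lemma mellin_head_inversion:
  assumes g: "continuous_on {1..} g"
  shows "mellin_head (\<lambda>y. g (1 / y)) s = mellin_tail g (- s)"
proof -
  define f where "f y = indicator {1<..} y *\<^sub>R mellin_integrand g (- s) y" for y
  have "continuous_on {1<..} g"
    by (rule continuous_on_subset[OF g]) auto
  hence f: "f \<in> borel_measurable borel"
    using set_borel_measurable_mellin_integrand[of "{1<..}" g "- s"]
    by (auto simp: f_def[abs_def] set_borel_measurable_def)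
  have "mellin_tail g (- s) = set_lebesgue_integral lborel {1<..} (mellin_integrand g (- s))"
    unfolding mellin_tail_def
  proof (rule set_integral_cong_set)
    have "set_borel_measurable borel {1..} (mellin_integrand g (- s))"
      by (rule set_borel_measurable_mellin_integrand[OF g]) auto
    thus "set_borel_measurable lborel {1..} (mellin_integrand g (- s))"
      by (simp add: set_borel_measurable_def)
    show "set_borel_measurable lborel {1<..} (mellin_integrand g (- s))"
      using f by (simp add: set_borel_measurable_def f_def[abs_def])
    show "AE y in lborel. y \<in> {1<..} \<longleftrightarrow> y \<in> {1::real..}"
      using AE_lborel_singleton[of "1::real"] by eventually_elim auto
  qed
  also have "\<dots> = set_lebesgue_integral lborel {0<..} f"
    unfolding set_lebesgue_integral_def f_def
    by (intro Bochner_Integration.integral_cong refl) (auto simp: indicator_def)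
  also have "\<dots> = set_lebesgue_integral lborel {0<..} (\<lambda>y. f (1 / y) /\<^sub>R y\<^sup>2)"
    by (rule integral_inversion[OF f])
  also have "\<dots> = mellin_head (\<lambda>y. g (1 / y)) s"
    unfolding mellin_head_def set_lebesgue_integral_def
  proof (rule Bochner_Integration.integral_cong[OF refl])
    fix y :: real
    show "indicator {0<..} y *\<^sub>R (f (1 / y) /\<^sub>R y\<^sup>2) =
        indicator {0<..<1} y *\<^sub>R mellin_integrand (\<lambda>y. g (1 / y)) s y"
      using mellin_integrand_inversion[of y g s] by (auto simp: f_def indicator_def field_simps)
  qed
  finally show ?thesis ..
qed

lemma mellin_head_powi_mult:
  "mellin_head (\<lambda>y. of_real y powi n * g y) s = mellin_head g (s + of_int n)"
  unfolding mellin_head_def by (rule set_lebesgue_integral_cong) (auto simp: mellin_integrand_powi)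

lemma
  assumes w: "Re w > 0"
  shows mellin_head_1_integrable: "set_integrable lborel {0<..<1} (mellin_integrand (\<lambda>_. 1) w)"
    and mellin_head_1: "mellin_head (\<lambda>_. 1) w = 1 / w"
proof -
  have w0: "w \<noteq> 0"
    using w by auto
  show integrable: "set_integrable lborel {0<..<1} (mellin_integrand (\<lambda>_. 1) w)"
    by (rule mellin_head_integrable[of _ 1]) (use w in auto)
  have "(mellin_integrand (\<lambda>_. 1) w has_integral
      complex_of_real 1 powr w / w - complex_of_real 0 powr w / w) {0..1}"
  proof (rule fundamental_theorem_of_calculus_interior)
    show "continuous_on {0..1} (\<lambda>y. complex_of_real y powr w / w)"
      using w w0 by (intro continuous_intros) auto
    fix y :: real
    assume y: "y \<in> {0<..<1}"
    hence "complex_of_real y \<notin> \<real>\<^sub>\<le>\<^sub>0"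
      by (simp add: complex_nonpos_Reals_iff)
    hence "((\<lambda>z. z powr w / w) has_field_derivative (w * of_real y powr (w - 1)) / w)
        (at (of_real y))"
      by (intro derivative_eq_intros refl has_field_derivative_powr DERIV_cdivide)
    moreover have "(w * of_real y powr (w - 1)) / w = mellin_integrand (\<lambda>_. 1) w y"
      using w0 y by (simp add: mellin_integrand_def powr_diff)
    ultimately have "((\<lambda>z. z powr w / w) has_field_derivative mellin_integrand (\<lambda>_. 1) w y)
        (at (of_real y))"
      by simp
    thus "((\<lambda>y. complex_of_real y powr w / w) has_vector_derivative
        mellin_integrand (\<lambda>_. 1) w y) (at y)"
      by (rule has_vector_derivative_real_field)
  qed simp
  hence "(mellin_integrand (\<lambda>_. 1) w has_integral 1 / w) {0..1}"
    by simp
  hence "(mellin_integrand (\<lambda>_. 1) w has_integral 1 / w) {0<..<1}"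
    by (rule has_integral_spike_set_eq[THEN iffD1, rotated 2])
      (auto intro: negligible_subset[of "{0, 1}"])
  thus "mellin_head (\<lambda>_. 1) w = 1 / w"
    using set_borel_integral_eq_integral(2)[OF integrable]
    by (simp add: mellin_head_def integral_unique)
qed

lemma
  assumes "Re s + real_of_int n > 0"
  shows mellin_head_powi_integrable:
      "set_integrable lborel {0<..<1} (mellin_integrand (\<lambda>y. of_real y powi n) s)"
    and mellin_head_powi: "mellin_head (\<lambda>y. of_real y powi n) s = 1 / (s + of_int n)"
proof -
  have "mellin_integrand (\<lambda>y. of_real y powi n) s y = mellin_integrand (\<lambda>_. 1) (s + of_int n) y"
    if "y > 0" for y
    using mellin_integrand_powi[OF that, of n "\<lambda>_. 1"] by simp
  thus "set_integrable lborel {0<..<1} (mellin_integrand (\<lambda>y. of_real y powi n) s)"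
    using mellin_head_1_integrable[of "s + of_int n"] assms
    by (subst set_integrable_cong[OF refl refl]) auto
  show "mellin_head (\<lambda>y. of_real y powi n) s = 1 / (s + of_int n)"
    using mellin_head_powi_mult[of n "\<lambda>_. 1" s] mellin_head_1[of "s + of_int n"] assms by simp
qed

text \<open>These bounds make the Mellin integral converge for \<open>0 < Re s < c\<close>.\<close>

definition decays :: "real \<Rightarrow> (real \<Rightarrow> complex) \<Rightarrow> bool" where
  "decays c t \<longleftrightarrow> continuous_on {0<..} t \<and>
     (\<exists>C. \<forall>y>0. norm (t y) \<le> C \<and> norm (t y) \<le> C * y powr (- c))"

lemma decaysE:
  assumes "decays c t"
  obtains C where "continuous_on {0<..} t" "C \<ge> 0" "\<forall>y>0. norm (t y) \<le> C"
    "\<forall>y>0. norm (t y) \<le> C * y powr (- c)"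
proof -
  obtain C where "continuous_on {0<..} t"
    and C: "\<forall>y>0. norm (t y) \<le> C \<and> norm (t y) \<le> C * y powr (- c)"
    using assms unfolding decays_def by blast
  moreover have "C \<ge> 0"
    using C order_trans[OF norm_ge_zero] zero_less_one by blast
  ultimately show ?thesis
    using that by blast
qed

lemma decaysI:
  assumes "continuous_on {0<..} t" "\<And>y. y > 0 \<Longrightarrow> norm (t y) \<le> C"
    "\<And>y. y > 0 \<Longrightarrow> norm (t y) \<le> C * y powr (- c)"
  shows "decays c t"
  using assms unfolding decays_def by blast

lemma decays_zero: "decays c (\<lambda>_. 0)"
  by (rule decaysI[of _ 0]) auto

lemma decays_add:
  assumes "decays c t" "decays c u"
  shows "decays c (\<lambda>y. t y + u y)"
proof -
  obtain C where t: "continuous_on {0<..} t" "C \<ge> 0" "\<forall>y>0. norm (t y) \<le> C"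
    "\<forall>y>0. norm (t y) \<le> C * y powr (- c)"
    using assms(1) by (rule decaysE)
  obtain E where u: "continuous_on {0<..} u" "E \<ge> 0" "\<forall>y>0. norm (u y) \<le> E"
    "\<forall>y>0. norm (u y) \<le> E * y powr (- c)"
    using assms(2) by (rule decaysE)
  show ?thesis
    using t u norm_triangle_mono[of "t _" _ "u _"]
    by (intro decaysI[of _ "C + E"] continuous_intros) (simp_all add: distrib_right)
qed

lemma decays_sum: "(\<And>i. i \<in> I \<Longrightarrow> decays c (t i)) \<Longrightarrow> decays c (\<lambda>y. \<Sum>i\<in>I. t i y)"
  by (induction I rule: infinite_finite_induct) (auto simp: decays_zero intro: decays_add)

lemma decays_mult:
  assumes "decays c t" "decays e u"
  shows "decays (c + e) (\<lambda>y. t y * u y)"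
proof -
  obtain C where t: "continuous_on {0<..} t" "C \<ge> 0" "\<forall>y>0. norm (t y) \<le> C"
    "\<forall>y>0. norm (t y) \<le> C * y powr (- c)"
    using assms(1) by (rule decaysE)
  obtain E where u: "continuous_on {0<..} u" "E \<ge> 0" "\<forall>y>0. norm (u y) \<le> E"
    "\<forall>y>0. norm (u y) \<le> E * y powr (- e)"
    using assms(2) by (rule decaysE)
  show ?thesis
  proof (rule decaysI)
    show "continuous_on {0<..} (\<lambda>y. t y * u y)"
      by (intro continuous_intros t u)
    fix y :: real
    assume y: "y > 0"
    show "norm (t y * u y) \<le> C * E"
      using t u y by (simp add: norm_mult mult_mono)
    have "norm (t y * u y) \<le> (C * y powr (- c)) * (E * y powr (- e))"
      using t u y by (simp add: norm_mult mult_mono)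
    also have "\<dots> = C * E * y powr (- (c + e))"
      by (simp add: powr_add[symmetric])
    finally show "norm (t y * u y) \<le> C * E * y powr (- (c + e))" .
  qed
qed

lemma decays_const: "decays 0 (\<lambda>_. a)"
  by (rule decaysI[of _ "norm a"]) auto

lemma decays_cmult: "decays c t \<Longrightarrow> decays c (\<lambda>y. a * t y)"
  using decays_mult[OF decays_const] by simp

lemma decays_power: "decays c t \<Longrightarrow> decays (real n * c) (\<lambda>y. t y ^ n)"
proof (induction n)
  case 0
  thus ?case
    by (simp add: decays_const)
next
  case (Suc n)
  thus ?case
    using decays_mult[of c t "real n * c" "\<lambda>y. t y ^ n"] by (simp add: distrib_right)
qed

lemma decays_inverse_linear:
  assumes "a \<noteq> 0"
  shows "decays 1 (\<lambda>y. 1 / (\<i> * of_real y - of_real a))"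
proof (rule decaysI)
  have lower: "norm (\<i> * of_real y - of_real a) \<ge> \<bar>a\<bar>"
    "norm (\<i> * of_real y - of_real a) \<ge> y" for y
    using abs_Re_le_cmod[of "\<i> * of_real y - of_real a"]
      abs_Im_le_cmod[of "\<i> * of_real y - of_real a"]
    by simp_all
  hence "\<i> * of_real y - of_real a \<noteq> 0" for y
    using assms by (metis norm_zero abs_le_zero_iff)
  thus "continuous_on {0<..} (\<lambda>y. 1 / (\<i> * of_real y - of_real a))"
    by (intro continuous_intros) auto
  fix y :: real
  assume y: "y > 0"
  have "norm (1 / (\<i> * of_real y - of_real a)) \<le> 1 / \<bar>a\<bar>"
    using lower(1)[of y] assms by (simp add: norm_divide frac_le)
  thus "norm (1 / (\<i> * of_real y - of_real a)) \<le> max 1 (1 / \<bar>a\<bar>)"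
    by simp
  have "norm (1 / (\<i> * of_real y - of_real a)) \<le> 1 * y powr (- 1)"
    using lower(2)[of y] y by (simp add: norm_divide frac_le powr_minus inverse_eq_divide)
  also have "\<dots> \<le> max 1 (1 / \<bar>a\<bar>) * y powr (- 1)"
    by (intro mult_right_mono) auto
  finally show "norm (1 / (\<i> * of_real y - of_real a)) \<le> max 1 (1 / \<bar>a\<bar>) * y powr (- 1)" .
qed

lemma decays_tail:
  assumes "decays c t"
  obtains C where "continuous_on {1..} t" "\<forall>y\<ge>1. norm (t y) \<le> C * y powr (- c)"
proof -
  obtain C where t: "continuous_on {0<..} t" "C \<ge> 0" "\<forall>y>0. norm (t y) \<le> C"
    "\<forall>y>0. norm (t y) \<le> C * y powr (- c)"
    using assms by (rule decaysE)
  moreover have "continuous_on {1..} t"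
    by (rule continuous_on_subset[OF t(1)]) auto
  ultimately show ?thesis
    using that[of C] by auto
qed

lemma mellin_tail_integrable_decays:
  assumes "decays c t" "Re s < c"
  shows "set_integrable lborel {1..} (mellin_integrand t s)"
proof -
  obtain C where "continuous_on {1..} t" "\<forall>y\<ge>1. norm (t y) \<le> C * y powr (- c)"
    using assms(1) by (rule decays_tail)
  thus ?thesis
    using assms(2) by (intro mellin_tail_integrable) auto
qed

lemma mellin_tail_holomorphic_decays:
  assumes "decays c t"
  shows "mellin_tail t holomorphic_on {s. Re s < c}"
proof -
  obtain C where "continuous_on {1..} t" "\<forall>y\<ge>1. norm (t y) \<le> C * y powr (- c)"
    using assms by (rule decays_tail)
  thus ?thesis
    by (intro mellin_tail_holomorphic) auto
qed

lemma mellin_integrable_decays: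
  assumes t: "decays c t" and s: "0 < Re s" "Re s < c"
  shows "set_integrable lborel {0<..} (mellin_integrand t s)"
proof -
  obtain C where C: "continuous_on {0<..} t" "C \<ge> 0" "\<forall>y>0. norm (t y) \<le> C"
    "\<forall>y>0. norm (t y) \<le> C * y powr (- c)"
    using t by (rule decaysE)
  have "continuous_on {0<..<1} t"
    by (rule continuous_on_subset[OF C(1)]) auto
  hence "set_integrable lborel {0<..<1} (mellin_integrand t s)"
    using C(3) s(1) by (intro mellin_head_integrable) auto
  moreover have "{0::real<..} = {0<..<1} \<union> {1..}"
    by auto
  ultimately show ?thesis
    using set_integrable_Un[OF _ mellin_tail_integrable_decays[OF t s(2)]] by simp
qed

lemma mellin_reflect:
  assumes t: "decays (2 * real k) t" and s: "0 < Re s" "Re s < 2 * real k"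
    and reflect: "\<And>y. y > 0 \<Longrightarrow> t (1 / y) = of_real y ^ (2 * k) * t y"
  shows "mellin t s = mellin_tail t s + mellin_tail t (of_nat (2 * k) - s)"
proof -
  have "mellin_integrand t s y =
      mellin_integrand (\<lambda>y. of_real y powi (- int (2 * k)) * t (1 / y)) s y" if "y > 0" for y
    using that by (simp add: mellin_integrand_def reflect power_int_minus power_int_of_nat
        del: of_nat_mult)
  hence "mellin_head t s = mellin_head (\<lambda>y. of_real y powi (- int (2 * k)) * t (1 / y)) s"
    unfolding mellin_head_def by (intro set_lebesgue_integral_cong) auto
  also have "\<dots> = mellin_head (\<lambda>y. t (1 / y)) (s - of_nat (2 * k))"
    by (simp add: mellin_head_powi_mult)
  also have "\<dots> = mellin_tail t (of_nat (2 * k) - s)"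
    using decays_tail[OF t] by (subst mellin_head_inversion) auto
  finally show ?thesis
    by (simp add: mellin_split[OF mellin_integrable_decays[OF t s]])
qed


subsection \<open>Exponential decay of Fourier series\<close>

lemma power_series_norm_le:
  fixes a :: "nat \<Rightarrow> 'a::{real_normed_field, banach}"
  assumes summable: "summable (\<lambda>n. a n * x ^ n)" and a0: "a 0 = 0" and r: "0 < r" "r < norm x"
  shows "\<exists>C. \<forall>z. norm z \<le> r \<longrightarrow> norm (suminf (\<lambda>n. a n * z ^ n)) \<le> C * norm z"
proof -
  define b where "b n = norm (a (Suc n)) * r ^ n" for n
  have "summable (\<lambda>n. norm (a n * of_real r ^ n))"
    by (rule powser_insidea[OF summable]) (use r in simp)
  hence "summable (\<lambda>n. r * b n)"
    using r(1) by (subst (asm) summable_Suc_iff[symmetric])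
      (simp add: b_def norm_mult norm_power mult_ac)
  hence b: "summable b"
    using r(1) summable_mult_D by fastforce
  have "norm (suminf (\<lambda>n. a n * z ^ n)) \<le> suminf b * norm z" if z: "norm z \<le> r" for z
  proof -
    have "summable (\<lambda>n. norm (a n * z ^ n))"
      by (rule powser_insidea[OF summable]) (use r z in simp)
    hence "suminf (\<lambda>n. a n * z ^ n) = suminf (\<lambda>n. a (Suc n) * z ^ Suc n)"
      by (subst suminf_split_head) (simp_all add: a0 summable_norm_cancel)
    also have "norm \<dots> \<le> suminf (\<lambda>n. b n * norm z)"
    proof (rule norm_suminf_le)
      fix n
      have "norm z ^ n \<le> r ^ n"
        using z by (intro power_mono) auto
      thus "norm (a (Suc n) * z ^ Suc n) \<le> b n * norm z"
        by (auto simp: b_def norm_mult norm_power mult_ac intro!: mult_left_mono mult_right_mono)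
    qed (use b in \<open>intro summable_mult2\<close>)
    also have "\<dots> = suminf b * norm z"
      by (rule suminf_mult2[OF b, symmetric])
    finally show ?thesis .
  qed
  thus ?thesis
    by blast
qed

lemma fourier_series_decay:
  fixes a :: "nat \<Rightarrow> complex"
  assumes l: "l > 0" and a0: "a 0 = 0"
    and F: "\<And>z. Im z > 0 \<Longrightarrow> (\<lambda>n. a n * exp (2 * of_real pi * \<i> * of_nat n * z / of_real l)) sums F z"
  shows "\<exists>C. \<forall>y\<ge>1. norm (F (\<i> * of_real y)) \<le> C * exp (- (2 * pi / l) * y)"
proof -
  define \<kappa> where "\<kappa> = 2 * pi / l"
  have \<kappa>: "\<kappa> > 0"
    using l by (simp add: \<kappa>_def)
  have sums: "(\<lambda>n. a n * of_real (exp (- \<kappa> * y)) ^ n) sums F (\<i> * of_real y)" if "y > 0" for y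
  proof -
    have "2 * of_real pi * \<i> * of_nat n * (\<i> * of_real y) / of_real l =
        of_nat n * complex_of_real (- \<kappa> * y)" for n
      by (simp add: \<kappa>_def field_simps)
    thus ?thesis
      using F[of "\<i> * of_real y"] that by (simp only: exp_of_nat_mult exp_of_real) simp
  qed
  have "summable (\<lambda>n. a n * of_real (exp (- \<kappa> * (1 / 2))) ^ n)"
    using sums[of "1 / 2"] by (simp add: sums_iff)
  moreover have "exp (- \<kappa>) < norm (of_real (exp (- \<kappa> * (1 / 2))) :: complex)"
    using \<kappa> by simp
  ultimately obtain C where
    C: "\<And>z. norm z \<le> exp (- \<kappa>) \<Longrightarrow> norm (suminf (\<lambda>n. a n * z ^ n)) \<le> C * norm z"
    using power_series_norm_le[of a _ "exp (- \<kappa>)", OF _ a0] by (metis exp_gt_zero)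
  have "norm (F (\<i> * of_real y)) \<le> C * exp (- \<kappa> * y)" if "y \<ge> 1" for y
    using C[of "of_real (exp (- \<kappa> * y))"] sums[of y] that \<kappa> by (simp add: sums_iff)
  thus ?thesis
    unfolding \<kappa>_def by blast
qed

lemma exp_le_powr:
  fixes y :: real
  assumes "c > 0" "\<kappa> > 0" "y > 0"
  shows "exp (- \<kappa> * y) \<le> (c / \<kappa>) powr c * exp (- c) * y powr (- c)"
proof -
  have "ln (\<kappa> * y / c) \<le> \<kappa> * y / c - 1"
    using assms by (intro ln_le_minus_one) simp
  hence "c * ln (\<kappa> * y / c) \<le> \<kappa> * y - c"
    using assms(1) by (simp add: field_simps)
  hence "- \<kappa> * y \<le> c * ln (c / \<kappa>) - c - c * ln y"
    using assms by (simp add: ln_div ln_mult algebra_simps)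
  hence "exp (- \<kappa> * y) \<le> exp (c * ln (c / \<kappa>) + - c + - c * ln y)"
    by simp
  also have "\<dots> = (c / \<kappa>) powr c * exp (- c) * y powr (- c)"
    unfolding exp_add using assms by (simp add: powr_def)
  finally show ?thesis .
qed

lemma exp_decay_imp_powr_decay:
  assumes \<kappa>: "\<kappa> > 0" and f: "\<And>y. y \<ge> 1 \<Longrightarrow> norm (f y :: complex) \<le> C * exp (- \<kappa> * y)"
  shows "\<exists>C. \<forall>y\<ge>1. norm (f y) \<le> C * y powr (- c)"
proof -
  define e where "e = max 1 c"
  define E where "E = C * ((e / \<kappa>) powr e * exp (- e))"
  have "0 \<le> C * exp (- \<kappa> * 1)"
    using f[of 1] norm_ge_zero order_trans by blast
  hence C: "C \<ge> 0"
    by (simp add: zero_le_mult_iff)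
  have "norm (f y) \<le> E * y powr (- c)" if y: "y \<ge> 1" for y
  proof -
    have "norm (f y) \<le> C * ((e / \<kappa>) powr e * exp (- e) * y powr (- e))"
      using f[OF y] exp_le_powr[of e \<kappa> y] \<kappa> y C
      by (smt (verit, best) e_def mult_left_mono)
    also have "\<dots> = E * y powr (- e)"
      by (simp add: E_def)
    also have "\<dots> \<le> E * y powr (- c)"
      using C y by (intro mult_left_mono powr_mono) (auto simp: E_def e_def)
    finally show ?thesis .
  qed
  thus ?thesis
    by blast
qed


subsection \<open>Laurent polynomials\<close>

definition laurent_sum :: "(int \<Rightarrow> complex) \<Rightarrow> complex \<Rightarrow> complex" where
  "laurent_sum c z = (\<Sum>e | c e \<noteq> 0. c e * z powi e)"

lemma laurent_sum_superset:
  assumes "finite E" "\<And>e. c e \<noteq> 0 \<Longrightarrow> e \<in> E"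
  shows "laurent_sum c z = (\<Sum>e\<in>E. c e * z powi e)"
  unfolding laurent_sum_def by (rule sum.mono_neutral_left) (use assms in auto)

lemma poly_eq_0_if_pos_real_roots:
  fixes P :: "complex poly"
  assumes "\<And>y::real. y > 0 \<Longrightarrow> poly P (of_real y) = 0"
  shows "P = 0"
proof -
  have "of_real ` {0::real<..} \<subseteq> {z. poly P z = 0}"
    using assms by auto
  moreover have "infinite (complex_of_real ` {0<..})"
    by (subst finite_image_iff) (auto simp: inj_on_def infinite_Ioi)
  ultimately show ?thesis
    using poly_roots_finite finite_subset by blast
qed

lemma laurent_coeffs_eq_0:
  assumes E: "finite E" and zero: "\<And>y::real. y > 0 \<Longrightarrow> (\<Sum>e\<in>E. c e * of_real y powi e) = 0"
    and e: "e \<in> E"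
  shows "c e = (0 :: complex)"
proof -
  define N where "N = Max ((\<lambda>e. nat (- e)) ` E)"
  have N: "- int N \<le> e" if "e \<in> E" for e
  proof -
    have "nat (- e) \<le> N"
      unfolding N_def using E that by (intro Max_ge) auto
    thus ?thesis
      by linarith
  qed
  define P where "P = (\<Sum>e\<in>E. monom (c e) (nat (e + int N)))"
  have "poly P (of_real y) = 0" if y: "y > 0" for y :: real
  proof -
    have "poly P (of_real y) = (\<Sum>e\<in>E. of_real y ^ N * (c e * of_real y powi e))"
      unfolding P_def poly_sum
    proof (rule sum.cong[OF refl])
      fix e assume "e \<in> E"
      hence "0 \<le> e + int N"
        using N by force
      hence "complex_of_real y ^ nat (e + int N) = of_real y powi (e + int N)"
        by (simp add: power_int_def)
      thus "poly (monom (c e) (nat (e + int N))) (of_real y) =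
          of_real y ^ N * (c e * of_real y powi e)"
        using y by (simp add: poly_monom power_int_add)
    qed
    thus ?thesis
      using zero[OF y] by (simp flip: sum_distrib_left)
  qed
  hence "P = 0"
    by (rule poly_eq_0_if_pos_real_roots)
  moreover have "coeff P (nat (e + int N)) = (\<Sum>e'\<in>E. if e' = e then c e' else 0)"
    unfolding P_def coeff_sum
  proof (rule sum.cong[OF refl])
    fix e' assume "e' \<in> E"
    thus "coeff (monom (c e') (nat (e' + int N))) (nat (e + int N)) = (if e' = e then c e' else 0)"
      using N[OF e] N[of e'] by auto
  qed
  ultimately show ?thesis
    using E e by simp
qed

lemma laurent_sum_inj:
  assumes finite: "finite {e. c e \<noteq> 0}" "finite {e. c' e \<noteq> 0}"
    and eq: "\<And>y::real. y > 0 \<Longrightarrow> laurent_sum c (of_real y) = laurent_sum c' (of_real y)"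
  shows "c = c'"
proof
  fix e
  define E where "E = insert e ({e. c e \<noteq> 0} \<union> {e. c' e \<noteq> 0})"
  have E: "finite E"
    using finite by (simp add: E_def)
  have "(\<Sum>e\<in>E. (c e - c' e) * of_real y powi e) = 0" if "y > 0" for y :: real
    using eq[OF that] laurent_sum_superset[OF E, of c] laurent_sum_superset[OF E, of c']
    by (simp add: E_def left_diff_distrib sum_subtractf)
  thus "c e = c' e"
    using laurent_coeffs_eq_0[OF E, of "\<lambda>e. c e - c' e" e] by (simp add: E_def)
qed

lemma laurent_sum_inverse: "laurent_sum c (1 / z) = laurent_sum (\<lambda>e. c (- e)) z"
  unfolding laurent_sum_def
  by (rule sum.reindex_bij_witness[of _ uminus uminus])
    (simp_all add: power_int_minus inverse_eq_divide power_int_divide_distrib)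

lemma laurent_sum_shift: "z \<noteq> 0 \<Longrightarrow> z powi n * laurent_sum c z = laurent_sum (\<lambda>e. c (e - n)) z"
  unfolding laurent_sum_def sum_distrib_left
  by (rule sum.reindex_bij_witness[of _ "\<lambda>e. e - n" "\<lambda>e. e + n"]) (auto simp: power_int_add)

definition polar_sum :: "(int \<Rightarrow> complex) \<Rightarrow> complex \<Rightarrow> complex" where
  "polar_sum c s = (\<Sum>e | c e \<noteq> 0. c e / (s + of_int e))"

lemma polar_sum_cancel:
  assumes finite: "finite {e. c e \<noteq> 0}"
    and reflect: "\<And>y. y > 0 \<Longrightarrow>
      laurent_sum c (of_real (1 / y)) = of_real y powi n * laurent_sum c (of_real y)"
  shows "polar_sum c s + polar_sum c (of_int n - s) = 0"
proof -
  have "(\<lambda>e. c (- e)) = (\<lambda>e. c (e - n))"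
  proof (rule laurent_sum_inj)
    show "finite {e. c (- e) \<noteq> 0}" "finite {e. c (e - n) \<noteq> 0}"
      using finite_vimageI[OF finite, of uminus] finite_vimageI[OF finite, of "\<lambda>e. e - n"]
      by (simp_all add: vimage_def inj_def)
    fix y :: real
    assume "y > 0"
    thus "laurent_sum (\<lambda>e. c (- e)) (of_real y) = laurent_sum (\<lambda>e. c (e - n)) (of_real y)"
      using reflect[of y] by (simp add: laurent_sum_shift flip: laurent_sum_inverse)
  qed
  hence c: "c (- e - n) = c e" for e
    using fun_cong[of _ _ "- e"] by fastforce
  have "polar_sum c (of_int n - s) = (\<Sum>e | c e \<noteq> 0. - (c e / (s + of_int e)))"
    unfolding polar_sum_def
  proof (rule sum.reindex_bij_witness[of _ "\<lambda>e. - e - n" "\<lambda>e. - e - n"])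
    fix e
    have "s + of_int (- e - n) = - (of_int n - s + of_int e)"
      by simp
    thus "- (c (- e - n) / (s + of_int (- e - n))) = c e / (of_int n - s + of_int e)"
      unfolding c by (metis minus_divide_right minus_minus)
  qed (auto simp: c)
  thus ?thesis
    by (simp add: polar_sum_def sum_negf)
qed

lemma is_pole_poly_divide:
  fixes P N :: "complex poly"
  assumes "coprime P N" "N \<noteq> 0" "poly N z = 0"
  shows "is_pole (\<lambda>z. poly P z / poly N z) z"
proof (rule is_pole_divide)
  show "isCont (poly P) z"
    by simp
  show "poly P z \<noteq> 0"
  proof
    assume "poly P z = 0"
    hence "[:- z, 1:] dvd P" "[:- z, 1:] dvd N"
      using assms(3) by (simp_all add: poly_eq_0_iff_dvd)
    hence "[:- z, 1:] dvd 1"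
      using assms(1) coprime_common_divisor by blast
    thus False
      using poly_eq_0_iff_dvd[of 1 z] by simp
  qed
  have "\<not> z islimpt {w. poly N w = 0}"
    by (intro islimpt_finite poly_roots_finite assms(2))
  hence "eventually (\<lambda>w. poly N w \<noteq> 0) (at z)"
    by (simp add: islimpt_iff_eventually)
  moreover have "(poly N \<longlongrightarrow> 0) (at z)"
    using assms(3) isCont_def poly_isCont[of z N] by metis
  ultimately show "filterlim (poly N) (at 0) (at z)"
    by (simp add: filterlim_at)
qed

lemma complex_poly_only_root_0:
  fixes N :: "complex poly"
  assumes "\<And>z. poly N z = 0 \<Longrightarrow> z = 0"
  shows "N = monom (lead_coeff N) (order 0 N)"
proof -
  have roots: "{z. poly N z = 0} = (if poly N 0 = 0 then {0} else {})"
    using assms by auto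
  have "(\<Prod>z | poly N z = 0. [:- z, 1:] ^ order z N) = [:0, 1:] ^ order 0 N"
    unfolding roots by (simp add: order_0I)
  thus ?thesis
    using complex_poly_decompose[of N] by (simp add: monom_altdef)
qed

lemma rational_function_laurent:
  assumes q: "rational_function q" and pole: "\<And>z. is_pole q z \<Longrightarrow> z = 0"
  obtains c where "finite {e. c e \<noteq> 0}" "\<And>z. z \<noteq> 0 \<Longrightarrow> q z = laurent_sum c z"
proof -
  obtain P N where N: "N \<noteq> 0" "coprime P N" and q_eq: "q = (\<lambda>z. poly P z / poly N z)"
    using q by (auto simp: rational_function_def)
  define b m where "b = lead_coeff N" and "m = order 0 N"
  have N_eq: "N = monom b m"
    using pole is_pole_poly_divide[OF N(2,1)] unfolding b_def m_def q_eq
    by (intro complex_poly_only_root_0) blast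
  define c where "c e = (if e < - int m then 0 else coeff P (nat (e + int m)) / b)" for e
  have support: "e \<in> (\<lambda>i. int i - int m) ` {..degree P}" if "c e \<noteq> 0" for e
    using that by (intro image_eqI[of _ _ "nat (e + int m)"])
      (auto simp: c_def le_degree split: if_splits)
  have "q z = laurent_sum c z" if z: "z \<noteq> 0" for z
  proof -
    have "q z = (\<Sum>i\<le>degree P. coeff P i / b * (z ^ i / z ^ m))"
      by (simp add: q_eq N_eq poly_monom poly_altdef[of P] sum_divide_distrib mult_ac)
    also have "\<dots> = (\<Sum>i\<le>degree P. c (int i - int m) * z powi (int i - int m))"
      using z by (simp add: c_def power_int_diff)
    also have "\<dots> = (\<Sum>e\<in>(\<lambda>i. int i - int m) ` {..degree P}. c e * z powi e)"
      by (subst sum.reindex) (auto simp: inj_on_def)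
    also have "\<dots> = laurent_sum c z"
      by (rule laurent_sum_superset[symmetric]) (use support in auto)
    finally show ?thesis .
  qed
  moreover have "finite {e. c e \<noteq> 0}"
    by (rule finite_subset[of _ "(\<lambda>i. int i - int m) ` {..degree P}"]) (use support in auto)
  ultimately show ?thesis
    using that by blast
qed

lemma laurent_sum_scale:
  assumes "finite {e. c e \<noteq> 0}" "w \<noteq> 0"
  shows "a * laurent_sum c (w * z) = laurent_sum (\<lambda>e. a * w powi e * c e) z"
  using laurent_sum_superset[of "{e. c e \<noteq> 0}" "\<lambda>e. a * w powi e * c e" z] assms
  by (simp add: laurent_sum_def sum_distrib_left power_int_mult_distrib mult_ac)

lemma mellin_head_laurent_sum:
  assumes finite: "finite {e. c e \<noteq> 0}" and s: "\<And>e. c e \<noteq> 0 \<Longrightarrow> Re s + real_of_int e > 0"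
  shows "set_integrable lborel {0<..<1} (mellin_integrand (\<lambda>y. laurent_sum c (of_real y)) s)"
    and "mellin_head (\<lambda>y. laurent_sum c (of_real y)) s = polar_sum c s"
proof -
  let ?u = "\<lambda>e y. c e * mellin_integrand (\<lambda>y. of_real y powi e) s y"
  have eq: "mellin_integrand (\<lambda>y. laurent_sum c (of_real y)) s = (\<lambda>y. \<Sum>e | c e \<noteq> 0. ?u e y)"
    by (simp add: laurent_sum_def mellin_integrand_sum mellin_integrand_cmult)
  have integrable: "set_integrable lborel {0<..<1} (?u e)" if "e \<in> {e. c e \<noteq> 0}" for e
    using mellin_head_powi_integrable[of s e] s that by (intro set_integrable_mult_right) auto
  thus "set_integrable lborel {0<..<1} (mellin_integrand (\<lambda>y. laurent_sum c (of_real y)) s)"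
    unfolding eq set_integrable_def scaleR_sum_right by (intro Bochner_Integration.integrable_sum)
  have "mellin_head (\<lambda>y. laurent_sum c (of_real y)) s =
      (\<Sum>e | c e \<noteq> 0. set_lebesgue_integral lborel {0<..<1} (?u e))"
    using integrable
    unfolding mellin_head_def eq set_integrable_def set_lebesgue_integral_def scaleR_sum_right
    by (intro Bochner_Integration.integral_sum)
  also have "\<dots> = polar_sum c s"
    unfolding polar_sum_def
  proof (rule sum.cong[OF refl])
    fix e assume "e \<in> {e. c e \<noteq> 0}"
    hence "mellin_head (\<lambda>y. of_real y powi e) s = 1 / (s + of_int e)"
      using s by (intro mellin_head_powi) auto
    thus "set_lebesgue_integral lborel {0<..<1} (?u e) = c e / (s + of_int e)"
      by (simp add: set_integral_mult_right mellin_head_def)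
  qed
  finally show "mellin_head (\<lambda>y. laurent_sum c (of_real y)) s = polar_sum c s" .
qed


subsection \<open>The remainder term of a Mellin transform\<close>

lemma meromorphic_on_eventually_eq:
  assumes f: "f meromorphic_on A" and g: "g meromorphic_on A" and A: "open A" "connected A"
    and B: "open B" "B \<subseteq> A" "x \<in> B" and eq: "\<And>z. z \<in> B \<Longrightarrow> f z = g z" and z: "z \<in> A"
  shows "\<forall>\<^sub>F w in at z. f w = g w"
proof -
  have "(\<lambda>z. f z - g z) meromorphic_on A"
    by (intro meromorphic_intros f g)
  hence "(\<forall>\<^sub>\<approx>z\<in>A. f z - g z = 0) \<or> (\<forall>\<^sub>\<approx>z\<in>A. f z - g z \<noteq> 0)"
    using A by (rule meromorphic_imp_constant_or_avoid)
  moreover have "\<not> (\<forall>\<^sub>\<approx>z\<in>A. f z - g z \<noteq> 0)"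
  proof
    assume "\<forall>\<^sub>\<approx>z\<in>A. f z - g z \<noteq> 0"
    hence "\<forall>\<^sub>F z in at x. f z - g z \<noteq> 0"
      using A(1) B by (auto simp: eventually_cosparse_open_eq)
    moreover have "\<forall>\<^sub>F z in at x. z \<in> B"
      using B by (intro eventually_at_in_open')
    ultimately have "\<forall>\<^sub>F z in at x. False"
      by eventually_elim (use eq in simp)
    thus False
      by simp
  qed
  ultimately have "\<forall>\<^sub>F w in at z. f w - g w = 0"
    using A(1) z by (auto simp: eventually_cosparse_open_eq)
  thus ?thesis
    by simp
qed

lemma nicely_meromorphic_on_eqI:
  assumes f: "f nicely_meromorphic_on A" "z \<in> A" and g: "isCont g z"
    and eq: "\<forall>\<^sub>F w in at z. f w = g w"
  shows "f z = g z"
proof -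
  have lim: "(f \<longlongrightarrow> g z) (at z)"
    using g eq by (simp add: isCont_def filterlim_cong)
  hence "\<not> is_pole f z"
    using not_tendsto_and_filterlim_at_infinity[of "at z" f "g z"] by (auto simp: is_pole_def)
  hence "(f \<longlongrightarrow> f z) (at z)"
    using f by (auto simp: nicely_meromorphic_on_def)
  thus ?thesis
    using lim by (intro tendsto_unique[of "at z"]) auto
qed

text \<open>The data of an automorphic integral on the imaginary axis: \<open>f\<close>, \<open>t\<close> and \<open>laurent_sum c\<close> stand
  for the values of \<open>F\<close>, \<open>q\<^sup>*\<close> and \<open>c\<^sub>0 q\<^sub>0\<close> at \<open>\<i>y\<close>.\<close>

locale ray_integral =
  fixes k :: nat and f t :: "real \<Rightarrow> complex" and c :: "int \<Rightarrow> complex"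
  assumes f_cont: "continuous_on {0<..} f"
    and f_decay: "\<exists>\<kappa>>0. \<exists>C. \<forall>y\<ge>1. norm (f y) \<le> C * exp (- \<kappa> * y)"
    and t_decays: "decays (2 * real k) t"
    and t_reflect: "y > 0 \<Longrightarrow> t (1 / y) = of_real y ^ (2 * k) * t y"
    and finite_c: "finite {e. c e \<noteq> 0}"
    and f_reflect: "y > 0 \<Longrightarrow>
      f (1 / y) = - (of_real y ^ (2 * k) * (f y + t y + laurent_sum c (of_real y)))"
begin

abbreviation weight :: complex where
  "weight \<equiv> of_nat (2 * k)"

lemma f_cont_tail: "continuous_on {1..} f"
  by (rule continuous_on_subset[OF f_cont]) auto

lemma f_powr_decay: "\<exists>C. \<forall>y\<ge>1. norm (f y) \<le> C * y powr (- e)"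
proof -
  obtain \<kappa> C where "\<kappa> > 0" "\<forall>y\<ge>1. norm (f y) \<le> C * exp (- \<kappa> * y)"
    using f_decay by blast
  thus ?thesis
    by (intro exp_decay_imp_powr_decay) auto
qed

lemma f_tail_integrable: "set_integrable lborel {1..} (mellin_integrand f s)"
proof -
  obtain C where "\<forall>y\<ge>1. norm (f y) \<le> C * y powr (- (Re s + 1))"
    using f_powr_decay by blast
  thus ?thesis
    by (intro mellin_tail_integrable[OF f_cont_tail, of C "Re s + 1"]) auto
qed

lemma mellin_tail_f_holomorphic: "mellin_tail f holomorphic_on A"
proof -
  have "mellin_tail f field_differentiable at s" for s
  proof -
    obtain C where "\<forall>y\<ge>1. norm (f y) \<le> C * y powr (- (Re s + 1))"
      using f_powr_decay by blast
    hence "mellin_tail f holomorphic_on {z. Re z < Re s + 1}"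
      by (intro mellin_tail_holomorphic[OF f_cont_tail]) auto
    thus ?thesis
      by (rule holomorphic_on_imp_differentiable_at) (auto simp: open_halfspace_Re_lt)
  qed
  thus ?thesis
    by (simp add: holomorphic_on_def field_differentiable_at_within)
qed

lemma mellin_tail_t_holomorphic: "mellin_tail t holomorphic_on {s. Re s < 2 * real k}"
  by (rule mellin_tail_holomorphic_decays[OF t_decays])

lemma mellin_tail_add:
  assumes "Re s < 2 * real k"
  shows "mellin_tail (\<lambda>y. f y + t y) s = mellin_tail f s + mellin_tail t s"
  unfolding mellin_tail_def mellin_integrand_add
  using f_tail_integrable mellin_tail_integrable_decays[OF t_decays assms]
  by (rule set_integral_add)

lemma laurent_sum_reflect:
  assumes y: "y > 0"
  shows "laurent_sum c (of_real (1 / y)) = of_real y ^ (2 * k) * laurent_sum c (of_real y)"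
proof -
  define r where "r y = laurent_sum c (of_real y)" for y :: real
  define Y where "Y = complex_of_real y ^ (2 * k)"
  have "f (1 / (1 / y)) = - (of_real (1 / y) ^ (2 * k) * (f (1 / y) + t (1 / y) + r (1 / y)))"
    using f_reflect[of "1 / y"] y by (simp add: r_def)
  hence "Y * f y = - (f (1 / y) + t (1 / y) + r (1 / y))"
    using y by (simp add: Y_def power_divide field_simps)
  moreover have "f (1 / y) = - (Y * (f y + t y + r y))" "t (1 / y) = Y * t y"
    using f_reflect[OF y] t_reflect[OF y] by (simp_all add: r_def Y_def)
  ultimately have "r (1 / y) = Y * r y"
    by (simp add: algebra_simps)
  thus ?thesis
    by (simp add: r_def Y_def)
qed

lemma polar_sum_reflect: "polar_sum c s + polar_sum c (weight - s) = 0"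
proof -
  have "laurent_sum c (of_real (1 / y)) = of_real y powi int (2 * k) * laurent_sum c (of_real y)"
    if "y > 0" for y
    using laurent_sum_reflect[OF that] by (simp only: power_int_of_nat)
  thus ?thesis
    using polar_sum_cancel[OF finite_c, of "int (2 * k)" s] by simp
qed

lemma mellin_head_f:
  assumes integrable: "set_integrable lborel {0<..<1} (mellin_integrand f s)"
    and s: "\<And>e. c e \<noteq> 0 \<Longrightarrow> Re s + real_of_int e > 0"
  shows "mellin_head f s = - mellin_tail (\<lambda>y. f y + t y) (weight - s) - polar_sum c s"
proof -
  let ?r = "\<lambda>y. laurent_sum c (of_real y)"
  note laurent = mellin_head_laurent_sum[OF finite_c s]
  have "continuous_on {1..} (\<lambda>y. f y + t y)"
    using decays_tail[OF t_decays] by (metis continuous_on_add f_cont_tail)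
  hence "mellin_tail (\<lambda>y. f y + t y) (weight - s) =
      mellin_head (\<lambda>y. f (1 / y) + t (1 / y)) (s - weight)"
    using mellin_head_inversion[of "\<lambda>y. f y + t y" "s - weight"] by simp
  also have "\<dots> = mellin_head (\<lambda>y. of_real y powi (- int (2 * k)) * (f (1 / y) + t (1 / y))) s"
    by (simp add: mellin_head_powi_mult)
  also have "\<dots> = (LINT y:{0<..<1}|lborel. - mellin_integrand f s y - mellin_integrand ?r s y)"
    unfolding mellin_head_def
  proof (rule set_lebesgue_integral_cong, simp, intro allI impI)
    fix y :: real
    assume "y \<in> {0<..<1}"
    hence y: "y > 0"
      by simp
    have reflect: "of_real y powi (- int (2 * k)) * (f (1 / y) + t (1 / y)) = - f y - ?r y"
      using y by (simp add: f_reflect t_reflect power_int_minus power_int_of_nat field_simps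
          del: of_nat_mult)
    thus "mellin_integrand (\<lambda>y. of_real y powi (- int (2 * k)) * (f (1 / y) + t (1 / y))) s y =
        - mellin_integrand f s y - mellin_integrand ?r s y"
      unfolding mellin_integrand_def reflect by (simp add: left_diff_distrib diff_divide_distrib)
  qed
  also have "\<dots> = - mellin_head f s - mellin_head ?r s"
    using integrable laurent(1) unfolding mellin_head_def
    by (subst set_integral_diff) (auto simp: set_integral_uminus set_integrable_def)
  finally show ?thesis
    by (simp add: laurent(2))
qed

definition continuation :: "complex \<Rightarrow> complex" where
  "continuation s =
     mellin_tail f s - mellin_tail f (weight - s) - mellin_tail t (weight - s) - polar_sum c s"

lemma mellin_f_eq_continuation:
  assumes integrable: "set_integrable lborel {0<..} (mellin_integrand f s)" and s: "Re s > 0"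
    and exponents: "\<And>e. c e \<noteq> 0 \<Longrightarrow> Re s + real_of_int e > 0"
  shows "mellin f s = continuation s"
proof -
  have "set_integrable lborel {0<..<1} (mellin_integrand f s)"
    by (rule set_integrable_subset[OF integrable]) auto
  hence "mellin_head f s = - mellin_tail (\<lambda>y. f y + t y) (weight - s) - polar_sum c s"
    using exponents by (rule mellin_head_f)
  also have "mellin_tail (\<lambda>y. f y + t y) (weight - s) =
      mellin_tail f (weight - s) + mellin_tail t (weight - s)"
    using s by (intro mellin_tail_add) simp
  finally show ?thesis
    by (simp add: mellin_split[OF integrable] continuation_def)
qed

lemma mellin_tail_t_reflected_holomorphic:
  "A \<subseteq> {s. Re s > 0} \<Longrightarrow> (\<lambda>s. mellin_tail t (weight - s)) holomorphic_on A"
  by (rule holomorphic_on_compose_gen[OF _ mellin_tail_t_holomorphic, unfolded o_def])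
    (auto intro!: holomorphic_intros)

lemma continuation_meromorphic: "continuation meromorphic_on {s. Re s > 0}"
proof -
  have meromorphic: "g meromorphic_on {s. Re s > 0}" if "g holomorphic_on {s. Re s > 0}" for g
    using that
    by (intro analytic_on_imp_meromorphic_on) (simp add: analytic_on_open open_halfspace_Re_gt)
  have "(\<lambda>s. mellin_tail f (weight - s)) holomorphic_on {s. Re s > 0}"
    by (rule holomorphic_on_compose_gen[OF _ mellin_tail_f_holomorphic[of UNIV], unfolded o_def])
      (auto intro!: holomorphic_intros)
  thus ?thesis
    unfolding continuation_def[abs_def] polar_sum_def[abs_def]
    by (intro meromorphic_intros meromorphic mellin_tail_f_holomorphic
        mellin_tail_t_reflected_holomorphic) auto
qed

lemma eventually_eq_continuation:
  assumes \<Phi>: "\<Phi> meromorphic_on UNIV"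
    and \<sigma>: "\<And>s. Re s > \<sigma> \<Longrightarrow> set_integrable lborel {0<..} (mellin_integrand f s) \<and> \<Phi> s = mellin f s"
    and s: "Re s > 0"
  shows "\<forall>\<^sub>F z in at s. \<Phi> z = continuation z"
proof -
  define X where "X = {0, \<sigma>} \<union> (\<lambda>e. - real_of_int e) ` {e. c e \<noteq> 0}"
  define M where "M = Max X"
  have "x \<le> M" if "x \<in> X" for x
    unfolding M_def using finite_c that by (intro Max_ge) (auto simp: X_def)
  hence M: "0 \<le> M" "\<sigma> \<le> M" "\<And>e. c e \<noteq> 0 \<Longrightarrow> - real_of_int e \<le> M"
    by (auto simp: X_def)
  show ?thesis
  proof (rule meromorphic_on_eventually_eq[where A = "{s. Re s > 0}" and B = "{s. Re s > M}"])
    show "\<Phi> meromorphic_on {s. Re s > 0}"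
      by (rule meromorphic_on_subset[OF \<Phi>]) auto
    show "connected {s. Re s > 0}"
      by (intro convex_connected convex_halfspace_Re_gt)
    show "of_real (M + 1) \<in> {s. Re s > M}"
      by simp
    fix z assume "z \<in> {s. Re s > M}"
    hence "Re z > M"
      by simp
    hence "Re z > \<sigma>" "Re z > 0" and "\<And>e. c e \<noteq> 0 \<Longrightarrow> Re z + real_of_int e > 0"
      using M by fastforce+
    thus "\<Phi> z = continuation z"
      using \<sigma> mellin_f_eq_continuation by simp
  qed (use M s continuation_meromorphic in \<open>auto simp: open_halfspace_Re_gt\<close>)
qed

lemma isCont_mellin_tail_t_symmetrized:
  assumes "0 < Re s" "Re s < 2 * real k"
  shows "isCont (\<lambda>z. mellin_tail t z + mellin_tail t (weight - z)) s"
proof -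
  define A where "A = {z. 0 < Re z} \<inter> {z. Re z < 2 * real k}"
  have "(\<lambda>z. mellin_tail t z + mellin_tail t (weight - z)) holomorphic_on A"
    by (intro holomorphic_intros mellin_tail_t_reflected_holomorphic
        holomorphic_on_subset[OF mellin_tail_t_holomorphic]) (auto simp: A_def)
  moreover have "open A" "s \<in> A"
    using assms by (auto simp: A_def open_halfspace_Re_lt open_halfspace_Re_gt)
  ultimately show ?thesis
    using holomorphic_on_imp_continuous_on continuous_on_eq_continuous_at by blast
qed

theorem remainder_term_eq:
  assumes \<Phi>: "\<Phi> nicely_meromorphic_on UNIV"
    and \<sigma>: "\<And>s. Re s > \<sigma> \<Longrightarrow> set_integrable lborel {0<..} (mellin_integrand f s) \<and> \<Phi> s = mellin f s"
    and R: "remainder_term k \<Phi> R"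
    and s: "0 < Re s" "Re s < 2 * real k"
  shows "R s = - mellin t s"
proof -
  define G where "G z = - (mellin_tail t z + mellin_tail t (weight - z))" for z
  have mero: "\<Phi> meromorphic_on UNIV"
    using \<Phi> by (simp add: nicely_meromorphic_on_def)
  have reflect: "filterlim (\<lambda>z. weight - z) (at (weight - s)) (at s)"
    by (rule filterlim_atI) (auto intro!: tendsto_intros simp: eventually_at_filter)
  have continuation: "\<forall>\<^sub>F z in at x. \<Phi> z = continuation z" if "Re x > 0" for x
    using eventually_eq_continuation[OF mero \<sigma> that] .
  have no_pole: "\<forall>\<^sub>F z in at x. \<not> is_pole \<Phi> z" for x
    by (intro eventually_not_pole meromorphic_on_isolated_singularity
        meromorphic_on_subset[OF mero]) auto
  have "\<forall>\<^sub>F z in at s. \<Phi> (weight - z) = continuation (weight - z)"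
    "\<forall>\<^sub>F z in at s. \<not> is_pole \<Phi> (weight - z)"
    using s eventually_compose_filterlim[OF continuation reflect]
      eventually_compose_filterlim[OF no_pole reflect] by simp_all
  with continuation[OF s(1)] no_pole[of s] have "\<forall>\<^sub>F z in at s. R z = G z"
  proof eventually_elim
    case (elim z)
    have "R z = \<Phi> (weight - z) + \<Phi> z"
      using R elim(2,4) by (simp add: remainder_term_def)
    also have "\<dots> = G z - (polar_sum c z + polar_sum c (weight - z))"
      unfolding elim(1,3) continuation_def by (simp add: G_def)
    finally show ?case
      using polar_sum_reflect[of z] by simp
  qed
  moreover have "isCont G s"
    unfolding G_def using s by (intro continuous_intros isCont_mellin_tail_t_symmetrized)
  ultimately have "R s = G s"
    using R by (intro nicely_meromorphic_on_eqI[where A = UNIV]) (auto simp: remainder_term_def)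
  thus ?thesis
    by (simp add: G_def mellin_reflect[OF t_decays s t_reflect])
qed

end


subsection \<open>The remainder term of an automorphic integral\<close>

definition hecke_kernel :: "nat \<Rightarrow> real \<Rightarrow> real \<Rightarrow> real \<Rightarrow> complex" where
  "hecke_kernel k a b y =
     of_real (a - b) ^ k / ((\<i> * of_real y - of_real a) ^ k * (\<i> * of_real y - of_real b) ^ k)"

lemma hecke_R_eq_mellin: "hecke_R k s a b = mellin (hecke_kernel k a b) s"
  unfolding hecke_R_def mellin_def set_integral_mult_right[symmetric]
  by (rule set_lebesgue_integral_cong) (auto simp: mellin_integrand_def hecke_kernel_def)

lemma decays_hecke_kernel:
  assumes "a \<noteq> 0" "b \<noteq> 0"
  shows "decays (2 * real k) (hecke_kernel k a b)"
proof -
  let ?u = "\<lambda>a y. 1 / (\<i> * of_real y - complex_of_real a)"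
  have "decays (real k * 1 + real k * 1) (\<lambda>y. ?u a y ^ k * ?u b y ^ k)"
    by (intro decays_mult decays_power decays_inverse_linear assms)
  hence "decays (2 * real k) (\<lambda>y. of_real (a - b) ^ k * (?u a y ^ k * ?u b y ^ k))"
    by (intro decays_cmult) simp
  thus ?thesis
    by (simp add: hecke_kernel_def[abs_def] power_one_over field_simps)
qed

lemma (in hecke) automorphic_integral_ray_decay:
  assumes "entire_automorphic_integral p k F a q" "a 0 = 0"
  shows "\<exists>\<kappa>>0. \<exists>C. \<forall>y\<ge>1. norm (F (\<i> * of_real y)) \<le> C * exp (- \<kappa> * y)"
proof (rule exI[of _ "2 * pi / hecke_lambda p"], rule conjI)
  have lambda: "hecke_lambda p > 0"
    using hecke_lambda_ge_1 by simp
  thus "2 * pi / hecke_lambda p > 0"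
    by simp
  show "\<exists>C. \<forall>y\<ge>1. norm (F (\<i> * of_real y)) \<le> C * exp (- (2 * pi / hecke_lambda p) * y)"
    using assms
    by (intro fourier_series_decay[OF lambda, of a]) (auto simp: entire_automorphic_integral_def)
qed

context symmetric_period
begin

lemma q_star_eq:
  "q_star p k L d \<A> z = (\<Sum>l=1..L. d l * (\<Sum>Q\<in>simple_forms (\<A> l). 1 / bqf_eval Q z 1 ^ k))"
  unfolding q_star_def
  by (intro sum.cong refl arg_cong2[where f = "(*)"] symmetric_class.sum_Z_set[OF symmetric_class,
      of _ "\<lambda>a Q b. 1 / bqf_eval Q z 1 ^ k"])

lemma q_star_reflect:
  assumes "z \<noteq> 0"
  shows "q_star p k L d \<A> (- 1 / z) = - (z ^ (2 * k)) * q_star p k L d \<A> z"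
proof -
  have "q_star p k L d \<A> (- 1 / z) =
      (\<Sum>l=1..L. d l * (- (z ^ (2 * k)) * (\<Sum>Q\<in>simple_forms (\<A> l). 1 / bqf_eval Q z 1 ^ k)))"
    unfolding q_star_eq by (intro sum.cong refl arg_cong2[where f = "(*)"]
        symmetric_class.sum_bqf_eval_reflect[OF symmetric_class] odd_k assms)
  thus ?thesis
    unfolding q_star_eq sum_distrib_left by (simp only: mult.left_commute)
qed

lemma q_star_ray:
  "q_star p k L d \<A> (\<i> * of_real y) = (\<Sum>l=1..L. \<Sum>Q\<in>simple_forms (\<A> l).
     remainder_coeff l * hecke_kernel k (alpha_of Q) (conj_root Q) y)"
proof -
  have "d l * (1 / bqf_eval Q (\<i> * of_real y) 1 ^ k) =
      remainder_coeff l * hecke_kernel k (alpha_of Q) (conj_root Q) y"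
    if "l \<in> {1..L}" "Q \<in> simple_forms (\<A> l)" for l Q
    using symmetric_class.bqf_eval_eq_linear_factors[OF symmetric_class[OF that(1)], of Q "D l"]
      disc that by (simp add: simple_forms_def hecke_kernel_def remainder_coeff_def)
  thus ?thesis
    unfolding q_star_eq sum_distrib_left by (intro sum.cong refl) auto
qed

lemma decays_hecke_kernel_roots:
  assumes "l \<in> {1..L}" "Q \<in> simple_forms (\<A> l)"
  shows "decays (2 * real k) (hecke_kernel k (alpha_of Q) (conj_root Q))"
proof (rule decays_hecke_kernel)
  interpret symmetric_class p "\<A> l"
    by (rule symmetric_class[OF assms(1)])
  have Q: "Q \<in> \<A> l"
    using assms(2) by (simp add: simple_forms_def)
  have "fst Q * (alpha_of Q * conj_root Q) = snd (snd Q)"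
    using bqf_of_roots_collapse[of Q] outer_coeffs_neq_0(1)[OF Q] roots(3)[OF Q]
    by (metis bqf_of_roots_nth(2))
  thus "alpha_of Q \<noteq> 0" "conj_root Q \<noteq> 0"
    using outer_coeffs_neq_0(2)[OF Q] by auto
qed

lemma decays_q_star: "decays (2 * real k) (\<lambda>y. q_star p k L d \<A> (\<i> * of_real y))"
  unfolding q_star_ray by (intro decays_sum decays_cmult) (rule decays_hecke_kernel_roots)

lemma R_eval_R_remainder_eq_mellin:
  assumes s: "0 < Re s" "Re s < 2 * real k"
  shows "R_eval k (R_remainder p k L d D \<A>) s = - mellin (\<lambda>y. q_star p k L d \<A> (\<i> * of_real y)) s"
proof -
  let ?u = "\<lambda>l Q y. remainder_coeff l *
    mellin_integrand (hecke_kernel k (alpha_of Q) (conj_root Q)) s y"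
  have integrable: "set_integrable lborel {0<..} (?u l Q)"
    if "l \<in> {1..L}" "Q \<in> simple_forms (\<A> l)" for l Q
    using mellin_integrable_decays[OF decays_hecke_kernel_roots[OF that] s]
    by (intro set_integrable_mult_right) auto
  have "R_eval k (R_remainder p k L d D \<A>) s =
      - (\<Sum>l=1..L. \<Sum>Q\<in>simple_forms (\<A> l). LINT y:{0<..}|lborel. ?u l Q y)"
    by (simp add: R_remainder_eq R_eval.minus R_eval.sum R_eval_single hecke_R_eq_mellin mellin_def
        set_integral_mult_right)
  also have "(\<Sum>l=1..L. \<Sum>Q\<in>simple_forms (\<A> l). LINT y:{0<..}|lborel. ?u l Q y) =
      (LINT y:{0<..}|lborel. \<Sum>l=1..L. \<Sum>Q\<in>simple_forms (\<A> l). ?u l Q y)"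
    using integrable unfolding set_integrable_def set_lebesgue_integral_def scaleR_sum_right
    by (simp add: Bochner_Integration.integral_sum)
  also have "\<dots> = mellin (\<lambda>y. q_star p k L d \<A> (\<i> * of_real y)) s"
    by (simp add: q_star_ray mellin_def mellin_integrand_sum mellin_integrand_cmult)
  finally show ?thesis .
qed

lemma ray_integral_automorphic:
  assumes F: "entire_automorphic_integral p k F a q" and a0: "a 0 = 0"
    and q: "\<And>z. Im z > 0 \<Longrightarrow> q z = q_star p k L d \<A> z + c0 * q0 z"
    and q0: "rational_function q0" "\<And>z. is_pole q0 z \<Longrightarrow> z = 0"
  obtains c where
    "ray_integral k (\<lambda>y. F (\<i> * of_real y)) (\<lambda>y. q_star p k L d \<A> (\<i> * of_real y)) c"
proof -
  obtain b where b: "finite {e. b e \<noteq> 0}" "\<And>z. z \<noteq> 0 \<Longrightarrow> q0 z = laurent_sum b z"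
    using rational_function_laurent[OF q0] by blast
  define c where "c e = c0 * \<i> powi e * b e" for e
  have hol: "F holomorphic_on {z. Im z > 0}"
    and trans: "\<And>z. Im z > 0 \<Longrightarrow> F (- 1 / z) / z ^ (2 * k) = F z + q z"
    using F by (auto simp: entire_automorphic_integral_def)
  have inverse: "- 1 / (\<i> * of_real y) = \<i> * of_real (1 / y)" for y :: real
    by (cases "y = 0") (simp_all add: field_simps)
  have power: "(\<i> * of_real y) ^ (2 * k) = - (of_real y ^ (2 * k))" for y :: real
    using odd_k by (simp add: power_mult_distrib power_mult)
  show ?thesis
  proof (rule that[of c], unfold_locales)
    show "continuous_on {0<..} (\<lambda>y. F (\<i> * of_real y))"
      by (intro continuous_on_compose2[OF holomorphic_on_imp_continuous_on[OF hol]]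
          continuous_intros) auto
    show "\<exists>\<kappa>>0. \<exists>C. \<forall>y\<ge>1. norm (F (\<i> * of_real y)) \<le> C * exp (- \<kappa> * y)"
      using F a0 by (rule automorphic_integral_ray_decay)
    show "decays (2 * real k) (\<lambda>y. q_star p k L d \<A> (\<i> * of_real y))"
      by (rule decays_q_star)
    show "finite {e. c e \<noteq> 0}"
      by (rule finite_subset[OF _ b(1)]) (auto simp: c_def)
    fix y :: real
    assume y: "y > 0"
    show "q_star p k L d \<A> (\<i> * of_real (1 / y)) =
        of_real y ^ (2 * k) * q_star p k L d \<A> (\<i> * of_real y)"
      using q_star_reflect[of "\<i> * of_real y"] y unfolding inverse power by simp
    have "c0 * q0 (\<i> * of_real y) = laurent_sum c (of_real y)"
      using y b(2) laurent_sum_scale[OF b(1), of \<i> c0] by (simp add: c_def[abs_def])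
    hence "F (\<i> * of_real (1 / y)) / - (of_real y ^ (2 * k)) =
        F (\<i> * of_real y) + q_star p k L d \<A> (\<i> * of_real y) + laurent_sum c (of_real y)"
      using trans[of "\<i> * of_real y"] q[of "\<i> * of_real y"] y unfolding inverse power
      by (simp add: add.assoc)
    thus "F (\<i> * of_real (1 / y)) = - (of_real y ^ (2 * k) *
        (F (\<i> * of_real y) + q_star p k L d \<A> (\<i> * of_real y) + laurent_sum c (of_real y)))"
      using y by (subst (asm) nonzero_divide_eq_eq) (auto simp: mult.commute)
  qed
qed

end

theorem theorem2:
  fixes p k L :: nat
    and F q q0 \<Phi> R :: "complex \<Rightarrow> complex"
    and a d :: "nat \<Rightarrow> complex"
    and c0 :: complex
    and D :: "nat \<Rightarrow> real"
    and \<A> :: "nat \<Rightarrow> bqf set"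
  assumes p: "p \<ge> 3"
    and k: "odd k"
    and F: "entire_automorphic_integral p k F a q"
    and a0: "a 0 = 0"
    and symm: "hecke_symmetric p q"
    and q: "\<And>z. Im z > 0 \<Longrightarrow> q z = q_star p k L d \<A> z + c0 * q0 z"
    and hyp: "\<And>l. l \<in> {1..L} \<Longrightarrow> hyperbolic_class p (\<A> l)"
    and neg: "\<And>l. l \<in> {1..L} \<Longrightarrow> \<A> l = uminus ` \<A> l"
    and disc: "\<And>l Q. l \<in> {1..L} \<Longrightarrow> Q \<in> \<A> l \<Longrightarrow> bqf_disc Q = D l"
    and q0: "rational_function q0" "\<And>z. is_pole q0 z \<Longrightarrow> z = 0"
    and \<Phi>: "mellin_continuation F \<Phi>"
    and R: "remainder_term k \<Phi> R"
  shows "(\<forall>s. 0 < Re s \<and> Re s < 2 * real k \<longrightarrow>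
            R s = R_eval k (R_remainder p k L d D \<A>) s) \<and>
         (\<forall>s. 0 < Re s \<and> Re s < 2 * real k \<longrightarrow>
            R_eval k (\<Sum>j<p. (rho p ^^ j) (R_remainder p k L d D \<A>)) s = 0)"
proof (intro conjI allI impI)
  interpret symmetric_period p k L d D \<A>
    using p k hyp neg disc by unfold_locales
  fix s :: complex
  assume s: "0 < Re s \<and> Re s < 2 * real k"
  show "R_eval k (\<Sum>j<p. (rho p ^^ j) (R_remainder p k L d D \<A>)) s = 0"
    by (rule R_eval_rho_orbit_sum_eq_0)
  let ?f = "\<lambda>y. F (\<i> * of_real y)" and ?t = "\<lambda>y. q_star p k L d \<A> (\<i> * of_real y)"
  obtain c where "ray_integral k ?f ?t c"
    using ray_integral_automorphic[OF F a0 q q0] by blast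
  moreover have "\<Phi> nicely_meromorphic_on UNIV"
    using \<Phi> by (simp add: mellin_continuation_def)
  moreover obtain \<sigma> where
    "\<And>s. Re s > \<sigma> \<Longrightarrow> set_integrable lborel {0<..} (mellin_integrand ?f s) \<and> \<Phi> s = mellin ?f s"
    using \<Phi> unfolding mellin_continuation_def mellin_def mellin_integrand_def by blast
  ultimately have "R s = - mellin ?t s"
    using ray_integral.remainder_term_eq R s by blast
  also have "\<dots> = R_eval k (R_remainder p k L d D \<A>) s"
    using s by (simp add: R_eval_R_remainder_eq_mellin)
  finally show "R s = R_eval k (R_remainder p k L d D \<A>) s" .
qed

end
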